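(* Let $E$ be a quadratic extension of a non-Archimedean local field $F$ (of characteristic zero) and let $\widetilde{\mathrm{GL}_2(E)}$ be the two-fold metaplectic covering of $\mathrm{GL}_2(E)$. Then: (1) the two-fold metaplectic covering splits over the subgroup $\mathrm{GL}_2(F)$; (2) the $\mathbb C^\times$-covering obtained from $\widetilde{\mathrm{GL}_2(E)}$ splits over the subgroup $D_F^\times$.
   Context: Let $(\cdot,\cdot)$ denote the quadratic Hilbert symbol of $E$. For $g=\begin{pmatrix}a&b\\c&d\end{pmatrix}\in\mathrm{GL}_2(E)$ put $x(g)=c$ if $c\neq0$ and $x(g)=d$ if $c=0$. For $g_1,g_2\in\mathrm{SL}_2(E)$ put $\beta(g_1,g_2)=(x(g_1),x(g_2))\,(-x(g_1)^{-1}x(g_2),x(g_1g_2))$. For $g\in\mathrm{GL}_2(E)$ let $p(g)\in\mathrm{SL}_2(E)$ be defined by $g=\mathrm{diag}(1,\det g)\,p(g)$; for $y\in E^\times$ put $g^y=\mathrm{diag}(1,y^{-1})\,g\,\mathrm{diag}(1,y)$ and $v(y,g)=1$ if $c\neq0$, $v(y,g)=(y,d)$ if $c=0$. Extend $\beta$ by $\beta(g_1,g_2)=\beta(p(g_1)^{\det g_2},p(g_2))\,v(\det g_2,p(g_1))$. The metaplectic cover $\widetilde{\mathrm{GL}_2(E)}$ is $\mathrm{GL}_2(E)\times\{\pm1\}$ with $(g_1,\epsilon_1)(g_2,\epsilon_2)=(g_1g_2,\epsilon_1\epsilon_2\beta(g_1,g_2))$. The $\mathbb C^\times$-covering obtained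 from it is $(\widetilde{\mathrm{GL}_2(E)}\times\mathbb C^\times)/\langle((1,-1),-1)\rangle$, a central extension of $\mathrm{GL}_2(E)$ by $\mathbb C^\times$. $D_F$ is the unique quaternion division algebra with center $F$, and $D_F^\times\hookrightarrow\mathrm{GL}_2(E)$ via a fixed isomorphism $D_F\otimes_FE\cong M_2(E)$ (unique up to $\mathrm{GL}_2(E)$-conjugacy). *)

theory Defs
  imports Complex_Main
begin

text \<open>We work inside an ambient field type 'a of characteristic zero, playing the role of E;
  F is a subfield of it (given as a set).\<close>

definition subfield :: "'a::field set \<Rightarrow> bool" where
  "subfield F \<longleftrightarrow> 0 \<in> F \<and> 1 \<in> F \<and> (\<forall>x\<in>F. \<forall>y\<in>F. x + y \<in> F \<and> x * y \<in> F \<and> x - y \<in> F)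
     \<and> (\<forall>x\<in>F. inverse x \<in> F)"

definition nonarch_local_field :: "'a::field set \<Rightarrow> bool" where
  "nonarch_local_field F \<longleftrightarrow> subfield F \<and> (\<exists>f :: 'a \<Rightarrow> real.
     (\<forall>x\<in>F. f x \<ge> 0 \<and> (f x = 0 \<longleftrightarrow> x = 0)) \<and>
     (\<forall>x\<in>F. \<forall>y\<in>F. f (x * y) = f x * f y \<and> f (x + y) \<le> max (f x) (f y)) \<and>
     (\<exists>x\<in>F. f x \<noteq> 0 \<and> f x \<noteq> 1) \<and>
     (\<exists>c<1. \<forall>x\<in>F. f x < 1 \<longrightarrow> f x \<le> c) \<and>
     (\<forall>u :: nat \<Rightarrow> 'a. (\<forall>n. u n \<in> F) \<and>
        (\<forall>e>0. \<exists>N. \<forall>m\<ge>N. \<forall>n\<ge>N. f (u m - u n) < e) \<longrightarrow>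
        (\<exists>l\<in>F. \<forall>e>0. \<exists>N. \<forall>n\<ge>N. f (u n - l) < e)) \<and>
     (\<exists>R. finite R \<and> R \<subseteq> {x\<in>F. f x \<le> 1} \<and>
        (\<forall>x\<in>F. f x \<le> 1 \<longrightarrow> (\<exists>r\<in>R. f (x - r) < 1))))"

definition quadratic_ext :: "'a::field set \<Rightarrow> bool" where
  "quadratic_ext F \<longleftrightarrow> subfield F \<and>
     (\<exists>\<theta>. \<theta> \<notin> F \<and> (\<forall>x. \<exists>a\<in>F. \<exists>b\<in>F. x = a + b * \<theta>))"

definition hilbert :: "'a::field \<Rightarrow> 'a \<Rightarrow> int" where
  "hilbert a b = (if \<exists>x y z. (x, y, z) \<noteq> (0, 0, 0) \<and> a * x^2 + b * y^2 = z^2 then 1 else -1)"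

datatype 'a mat2 = M2 (m11: 'a) (m12: 'a) (m21: 'a) (m22: 'a)

definition mmul :: "'a::field mat2 \<Rightarrow> 'a mat2 \<Rightarrow> 'a mat2" where
  "mmul g h = M2 (m11 g * m11 h + m12 g * m21 h) (m11 g * m12 h + m12 g * m22 h)
                 (m21 g * m11 h + m22 g * m21 h) (m21 g * m12 h + m22 g * m22 h)"

definition madd :: "'a::field mat2 \<Rightarrow> 'a mat2 \<Rightarrow> 'a mat2" where
  "madd g h = M2 (m11 g + m11 h) (m12 g + m12 h) (m21 g + m21 h) (m22 g + m22 h)"

definition mscal :: "'a::field \<Rightarrow> 'a mat2 \<Rightarrow> 'a mat2" where
  "mscal c g = M2 (c * m11 g) (c * m12 g) (c * m21 g) (c * m22 g)"

definition mdet :: "'a::field mat2 \<Rightarrow> 'a" where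
  "mdet g = m11 g * m22 g - m12 g * m21 g"

definition mone :: "'a::field mat2" where "mone = M2 1 0 0 1"
definition mzero :: "'a::field mat2" where "mzero = M2 0 0 0 0"

definition GL2_over :: "'a::field set \<Rightarrow> 'a mat2 set" where
  "GL2_over F = {g. m11 g \<in> F \<and> m12 g \<in> F \<and> m21 g \<in> F \<and> m22 g \<in> F \<and> mdet g \<noteq> 0}"

definition xg :: "'a::field mat2 \<Rightarrow> 'a" where
  "xg g = (if m21 g \<noteq> 0 then m21 g else m22 g)"

definition beta_SL :: "'a::field mat2 \<Rightarrow> 'a mat2 \<Rightarrow> int" where
  "beta_SL g1 g2 = hilbert (xg g1) (xg g2) * hilbert (- inverse (xg g1) * xg g2) (xg (mmul g1 g2))"

text \<open>p(g) with g = diag(1, det g) p(g).\<close>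
definition pg :: "'a::field mat2 \<Rightarrow> 'a mat2" where
  "pg g = M2 (m11 g) (m12 g) (m21 g / mdet g) (m22 g / mdet g)"

text \<open>g^y = diag(1,y^-1) g diag(1,y).\<close>
definition conj_y :: "'a::field \<Rightarrow> 'a mat2 \<Rightarrow> 'a mat2" where
  "conj_y y g = M2 (m11 g) (m12 g * y) (m21 g / y) (m22 g)"

definition vfac :: "'a::field \<Rightarrow> 'a mat2 \<Rightarrow> int" where
  "vfac y g = (if m21 g \<noteq> 0 then 1 else hilbert y (m22 g))"

definition beta :: "'a::field mat2 \<Rightarrow> 'a mat2 \<Rightarrow> int" where
  "beta g1 g2 = beta_SL (conj_y (mdet g2) (pg g1)) (pg g2) * vfac (mdet g2) (pg g1)"

text \<open>The two-fold cover (with multiplication (g1,e1)(g2,e2) = (g1g2, e1 e2 beta(g1,g2)))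
  splits over H iff there is a section g \<mapsto> (g, s g) which is a homomorphism on H.\<close>
definition splits_twofold :: "'a::field mat2 set \<Rightarrow> bool" where
  "splits_twofold H \<longleftrightarrow> (\<exists>s :: 'a mat2 \<Rightarrow> int. (\<forall>g\<in>H. s g \<in> {1, -1}) \<and>
     (\<forall>g1\<in>H. \<forall>g2\<in>H. s (mmul g1 g2) = s g1 * s g2 * beta g1 g2))"

text \<open>The C^*-covering: classes [(g,e),z] = [(g,1), e z]; it splits over H iff there is a
  map s : H \<rightarrow> C^* with g \<mapsto> [(g,1), s g] a homomorphism.\<close>
definition splits_Cstar :: "'a::field mat2 set \<Rightarrow> bool" where
  "splits_Cstar H \<longleftrightarrow> (\<exists>s :: 'a mat2 \<Rightarrow> complex. (\<forall>g\<in>H. s g \<noteq> 0) \<and>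
     (\<forall>g1\<in>H. \<forall>g2\<in>H. s (mmul g1 g2) = s g1 * s g2 * of_int (beta g1 g2)))"

text \<open>A is (the image of) the quaternion division algebra D_F: an F-subalgebra of M_2(E)
  of F-dimension 4, which is a division algebra with centre exactly F (scalars).
  Such an A is a central division algebra of dimension 4 over F, hence isomorphic to the
  unique quaternion division algebra D_F, and A \<otimes>_F E \<cong> M_2(E) via multiplication.\<close>
definition is_DF_image :: "'a::field set \<Rightarrow> 'a mat2 set \<Rightarrow> bool" where
  "is_DF_image F A \<longleftrightarrow>
     mone \<in> A \<and>
     (\<forall>a\<in>A. \<forall>b\<in>A. madd a b \<in> A \<and> mmul a b \<in> A) \<and>
     (\<forall>c\<in>F. \<forall>a\<in>A. mscal c a \<in> A) \<and>
     (\<exists>b :: nat \<Rightarrow> 'a mat2. (\<forall>i<4. b i \<in> A) \<and>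
        (\<forall>c :: nat \<Rightarrow> 'a. (\<forall>i<4. c i \<in> F) \<and>
           madd (madd (mscal (c 0) (b 0)) (mscal (c 1) (b 1)))
                (madd (mscal (c 2) (b 2)) (mscal (c 3) (b 3))) = mzero
           \<longrightarrow> (\<forall>i<4. c i = 0)) \<and>
        (\<forall>a\<in>A. \<exists>c :: nat \<Rightarrow> 'a. (\<forall>i<4. c i \<in> F) \<and>
           a = madd (madd (mscal (c 0) (b 0)) (mscal (c 1) (b 1)))
                    (madd (mscal (c 2) (b 2)) (mscal (c 3) (b 3))))) \<and>
     (\<forall>a\<in>A. a \<noteq> mzero \<longrightarrow> (\<exists>b\<in>A. mmul a b = mone)) \<and>
     {a\<in>A. \<forall>b\<in>A. mmul a b = mmul b a} = {mscal c mone | c. c \<in> F}"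

end

theory Submission
  imports Defs "HOL-Library.Product_Plus" "HOL-Algebra.Group"
begin

text \<open>
  A quadratic form over a local field that is anisotropic makes the underlying space a normed space
  whose residue forms are anisotropic; by completeness every anisotropic ternary form therefore
  contains a multiple of the norm form of the unramified quadratic extension. Since units are norms
  from that extension, this yields bilinearity and nondegeneracy of the Hilbert symbol in every
  residue characteristic. Consequently every quaternion algebra over F splits over E, so the symbol of E is
  trivial on F and the Kubota cocycle is identically 1 on matrices over F.

  For the quaternion algebra D, write an element as a pair (c, d), its bottom row in M_2(E). On D the
  cocycle becomes (x_1, x_2)(-x_1 x_2, x_3)(N_1, x_1 x_3) with x_i the Kubota coordinates and N_1 the
  reduced norm. On the norm one group it is the coboundary of an explicit sign function, whose graph is
  a normal subgroup of the cover. Modulo this subgroup the elements of E are central, and since the norms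
  from E have index two in the nonzero elements of F the quotient is abelian. Hence the genuine
  character of the preimage of the norm one group extends to the cover of D, because the group of
  nonzero complex numbers is divisible.
\<close>

section \<open>Hilbert symbols and complete discretely valued fields\<close>

text \<open>Every estimate has to survive 2 being a non-unit. This is why the unramified extension
  is cut out by t^2 - t - \<open>rho\<close>, whose linear coefficient is always a unit, why
  bilinear forms are polar forms rather than their halves, and why Hensel's lemma is used for
  quadratic polynomials with a dominant linear coefficient. Symbols of E and F are linked by the
  projection formula (a, x)_E = (a, N x)_F for a in F, which moves every symbol with one entry in F
  down to F. The sign function on the norm one group comes from trace zero quaternions: for one of
  norm n with nonzero lower left entry r, the symbol (r, -n)_E depends on n alone. Cayley transforms
  carry this to norm one elements. The splitting is not continued to D by a formula: the extension
  takes complex roots. All it needs is that commutators in the cover of D lie in the graph over the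
  norm one group.\<close>

definition hil :: "'a::field set \<Rightarrow> 'a \<Rightarrow> 'a \<Rightarrow> bool" where
  "hil K a b \<longleftrightarrow> (\<exists>x\<in>K. \<exists>y\<in>K. \<exists>z\<in>K. (x, y, z) \<noteq> (0, 0, 0) \<and> a * x^2 + b * y^2 = z^2)"

text \<open>The symbol of E is the case \<open>K = UNIV\<close>; carrying the field as a set lets
  the symbols of F and E share all lemmas.\<close>

lemma hilbert_hil: "hilbert a b = (if hil UNIV a b then 1 else -1)"
  unfolding hilbert_def hil_def by simp

locale subfield_char0 =
  fixes K :: "'a::field_char_0 set"
  assumes subfield_K: "subfield K"
begin

lemma zero_K [simp, intro]: "0 \<in> K" and one_K [simp, intro]: "1 \<in> K"
  using subfield_K unfolding subfield_def by auto

lemma add_K [simp, intro]: "x \<in> K \<Longrightarrow> y \<in> K \<Longrightarrow> x + y \<in> K"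
  and mult_K [simp, intro]: "x \<in> K \<Longrightarrow> y \<in> K \<Longrightarrow> x * y \<in> K"
  and diff_K [simp, intro]: "x \<in> K \<Longrightarrow> y \<in> K \<Longrightarrow> x - y \<in> K"
  and inverse_K [simp, intro]: "x \<in> K \<Longrightarrow> inverse x \<in> K"
  using subfield_K unfolding subfield_def by auto

lemma uminus_K [simp, intro]: "x \<in> K \<Longrightarrow> - x \<in> K"
  using diff_K[of 0 x] by simp

lemma divide_K [simp, intro]: "x \<in> K \<Longrightarrow> y \<in> K \<Longrightarrow> x / y \<in> K"
  by (simp add: divide_inverse)

lemma power_K [simp, intro]: "x \<in> K \<Longrightarrow> x ^ n \<in> K"
  by (induction n) auto

lemma of_nat_K [simp, intro]: "of_nat n \<in> K"
  by (induction n) auto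

lemma numeral_K [simp, intro]: "numeral n \<in> K"
  using of_nat_K[of "numeral n"] by simp

lemma hil_sym: "hil K a b \<longleftrightarrow> hil K b a"
  unfolding hil_def by (metis add.commute prod.inject)

text \<open>A solution with y nonzero exhibits b as a norm from K(sqrt a). When y = 0 the element a
  is a square, and then the norm form is hyperbolic and represents everything.\<close>

lemma hil_iff_norm:
  assumes "a \<in> K" "b \<in> K" "a \<noteq> 0"
  shows "hil K a b \<longleftrightarrow> (\<exists>x\<in>K. \<exists>y\<in>K. b = x^2 - a * y^2)"
proof
  assume "hil K a b"
  then obtain x y z where xyz: "x \<in> K" "y \<in> K" "z \<in> K" "(x, y, z) \<noteq> (0, 0, 0)"
    "a * x^2 + b * y^2 = z^2"
    unfolding hil_def by blast
  show "\<exists>x\<in>K. \<exists>y\<in>K. b = x^2 - a * y^2"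
  proof (cases "y = 0")
    case False
    have "b = (z / y)^2 - a * (x / y)^2"
      using xyz(5) False by (simp add: field_simps)
    then show ?thesis using xyz by blast
  next
    case True
    then have x: "x \<noteq> 0" using xyz by auto
    have a: "a = (z / x)^2" using xyz True x by (simp add: field_simps)
    then have z: "z \<noteq> 0" using assms by auto
    \<comment> \<open>The hyperbolic plane: b = ((b + 1)/2)^2 - ((b - 1)/2)^2, where a = (z/x)^2 is
      split off from the second square.\<close>
    have "b = ((b + 1) / 2)^2 - a * ((b - 1) / 2 * (x / z))^2"
      using x z unfolding a by (simp add: field_simps power2_eq_square)
    moreover have "(b + 1) / 2 \<in> K" "(b - 1) / 2 * (x / z) \<in> K"
      using xyz assms by auto
    ultimately show ?thesis by blast
  qed
next
  assume "\<exists>x\<in>K. \<exists>y\<in>K. b = x^2 - a * y^2"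
  then obtain x y where "x \<in> K" "y \<in> K" "b = x^2 - a * y^2" by blast
  then show "hil K a b"
    unfolding hil_def by (intro bexI[of _ y] bexI[of _ 1] bexI[of _ x]) auto
qed

lemma hil_norm: "a \<in> K \<Longrightarrow> a \<noteq> 0 \<Longrightarrow> x \<in> K \<Longrightarrow> y \<in> K \<Longrightarrow> hil K a (x^2 - a * y^2)"
  by (subst hil_iff_norm) auto

lemma hil_square_right: "x \<in> K \<Longrightarrow> hil K a (x^2)"
  unfolding hil_def by (intro bexI[of _ 0] bexI[of _ 1] bexI[of _ x]) auto

lemma hil_uminus: "hil K a (- a)"
  unfolding hil_def by (intro bexI[of _ 1] bexI[of _ 1] bexI[of _ 0]) auto

text \<open>Norms from K(sqrt a) are closed under products, by the composition identity for x^2 -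
  a*y^2.\<close>

lemma hil_mult:
  assumes "a \<in> K" "b \<in> K" "c \<in> K" "a \<noteq> 0" "hil K a b" "hil K a c"
  shows "hil K a (b * c)"
proof -
  obtain x y where b: "x \<in> K" "y \<in> K" "b = x^2 - a * y^2"
    using assms hil_iff_norm[of a b] by blast
  obtain z w where c: "z \<in> K" "w \<in> K" "c = z^2 - a * w^2"
    using assms hil_iff_norm[of a c] by blast
  have "b * c = (x * z + a * y * w)^2 - a * (x * w + y * z)^2"
    unfolding b c by (simp add: algebra_simps power2_eq_square)
  then show ?thesis using assms b(1,2) c(1,2) hil_norm[of a "x * z + a * y * w" "x * w + y * z"]
    by simp
qed

lemma hil_mult_square:
  assumes "a \<in> K" "b \<in> K" "c \<in> K" "a \<noteq> 0" "c \<noteq> 0"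
  shows "hil K a (b * c^2) \<longleftrightarrow> hil K a b"
proof
  assume "hil K a (b * c^2)"
  moreover have "hil K a ((1 / c)^2)" using assms by (intro hil_square_right) auto
  ultimately have "hil K a (b * c^2 * (1 / c)^2)"
    using assms hil_mult[of a "b * c^2" "(1 / c)^2"] by simp
  then show "hil K a b" using assms by (simp add: field_simps)
qed (use assms hil_mult[of a b "c^2"] hil_square_right[of c a] in simp)

text \<open>Multiplying b*c by the norm b once more leaves c up to a square. This is the formal part
  of bilinearity; the deep part is \<open>hil_neg_mult\<close>.\<close>

lemma hil_cancel:
  assumes "a \<in> K" "b \<in> K" "c \<in> K" "a \<noteq> 0" "b \<noteq> 0" "hil K a b" 
  shows "hil K a (b * c) \<longleftrightarrow> hil K a c"
proof
  assume "hil K a (b * c)"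
  then have "hil K a (b * (b * c))" using assms hil_mult[of a b "b * c"] by simp
  then have "hil K a (c * b^2)" by (simp add: power2_eq_square mult_ac)
  then show "hil K a c" using assms hil_mult_square by blast
qed (use assms hil_mult[of a b c] in simp)

end

text \<open>The absolute value hidden behind the existential quantifier in
  \<open>nonarch_local_field\<close> becomes a parameter. It is constrained only on
  \<open>K\<close>; the locale is instantiated for F and again for E.\<close>

locale local_field = subfield_char0 K for K :: "'a::field_char_0 set" +
  fixes f :: "'a \<Rightarrow> real"
  assumes f_nonneg: "x \<in> K \<Longrightarrow> f x \<ge> 0"
    and f_eq_0: "x \<in> K \<Longrightarrow> f x = 0 \<longleftrightarrow> x = 0"
    and f_mult: "x \<in> K \<Longrightarrow> y \<in> K \<Longrightarrow> f (x * y) = f x * f y"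
    and f_add: "x \<in> K \<Longrightarrow> y \<in> K \<Longrightarrow> f (x + y) \<le> max (f x) (f y)"
    and f_nontrivial: "\<exists>x\<in>K. f x \<noteq> 0 \<and> f x \<noteq> 1"
    and f_discrete: "\<exists>c<1. \<forall>x\<in>K. f x < 1 \<longrightarrow> f x \<le> c"
    and f_complete: "\<And>u :: nat \<Rightarrow> 'a. (\<And>n. u n \<in> K) \<Longrightarrow> (\<And>e. e > 0 \<Longrightarrow> \<exists>N. \<forall>m\<ge>N. \<forall>n\<ge>N. f (u m - u n) < e) \<Longrightarrow>
        \<exists>l\<in>K. \<forall>e>0. \<exists>N. \<forall>n\<ge>N. f (u n - l) < e"
    and finite_residue: "\<exists>R. finite R \<and> R \<subseteq> {x\<in>K. f x \<le> 1} \<and>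
        (\<forall>x\<in>K. f x \<le> 1 \<longrightarrow> (\<exists>r\<in>R. f (x - r) < 1))"

lemma nonarch_local_field_imp:
  assumes "nonarch_local_field (K :: 'a::field_char_0 set)"
  shows "\<exists>f. local_field K f"
proof -
  from assms obtain f :: "'a \<Rightarrow> real" where K: "subfield K"
    and 1: "\<forall>x\<in>K. f x \<ge> 0 \<and> (f x = 0 \<longleftrightarrow> x = 0)"
    and 2: "\<forall>x\<in>K. \<forall>y\<in>K. f (x * y) = f x * f y \<and> f (x + y) \<le> max (f x) (f y)"
    and 3: "\<exists>x\<in>K. f x \<noteq> 0 \<and> f x \<noteq> 1"
    and 4: "\<exists>c<1. \<forall>x\<in>K. f x < 1 \<longrightarrow> f x \<le> c"
    and 5: "\<forall>u :: nat \<Rightarrow> 'a. (\<forall>n. u n \<in> K) \<and>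
        (\<forall>e>0. \<exists>N. \<forall>m\<ge>N. \<forall>n\<ge>N. f (u m - u n) < e) \<longrightarrow>
        (\<exists>l\<in>K. \<forall>e>0. \<exists>N. \<forall>n\<ge>N. f (u n - l) < e)"
    and 6: "\<exists>R. finite R \<and> R \<subseteq> {x\<in>K. f x \<le> 1} \<and>
        (\<forall>x\<in>K. f x \<le> 1 \<longrightarrow> (\<exists>r\<in>R. f (x - r) < 1))"
    unfolding nonarch_local_field_def by auto
  have "local_field K f"
  proof
    fix u :: "nat \<Rightarrow> 'a"
    assume "\<And>n. u n \<in> K" "\<And>e. e > 0 \<Longrightarrow> \<exists>N. \<forall>m\<ge>N. \<forall>n\<ge>N. f (u m - u n) < e"
    then show "\<exists>l\<in>K. \<forall>e>0. \<exists>N. \<forall>n\<ge>N. f (u n - l) < e"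
      using 5[rule_format, of u] by simp
  qed (use K 1 2 3 4 6 in blast)+
  then show ?thesis by blast
qed

context local_field
begin

lemma f_0 [simp]: "f 0 = 0" using f_eq_0 by simp

lemma f_1 [simp]: "f 1 = 1"
  using f_mult[of 1 1] f_eq_0[of 1] by simp

lemma f_power: "x \<in> K \<Longrightarrow> f (x ^ n) = f x ^ n"
  by (induction n) (auto simp: f_mult)

lemma f_uminus [simp]: assumes "x \<in> K" shows "f (- x) = f x"
proof -
  have "f (-1) ^ 2 = 1" using f_power[of "-1" 2] by simp
  then have "f (-1) = 1" using f_nonneg[of "-1"] by (simp add: power2_eq_1_iff)
  then show ?thesis using f_mult[of "-1" x] assms by simp
qed

lemma f_diff: "x \<in> K \<Longrightarrow> y \<in> K \<Longrightarrow> f (x - y) \<le> max (f x) (f y)"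
  using f_add[of x "- y"] by simp

lemma f_diff_commute: "x \<in> K \<Longrightarrow> y \<in> K \<Longrightarrow> f (x - y) = f (y - x)"
  using f_uminus[of "x - y"] by simp

lemma f_pos: "x \<in> K \<Longrightarrow> x \<noteq> 0 \<Longrightarrow> f x > 0"
  using f_nonneg[of x] f_eq_0[of x] by linarith

lemma f_inverse: assumes "x \<in> K" shows "f (inverse x) = inverse (f x)"
proof (cases "x = 0")
  case False
  then have "f x * f (inverse x) = 1" using assms f_mult[of x "inverse x"] by simp
  then show ?thesis using False f_eq_0 assms by (simp add: field_simps)
qed simp

lemma f_divide: "x \<in> K \<Longrightarrow> y \<in> K \<Longrightarrow> f (x / y) = f x / f y"
  by (simp add: divide_inverse f_mult f_inverse)

lemma f_add_eq: assumes "x \<in> K" "y \<in> K" "f x < f y" shows "f (x + y) = f y"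
proof (rule antisym)
  show "f (x + y) \<le> f y" using f_add[of x y] assms by simp
  show "f y \<le> f (x + y)" using f_diff[of "x + y" x] assms by (simp split: if_splits)
qed

lemma f_add_less: "x \<in> K \<Longrightarrow> y \<in> K \<Longrightarrow> f x < r \<Longrightarrow> f y < r \<Longrightarrow> f (x + y) < r"
  using f_add[of x y] by simp

lemma f_add_le: "x \<in> K \<Longrightarrow> y \<in> K \<Longrightarrow> f x \<le> r \<Longrightarrow> f y \<le> r \<Longrightarrow> f (x + y) \<le> r"
  using f_add[of x y] by simp

lemma f_diff_less: "x \<in> K \<Longrightarrow> y \<in> K \<Longrightarrow> f x < r \<Longrightarrow> f y < r \<Longrightarrow> f (x - y) < r"
  using f_diff[of x y] by simp

lemma f_diff_le: "x \<in> K \<Longrightarrow> y \<in> K \<Longrightarrow> f x \<le> r \<Longrightarrow> f y \<le> r \<Longrightarrow> f (x - y) \<le> r"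
  using f_diff[of x y] by simp

lemma f_of_nat: "f (of_nat n) \<le> 1"
  by (induction n) (auto intro: f_add_le)

lemma f_numeral: "f (numeral n) \<le> 1"
  using f_of_nat[of "numeral n"] by simp

lemma f_2_pos: "f 2 > 0" using f_pos[of 2] by simp

lemma f_4: "f 4 = f 2 ^ 2" using f_power[of 2 2] by simp

section \<open>Completeness and Hensel's lemma for quadratic polynomials\<close>

lemma f_complete_geometric:
  assumes u: "\<And>n. u n \<in> K" and q: "0 \<le> q" "q < 1"
    and step: "\<And>n. f (u (Suc n) - u n) \<le> C * q ^ n"
  shows "\<exists>l\<in>K. \<forall>e>0. \<exists>N. \<forall>n\<ge>N. f (u n - l) < e"
proof (rule f_complete[OF u])
  fix e :: real assume e: "e > 0"
  have C: "0 \<le> C" using step[of 0] f_nonneg[of "u (Suc 0) - u 0"] u by simp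
  \<comment> \<open>By the ultrametric inequality a total difference is bounded by its largest
    single step, so no geometric series is summed.\<close>
  have tail: "f (u (n + k) - u n) \<le> C * q ^ n" for n k
  proof (induction k)
    case 0
    then show ?case using C q by simp
  next
    case (Suc k)
    have "f (u (Suc (n + k)) - u (n + k)) \<le> C * q ^ (n + k)" by (rule step)
    also have "\<dots> \<le> C * q ^ n" using C q by (intro mult_left_mono power_decreasing) auto
    finally show ?case using Suc f_add_le[of "u (Suc (n + k)) - u (n + k)" "u (n + k) - u n"] u by simp
  qed
  have "(\<lambda>n. C * q ^ n) \<longlonglongrightarrow> C * 0"
    using q by (intro tendsto_mult tendsto_const LIMSEQ_power_zero) auto
  then obtain N where N: "\<And>n. n \<ge> N \<Longrightarrow> C * q ^ n < e"
    using order_tendstoD(2)[of "\<lambda>n. C * q ^ n" 0 sequentially e] e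
    by (auto simp: eventually_sequentially)
  have "f (u m - u n) < e" if "m \<ge> N" "n \<ge> N" for m n
  proof -
    have *: "f (u m - u N) < e" if "m \<ge> N" for m
      using tail[of N "m - N"] N[of N] that by simp
    show ?thesis
      using f_diff_less[of "u m - u N" "u n - u N" e] *[OF that(1)] *[OF that(2)] u by simp
  qed
  then show "\<exists>N. \<forall>m\<ge>N. \<forall>n\<ge>N. f (u m - u n) < e" by blast
qed

lemma limit_unique_zero:
  assumes "x \<in> K" "\<And>e. e > 0 \<Longrightarrow> f x < e" shows "x = 0"
  using assms f_pos[of x] by force

text \<open>The map s -> -e - s^2 contracts the ball of radius \<open>f e\<close> with factor
  \<open>f e\<close>, and its fixed point is the root. The unit linear coefficient makes this work
  in residue characteristic 2 as well.\<close>

lemma hensel_monic: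
  assumes e: "e \<in> K" "f e < 1"
  shows "\<exists>s\<in>K. s^2 + s + e = 0"
proof -
  define u where "u = rec_nat 0 (\<lambda>_ s. - e - s^2)"
  have u0: "u 0 = 0" and uS: "u (Suc n) = - e - (u n)^2" for n
    unfolding u_def by auto
  have uK: "u n \<in> K" for n by (induction n) (auto simp: u0 uS e)
  have ub: "f (u n) \<le> f e" for n
  proof (induction n)
    case (Suc n)
    have "f (u n) ^ 2 \<le> f e ^ 2" using Suc f_nonneg uK by (intro power_mono) auto
    also have "\<dots> \<le> f e" using e f_nonneg[of e] by (simp add: power2_eq_square mult_left_le)
    finally show ?case unfolding uS using e uK f_diff_le[of "-e" "(u n)^2" "f e"] by (simp add: f_power)
  qed (use e f_nonneg in \<open>auto simp: u0\<close>)
  have step: "f (u (Suc n) - u n) \<le> f e * f e ^ n" for n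
  proof (induction n)
    case 0
    then show ?case using e by (simp add: u0 uS)
  next
    case (Suc n)
    have "u (Suc (Suc n)) - u (Suc n) = - ((u (Suc n) + u n) * (u (Suc n) - u n))"
      unfolding uS[of "Suc n"] uS[of n] by (simp add: algebra_simps power2_eq_square)
    then have "f (u (Suc (Suc n)) - u (Suc n)) = f (u (Suc n) + u n) * f (u (Suc n) - u n)"
      using uK by (simp add: f_mult del: minus_mult_left minus_mult_right)
    also have "\<dots> \<le> f e * (f e * f e ^ n)"
      using Suc f_nonneg uK e f_add_le[of "u (Suc n)" "u n" "f e"] ub by (intro mult_mono) auto
    finally show ?case by simp
  qed
  obtain l where l: "l \<in> K" "\<And>r. r > 0 \<Longrightarrow> \<exists>N. \<forall>n\<ge>N. f (u n - l) < r"
    using f_complete_geometric[OF uK _ _ step] e f_nonneg by blast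
  have lb: "f l \<le> 1"
  proof -
    obtain N where "f (u N - l) < 1" using l(2)[of 1] by auto
    moreover have "f l = f (u N - (u N - l))" by simp
    moreover have "f (u N) \<le> 1" using ub[of N] e by simp
    ultimately show ?thesis using f_diff_le[of "u N" "u N - l" 1] uK l by simp
  qed
  have "l^2 + l + e = 0"
  proof (rule limit_unique_zero)
    fix r :: real assume r: "r > 0"
    then obtain N where N: "\<And>n. n \<ge> N \<Longrightarrow> f (u n - l) < r" using l(2) by blast
    have eq: "l^2 + l + e = (l + u N) * (l - u N) - (u (Suc N) - l)"
      unfolding uS by (simp add: algebra_simps power2_eq_square)
    have "f (l + u N) \<le> 1" using lb ub[of N] e l uK by (intro f_add_le) auto
    moreover have "f (l - u N) < r" using N[of N] f_diff_commute[of l "u N"] l uK by simp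
    ultimately have "f ((l + u N) * (l - u N)) < r"
      using f_nonneg[of "l - u N"] f_nonneg[of "l + u N"] l uK
      by (simp add: f_mult) (meson le_less_trans mult_left_le_one_le)
    then show "f (l^2 + l + e) < r"
      unfolding eq using N[of "Suc N"] l(1) uK f_diff_less[of "(l + u N) * (l - u N)" "u (Suc N) - l" r]
      by simp
  qed (use l e in auto)
  then show ?thesis using l by blast
qed

text \<open>Substituting t = b*s normalises the linear coefficient. Read backwards, a polynomial
  without roots satisfies f b ^ 2 \<le> f c, which becomes the Cauchy-Schwarz inequality
  \<open>f_B_bound\<close>.\<close>

lemma hensel_quadratic:
  assumes bc: "b \<in> K" "c \<in> K" "f c < f b ^ 2"
  shows "\<exists>t\<in>K. t^2 + b * t + c = 0"
proof -
  have b: "b \<noteq> 0" using bc f_nonneg[of c] by auto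
  have "f (c / b^2) < 1" using bc b f_pos[of b] by (simp add: f_divide f_power)
  then obtain s where s: "s \<in> K" "s^2 + s + c / b^2 = 0" using hensel_monic[of "c / b^2"] bc by auto
  have "(b * s)^2 + b * (b * s) + c = b^2 * (s^2 + s + c / b^2)"
    using b by (simp add: field_simps power2_eq_square)
  then show ?thesis using s bc by (intro bexI[of _ "b * s"]) auto
qed

text \<open>The sharp local square theorem: 1 + 4*e = (2*s + 1)^2 as soon as s^2 + s = e.\<close>

lemma square_1_plus_4:
  assumes "e \<in> K" "f e < 1" shows "\<exists>s\<in>K. 1 + 4 * e = s^2"
proof -
  obtain s where s: "s \<in> K" "s^2 + s + (- e) = 0" using hensel_monic[of "- e"] assms by auto
  have "e = s^2 + s" using s by (simp add: algebra_simps)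
  then have "1 + 4 * e = (2 * s + 1)^2" by (simp add: algebra_simps power2_eq_square)
  then show ?thesis using s by (intro bexI[of _ "2 * s + 1"]) auto
qed

end

section \<open>Uniformizers and residues\<close>

context local_field
begin

text \<open>By discreteness, applied to quotients, two different values differ by a factor of at
  most c. So a value exceeding c times the supremum of all values below 1 is the largest of
  them.\<close>

lemma ex_uniformizer: "\<exists>p\<in>K. 0 < f p \<and> f p < 1 \<and> (\<forall>x\<in>K. f x < 1 \<longrightarrow> f x \<le> f p)"
proof -
  obtain c where c: "c < 1" "\<And>x. x \<in> K \<Longrightarrow> f x < 1 \<Longrightarrow> f x \<le> c" using f_discrete by blast
  define G where "G = {f x |x. x \<in> K \<and> x \<noteq> 0 \<and> f x < 1}"
  obtain x where x: "x \<in> K" "f x \<noteq> 0" "f x \<noteq> 1" using f_nontrivial by blast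
  have "\<exists>y\<in>K. y \<noteq> 0 \<and> f y < 1"
  proof (cases "f x < 1")
    case True
    then show ?thesis using x by (intro bexI[of _ x]) auto
  next
    case False
    then have "inverse (f x) < 1" using x by (intro inverse_less_1_iff[THEN iffD2]) auto
    then have "f (inverse x) < 1" using x f_inverse[of x] by simp
    then show ?thesis using x by (intro bexI[of _ "inverse x"]) auto
  qed
  then obtain y where y: "y \<in> K" "y \<noteq> 0" "f y < 1" by blast
  then have fy: "f y \<in> G" unfolding G_def by blast
  have bdd: "bdd_above G" unfolding G_def by (intro bdd_aboveI[of _ 1]) auto
  define S where "S = Sup G"
  have S0: "S > 0" using cSup_upper[OF fy bdd] f_pos[of y] y unfolding S_def by linarith
  have c0: "c > 0" using c(2)[of y] y f_pos[of y] by linarith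
  have "S * c < S" using S0 c by simp
  then obtain g where g: "g \<in> G" "S * c < g"
    using less_cSupD[of G "S * c"] fy unfolding S_def by blast
  have "h \<le> g" if "h \<in> G" for h
  proof (rule ccontr)
    assume "\<not> h \<le> g"
    then have hg: "g < h" by simp
    obtain a where a: "a \<in> K" "a \<noteq> 0" "g = f a" using g unfolding G_def by blast
    obtain b where b: "b \<in> K" "b \<noteq> 0" "h = f b" using \<open>h \<in> G\<close> unfolding G_def by blast
    have "f (a / b) < 1" using a b hg f_pos[of b] by (simp add: f_divide)
    then have "f (a / b) \<le> c" using c(2)[of "a / b"] a b by simp
    then have "g \<le> c * h" using a(1,3) b f_pos[of b] by (simp add: f_divide pos_divide_le_eq)
    also have "\<dots> \<le> c * S" using c0 cSup_upper[OF that bdd] unfolding S_def by simp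
    finally show False using g by (simp add: mult.commute)
  qed
  moreover obtain p where p: "p \<in> K" "p \<noteq> 0" "g = f p" "f p < 1" using g unfolding G_def by blast
  ultimately have "f x \<le> f p" if "x \<in> K" "f x < 1" for x
    using that f_nonneg[of p] unfolding G_def by (cases "x = 0") auto
  then show ?thesis using p f_pos[of p] by (intro bexI[of _ p]) auto
qed

definition unif :: 'a where
  "unif = (SOME p. p \<in> K \<and> 0 < f p \<and> f p < 1 \<and> (\<forall>x\<in>K. f x < 1 \<longrightarrow> f x \<le> f p))"

lemma unif: "unif \<in> K" "0 < f unif" "f unif < 1" "\<And>x. x \<in> K \<Longrightarrow> f x < 1 \<Longrightarrow> f x \<le> f unif"
proof -
  have "\<exists>p. p \<in> K \<and> 0 < f p \<and> f p < 1 \<and> (\<forall>x\<in>K. f x < 1 \<longrightarrow> f x \<le> f p)"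
    using ex_uniformizer by blast
  from someI_ex[OF this] show "unif \<in> K" "0 < f unif" "f unif < 1"
    "\<And>x. x \<in> K \<Longrightarrow> f x < 1 \<Longrightarrow> f x \<le> f unif" unfolding unif_def[symmetric] by blast+
qed

lemma unif_nonzero: "unif \<noteq> 0" using unif by auto

text \<open>The least power of \<open>f unif\<close> below \<open>f x\<close> is one too far:
  dividing x by the preceding power gives a value above \<open>f unif\<close>, hence at least
  1.\<close>

lemma f_eq_unif_power:
  assumes "x \<in> K" "x \<noteq> 0" "f x \<le> 1"
  shows "\<exists>n. f x = f unif ^ n"
proof -
  define P where "P = (\<lambda>n. f unif ^ n < f x)"
  have ex: "\<exists>n. P n" unfolding P_def using real_arch_pow_inv[of "f x" "f unif"] unif f_pos assms by auto
  define n where "n = (LEAST n. P n)"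
  have n: "P n" unfolding n_def using ex by (rule LeastI_ex)
  have "n \<noteq> 0" using n assms unfolding P_def by (metis not_less power_0)
  then obtain m where m: "n = Suc m" by (cases n) auto
  have "\<not> P m" using not_less_Least[of m P] m unfolding n_def by auto
  then have le: "f x \<le> f unif ^ m" unfolding P_def by simp
  have "f (x / unif ^ m) = f x / f unif ^ m" using assms unif by (simp add: f_divide f_power)
  moreover have "f x / f unif ^ m > f unif" using n unif unfolding P_def m by (simp add: field_simps)
  ultimately have "\<not> f (x / unif ^ m) < 1" using unif(4)[of "x / unif ^ m"] assms unif by auto
  then have "f x \<ge> f unif ^ m" using \<open>f (x / unif ^ m) = f x / f unif ^ m\<close> unif by (simp add: field_simps)
  then show ?thesis using le by (intro exI[of _ m]) simp
qed

text \<open>Symbols only see the parity of the valuation, so the two classes are recorded through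
  values of squares rather than by an integer-valued valuation.\<close>

lemma parity:
  assumes "x \<in> K" "x \<noteq> 0"
  shows "\<exists>e\<in>K. e \<noteq> 0 \<and> (f x = f e ^ 2 \<or> f x = f unif * f e ^ 2)"
proof -
  have small: "\<exists>e\<in>K. e \<noteq> 0 \<and> (f x = f e ^ 2 \<or> f x = f unif * f e ^ 2)"
    if "x \<in> K" "x \<noteq> 0" "f x \<le> 1" for x
  proof -
    obtain n where n: "f x = f unif ^ n" using f_eq_unif_power \<open>x \<in> K\<close> \<open>x \<noteq> 0\<close> \<open>f x \<le> 1\<close> by blast
    have "n = 2 * (n div 2) \<or> n = 1 + 2 * (n div 2)" by presburger
    then have "f x = f unif ^ (2 * (n div 2)) \<or> f x = f unif ^ (1 + 2 * (n div 2))" using n by metis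
    then have "f x = f (unif ^ (n div 2)) ^ 2 \<or> f x = f unif * f (unif ^ (n div 2)) ^ 2"
      using unif by (simp add: f_power power_mult[symmetric] mult.commute)
    then show ?thesis using unif unif_nonzero by (intro bexI[of _ "unif ^ (n div 2)"]) auto
  qed
  show ?thesis
  proof (cases "f x \<le> 1")
    case True
    then show ?thesis using small assms by blast
  next
    case False
    then have "inverse (f x) \<le> 1" by (intro inverse_le_1_iff[THEN iffD2]) auto
    then have "f (inverse x) \<le> 1" using assms by (simp add: f_inverse)
    then obtain e where e: "e \<in> K" "e \<noteq> 0"
      "f (inverse x) = f e ^ 2 \<or> f (inverse x) = f unif * f e ^ 2"
      using small[of "inverse x"] assms by auto
    have fe: "f e > 0" using e f_pos by auto
    have fx: "f x > 0" using assms f_pos by auto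
    from e(3) have "f x = f (inverse e) ^ 2 \<or> f x = f unif * f (inverse (e * unif)) ^ 2"
    proof
      assume "f (inverse x) = f e ^ 2"
      then have "inverse (f x) = f e ^ 2" using assms f_inverse by simp
      then have "f x = inverse (f e) ^ 2" by (metis inverse_inverse_eq power_inverse)
      then have "f x = f (inverse e) ^ 2" using e f_inverse by simp
      then show ?thesis ..
    next
      assume "f (inverse x) = f unif * f e ^ 2"
      then have "inverse (f x) = f unif * f e ^ 2" using assms f_inverse by simp
      then have "f x = inverse (f unif * f e ^ 2)" by (metis inverse_inverse_eq)
      \<comment> \<open>Inverting an odd value keeps it odd: 1/(u*e^2) = u*(1/(e*u))^2.\<close>
      also have "\<dots> = f unif * inverse (f e * f unif) ^ 2"
        using fe unif by (simp add: field_simps power2_eq_square)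
      also have "inverse (f e * f unif) = f (inverse (e * unif))"
        using e unif f_inverse[of "e * unif"] f_mult[of e unif] by simp
      finally have "f x = f unif * f (inverse (e * unif)) ^ 2" .
      then show ?thesis ..
    qed
    then show ?thesis
      using e unif unif_nonzero by (metis inverse_K mult_K mult_eq_0_iff nonzero_imp_inverse_nonzero)
  qed
qed

text \<open>No value lies strictly between \<open>f unif\<close> and 1, so \<open>f unif\<close> has
  no square root among the values; the two classes of \<open>parity\<close> are disjoint.\<close>

lemma unif_odd:
  assumes "d \<in> K" "e \<in> K" "d \<noteq> 0"
  shows "f unif * f d ^ 2 \<noteq> f e ^ 2"
proof
  assume "f unif * f d ^ 2 = f e ^ 2"
  then have 1: "f (e / d) ^ 2 = f unif" using assms f_pos[of d] by (simp add: f_divide field_simps)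
  then have "f (e / d) ^ 2 < 1" using unif by simp
  then have "f (e / d) < 1" using f_nonneg[of "e / d"] assms
    by (metis divide_K linorder_not_less one_le_power)
  then have "f (e / d) \<le> f unif" using unif(4) assms by auto
  then have "f (e / d) ^ 2 \<le> f unif ^ 2" using f_nonneg[of "e / d"] assms by (intro power_mono) auto
  also have "\<dots> < f unif" using unif by (simp add: power2_eq_square)
  finally show False using 1 by simp
qed

section \<open>Congruences modulo the maximal ideal and counting in the finite residue field\<close>

lemma res_mult:
  assumes "x \<in> K" "y \<in> K" "z \<in> K" "w \<in> K" "f x \<le> 1" "f w \<le> 1" "f (x - y) < 1" "f (z - w) < 1"
  shows "f (x * z - y * w) < 1"
proof -
  have "x * z - y * w = x * (z - w) + (x - y) * w" by (simp add: algebra_simps)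
  moreover have "f (x * (z - w)) < 1"
    using assms f_nonneg by (auto simp: f_mult intro: le_less_trans[OF mult_left_le_one_le])
  moreover have "f ((x - y) * w) < 1"
    using assms f_nonneg by (auto simp: f_mult intro: le_less_trans[OF mult_right_le_one_le])
  ultimately show ?thesis using assms f_add_less by simp
qed

lemma res_trans: "x \<in> K \<Longrightarrow> y \<in> K \<Longrightarrow> z \<in> K \<Longrightarrow> f (x - y) < 1 \<Longrightarrow> f (y - z) < 1 \<Longrightarrow> f (x - z) < 1"
  using f_add_less[of "x - y" "y - z" 1] by simp

lemma f_mult_less_1_cases:
  assumes "x \<in> K" "y \<in> K" "f (x * y) < 1" shows "f x < 1 \<or> f y < 1"
  using assms by (auto simp: f_mult) (meson linorder_not_less mult_ge1_I)

lemma f_mult_le_1: "x \<in> K \<Longrightarrow> y \<in> K \<Longrightarrow> f x \<le> 1 \<Longrightarrow> f y \<le> 1 \<Longrightarrow> f (x * y) \<le> 1"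
  using f_nonneg by (simp add: f_mult mult_le_one)

lemma f_mult_less_1: "x \<in> K \<Longrightarrow> y \<in> K \<Longrightarrow> f x \<le> 1 \<Longrightarrow> f y < 1 \<Longrightarrow> f (x * y) < 1"
  using f_nonneg[of x] f_nonneg[of y] by (auto simp: f_mult intro: le_less_trans[OF mult_left_le_one_le])

text \<open>The finite set of values of \<open>rp\<close> stands in for the residue field. The
  choice depends only on the residue class, because congruent elements admit the same
  representatives.\<close>

lemma residue_transversal:
  "\<exists>rp. finite (rp ` {x\<in>K. f x \<le> 1}) \<and>
    (\<forall>x\<in>K. f x \<le> 1 \<longrightarrow> rp x \<in> K \<and> f (rp x) \<le> 1 \<and> f (x - rp x) < 1) \<and>
    (\<forall>x\<in>K. \<forall>y\<in>K. f x \<le> 1 \<longrightarrow> f y \<le> 1 \<longrightarrow> (rp x = rp y \<longleftrightarrow> f (x - y) < 1))"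
proof -
  obtain R where R: "finite R" "R \<subseteq> {x\<in>K. f x \<le> 1}"
    "\<And>x. x \<in> K \<Longrightarrow> f x \<le> 1 \<Longrightarrow> \<exists>r\<in>R. f (x - r) < 1"
    using finite_residue by blast
  define rp where "rp = (\<lambda>x. SOME r. r \<in> R \<and> f (x - r) < 1)"
  have rp: "rp x \<in> R" "f (x - rp x) < 1" if "x \<in> K" "f x \<le> 1" for x
  proof -
    have "\<exists>r. r \<in> R \<and> f (x - r) < 1" using R(3)[of x] \<open>x \<in> K\<close> \<open>f x \<le> 1\<close> by blast
    from someI_ex[OF this] show "rp x \<in> R" "f (x - rp x) < 1" unfolding rp_def by blast+
  qed
  have rpK: "rp x \<in> K" "f (rp x) \<le> 1" if "x \<in> K" "f x \<le> 1" for x using rp[OF that] R by auto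
  have "rp x = rp y \<longleftrightarrow> f (x - y) < 1" if "x \<in> K" "y \<in> K" "f x \<le> 1" "f y \<le> 1" for x y
  proof
    assume "rp x = rp y"
    then show "f (x - y) < 1"
      using res_trans[of x "rp x" y] rp(2)[of x] rp(2)[of y] rpK[of x] that f_diff_commute[of y "rp y"] by auto
  next
    assume *: "f (x - y) < 1"
    have "(r \<in> R \<and> f (x - r) < 1) = (r \<in> R \<and> f (y - r) < 1)" for r
      using res_trans[of x y r] res_trans[of y x r] * f_diff_commute[of x y] that R(2) by auto
    then show "rp x = rp y" unfolding rp_def by simp
  qed
  moreover have "finite (rp ` {x\<in>K. f x \<le> 1})"
    by (rule finite_subset[OF _ R(1)]) (use rp in auto)
  ultimately show ?thesis using rp rpK by (intro exI[of _ rp]) auto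
qed

end

text \<open>The image S of an at most two-to-one map has at least half the size of X. Two shifts of
  S, disjoint from S and from each other, would need 3|S| elements. This is the fact that a subgroup
  of index two has a single nontrivial coset, phrased so that it serves both squares and
  Artin-Schreier values.\<close>

lemma pigeonhole_two_to_one:
  fixes \<phi> \<alpha> \<beta> :: "'b \<Rightarrow> 'b"
  assumes X: "finite X" "X \<noteq> {}" and \<phi>: "\<phi> ` X \<subseteq> X" "\<And>s. s \<in> \<phi> ` X \<Longrightarrow> card {x\<in>X. \<phi> x = s} \<le> 2"
    and \<alpha>: "inj_on \<alpha> (\<phi> ` X)" "\<alpha> ` \<phi> ` X \<subseteq> X" "\<phi> ` X \<inter> \<alpha> ` \<phi> ` X = {}"
    and \<beta>: "inj_on \<beta> (\<phi> ` X)" "\<beta> ` \<phi> ` X \<subseteq> X" "\<phi> ` X \<inter> \<beta> ` \<phi> ` X = {}"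
  shows "\<exists>x\<in>X. \<exists>y\<in>X. \<alpha> (\<phi> x) = \<beta> (\<phi> y)"
proof (rule ccontr)
  assume "\<not> ?thesis"
  then have dis: "\<alpha> ` \<phi> ` X \<inter> \<beta> ` \<phi> ` X = {}" by auto
  define S where "S = \<phi> ` X"
  have fS: "finite S" unfolding S_def using X by simp
  have "X = (\<Union>s\<in>S. {x\<in>X. \<phi> x = s})" unfolding S_def by auto
  then have "card X \<le> (\<Sum>s\<in>S. card {x\<in>X. \<phi> x = s})" using card_UN_le[OF fS] by metis
  also have "\<dots> \<le> (\<Sum>s\<in>S. 2)" by (intro sum_mono) (use \<phi> S_def in auto)
  finally have 1: "card X \<le> 2 * card S" by simp
  have "card (S \<union> \<alpha> ` S \<union> \<beta> ` S) = card S + card (\<alpha> ` S) + card (\<beta> ` S)"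
    using \<alpha> \<beta> dis fS unfolding S_def[symmetric] by (subst card_Un_disjoint, auto)+
  also have "\<dots> = 3 * card S" using \<alpha> \<beta> unfolding S_def[symmetric] by (simp add: card_image)
  finally have 2: "3 * card S \<le> card X" 
    using \<alpha> \<beta> \<phi> X card_mono[of X "S \<union> \<alpha> ` S \<union> \<beta> ` S"] unfolding S_def[symmetric] by auto
  have "card S > 0" using X fS unfolding S_def by auto
  then show False using 1 2 by simp
qed

context local_field
begin

text \<open>Squares have index at most two among the nonzero residues, so two nonsquares differ by a
  square factor. The pigeonhole is applied to x -> x^2 and to multiplication by a and by b.\<close>

lemma nonsquare_residues:
  assumes a: "a \<in> K" "f a = 1" "\<And>s. s \<in> K \<Longrightarrow> f s \<le> 1 \<Longrightarrow> \<not> f (s^2 - a) < 1"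
    and b: "b \<in> K" "f b = 1" "\<And>s. s \<in> K \<Longrightarrow> f s \<le> 1 \<Longrightarrow> \<not> f (s^2 - b) < 1"
  shows "\<exists>s\<in>K. f s = 1 \<and> f (a * s^2 - b) < 1"
proof -
  obtain rp where fin: "finite (rp ` {x\<in>K. f x \<le> 1})"
    and rp: "\<And>x. x \<in> K \<Longrightarrow> f x \<le> 1 \<Longrightarrow> rp x \<in> K \<and> f (rp x) \<le> 1 \<and> f (x - rp x) < 1"
    and rpeq: "\<And>x y. x \<in> K \<Longrightarrow> y \<in> K \<Longrightarrow> f x \<le> 1 \<Longrightarrow> f y \<le> 1 \<Longrightarrow> (rp x = rp y \<longleftrightarrow> f (x - y) < 1)"
    using residue_transversal by blast
  define X where "X = rp ` {x\<in>K. f x = 1}"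
  have XK: "x \<in> K" "f x = 1" "rp x = x" if x: "x \<in> X" for x
  proof -
    obtain y where y: "y \<in> K" "f y = 1" "x = rp y" using x unfolding X_def by auto
    note ry = rp[of y]
    show "x \<in> K" using ry y by simp
    show "f x = 1" using ry y f_add_eq[of "x - y" y] f_diff_commute[of x y] by simp
    show "rp x = x" using ry y rpeq[of x y] f_diff_commute[of x y] by simp
  qed
  have XI: "rp y \<in> X" if "y \<in> K" "f y = 1" for y using that unfolding X_def by auto
  have mul: "rp (c * rp y) = rp (c * y)" if "c \<in> K" "f c = 1" "y \<in> K" "f y = 1" for c y
  proof -
    have "f (c * rp y - c * y) < 1"
      using rp[of y] that f_diff_commute[of y "rp y"] by (intro res_mult) auto
    then show ?thesis using rpeq[of "c * rp y" "c * y"] rp[of y] that by (simp add: f_mult)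
  qed
  have dis: "rp (x^2) \<noteq> rp (c * y^2)" if "c \<in> K" "f c = 1" "\<And>s. s \<in> K \<Longrightarrow> f s \<le> 1 \<Longrightarrow> \<not> f (s^2 - c) < 1"
    "x \<in> X" "y \<in> X" for c x y
  proof
    assume "rp (x^2) = rp (c * y^2)"
    then have "f (x^2 - c * y^2) < 1" using rpeq[of "x^2" "c * y^2"] XK[OF that(4)] XK[OF that(5)] that(1,2)
      by (simp add: f_mult f_power)
    moreover have "f ((x / y)^2 - c) = f (x^2 - c * y^2)"
    proof -
      have "y \<noteq> 0" using XK[OF that(5)] by auto
      then have "(x / y)^2 - c = (x^2 - c * y^2) / y^2" by (simp add: field_simps)
      moreover have "f ((x^2 - c * y^2) / y^2) = f (x^2 - c * y^2) / f (y^2)"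
        using XK[OF that(4)] XK[OF that(5)] that(1) by (intro f_divide) auto
      ultimately show ?thesis using XK[OF that(5)] by (simp add: f_power)
    qed
    ultimately show False using that(3)[of "x / y"] XK[OF that(4)] XK[OF that(5)] by (simp add: f_divide)
  qed
  have inj: "inj_on (\<lambda>x. rp (c * x)) ((\<lambda>x. rp (x^2)) ` X)" if "c \<in> K" "f c = 1" for c
  proof (rule inj_onI)
    fix x y assume xy: "x \<in> (\<lambda>x. rp (x^2)) ` X" "y \<in> (\<lambda>x. rp (x^2)) ` X" "rp (c * x) = rp (c * y)"
    have x: "x \<in> X" and y: "y \<in> X" using xy XK XI by (auto simp: f_power)
    have "f (c * x - c * y) < 1" using rpeq[of "c * x" "c * y"] xy XK[OF x] XK[OF y] that by (simp add: f_mult)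
    then have "f (x - y) < 1" using that f_mult[of c "x - y"] XK[OF x] XK[OF y] by (simp add: right_diff_distrib)
    then show "x = y" using rpeq[of x y] XK[OF x] XK[OF y] by simp
  qed
  have "\<exists>x\<in>X. \<exists>y\<in>X. (\<lambda>x. rp (a * x)) ((\<lambda>x. rp (x^2)) x) = (\<lambda>x. rp (b * x)) ((\<lambda>x. rp (x^2)) y)"
  proof (rule pigeonhole_two_to_one)
    show "finite X" unfolding X_def by (rule finite_subset[OF _ fin]) auto
    show "X \<noteq> {}" using XI[of 1] by auto
    show "(\<lambda>x. rp (x^2)) ` X \<subseteq> X" using XK XI by (auto simp: f_power)
    fix s assume "s \<in> (\<lambda>x. rp (x^2)) ` X"
    then obtain x where x: "x \<in> X" "s = rp (x^2)" by auto
    have "y = x \<or> y = rp (- x)" if y: "y \<in> X" "rp (y^2) = s" for y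
    proof -
      have "f (y^2 - x^2) < 1" using rpeq[of "y^2" "x^2"] x y XK[OF x(1)] XK[OF y(1)] by (simp add: f_power)
      then have "f ((y - x) * (y - (- x))) < 1" by (simp add: algebra_simps power2_eq_square)
      then have "f (y - x) < 1 \<or> f (y - (- x)) < 1"
        by (intro f_mult_less_1_cases) (use XK[OF x(1)] XK[OF y(1)] in auto)
      then show ?thesis
        using rpeq[of y x] rpeq[of y "- x"] XK[OF x(1)] XK[OF y(1)] by auto
    qed
    then have "{y\<in>X. rp (y^2) = s} \<subseteq> {x, rp (- x)}" by auto
    then have "card {y\<in>X. rp (y^2) = s} \<le> card {x, rp (- x)}" by (intro card_mono) auto
    also have "\<dots> \<le> 2" by (simp add: card_insert_le_m1)
    finally show "card {y\<in>X. rp (y^2) = s} \<le> 2" .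
  next
    show "(\<lambda>x. rp (a * x)) ` (\<lambda>x. rp (x^2)) ` X \<subseteq> X"
      using XI XK a by (auto simp: f_power f_mult mul)
    show "(\<lambda>x. rp (b * x)) ` (\<lambda>x. rp (x^2)) ` X \<subseteq> X"
      using XI XK b by (auto simp: f_power f_mult mul)
    show "(\<lambda>x. rp (x^2)) ` X \<inter> (\<lambda>x. rp (a * x)) ` (\<lambda>x. rp (x^2)) ` X = {}"
      using dis[OF a] XK a by (auto simp: mul f_power)
    show "(\<lambda>x. rp (x^2)) ` X \<inter> (\<lambda>x. rp (b * x)) ` (\<lambda>x. rp (x^2)) ` X = {}"
      using dis[OF b] XK b by (auto simp: mul f_power)
  qed (use inj a b in auto)
  then obtain x y where xy: "x \<in> X" "y \<in> X" "rp (a * x^2) = rp (b * y^2)"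
    using XK a b by (auto simp: mul f_power)
  note x = XK[OF xy(1)] and y = XK[OF xy(2)]
  have "f (a * x^2 - b * y^2) < 1" using rpeq[of "a * x^2" "b * y^2"] xy a b x y by (simp add: f_mult f_power)
  moreover have "a * (x / y)^2 - b = (a * x^2 - b * y^2) / y^2"
  proof -
    have "y \<noteq> 0" using y by auto
    then show ?thesis by (simp add: field_simps)
  qed
  ultimately have "f (a * (x / y)^2 - b) < 1" using f_divide[of "a * x^2 - b * y^2" "y^2"] a b x y
    by (simp add: f_power)
  then show ?thesis using x y by (intro bexI[of _ "x / y"]) (auto simp: f_divide)
qed

text \<open>The additive counterpart in residue characteristic 2: s -> s^2 - s is additive up to
  multiples of 2 and has kernel {0, 1} on residues, so its values have index two.\<close>

lemma artin_schreier_residues: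
  assumes a: "a \<in> K" "f a \<le> 1" "\<And>s. s \<in> K \<Longrightarrow> f s \<le> 1 \<Longrightarrow> \<not> f (s^2 - s - a) < 1"
    and b: "b \<in> K" "f b \<le> 1" "\<And>s. s \<in> K \<Longrightarrow> f s \<le> 1 \<Longrightarrow> \<not> f (s^2 - s - b) < 1"
    and two: "f 2 < 1"
  shows "\<exists>s\<in>K. f s \<le> 1 \<and> f (s^2 - s + a - b) < 1"
proof -
  obtain rp where fin: "finite (rp ` {x\<in>K. f x \<le> 1})"
    and rp: "\<And>x. x \<in> K \<Longrightarrow> f x \<le> 1 \<Longrightarrow> rp x \<in> K \<and> f (rp x) \<le> 1 \<and> f (x - rp x) < 1"
    and rpeq: "\<And>x y. x \<in> K \<Longrightarrow> y \<in> K \<Longrightarrow> f x \<le> 1 \<Longrightarrow> f y \<le> 1 \<Longrightarrow> (rp x = rp y \<longleftrightarrow> f (x - y) < 1)"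
    using residue_transversal by blast
  define X where "X = rp ` {x\<in>K. f x \<le> 1}"
  have XK: "x \<in> K" "f x \<le> 1" "rp x = x" if x: "x \<in> X" for x
  proof -
    obtain y where y: "y \<in> K" "f y \<le> 1" "x = rp y" using x unfolding X_def by auto
    note ry = rp[of y]
    show "x \<in> K" using ry y by simp
    show "f x \<le> 1" using ry y by simp
    then show "rp x = x" using ry y rpeq[of x y] f_diff_commute[of x y] by simp
  qed
  have XI: "rp y \<in> X" if "y \<in> K" "f y \<le> 1" for y using that unfolding X_def by auto
  have wp: "x^2 - x \<in> K" "f (x^2 - x) \<le> 1" if "x \<in> K" "f x \<le> 1" for x
    using that f_diff_le[of "x^2" x 1] f_nonneg[of x] by (auto simp: f_power power_le_one)
  have add: "rp (rp y + c) = rp (y + c)" if "c \<in> K" "f c \<le> 1" "y \<in> K" "f y \<le> 1" for c y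
    using rpeq[of "rp y + c" "y + c"] rp[of y] that f_diff_commute[of y "rp y"] f_add_le by simp
  have additive: "f ((x^2 - x) - (y^2 - y) - ((x - y)^2 - (x - y))) < 1"
    if "x \<in> K" "y \<in> K" "f x \<le> 1" "f y \<le> 1" for x y
  proof -
    have "(x^2 - x) - (y^2 - y) - ((x - y)^2 - (x - y)) = (y * (x - y)) * 2"
      by (simp add: algebra_simps power2_eq_square)
    moreover have "f ((y * (x - y)) * 2) < 1"
      using that two f_diff_le[of x y 1] by (intro f_mult_less_1 f_mult_le_1) auto
    ultimately show ?thesis by simp
  qed
  have dis: "rp (x^2 - x) \<noteq> rp ((y^2 - y) + c)"
    if "c \<in> K" "f c \<le> 1" "\<And>s. s \<in> K \<Longrightarrow> f s \<le> 1 \<Longrightarrow> \<not> f (s^2 - s - c) < 1" "x \<in> X" "y \<in> X" for c x y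
  proof
    note x = XK[OF that(4)] and y = XK[OF that(5)]
    assume "rp (x^2 - x) = rp ((y^2 - y) + c)"
    then have 1: "f ((x^2 - x) - (y^2 - y) - c) < 1"
      using rpeq[of "x^2 - x" "(y^2 - y) + c"] wp x y that(1,2) f_add_le[of "y^2 - y" c 1]
      by (simp add: diff_diff_eq add.assoc)
    have "f (((x^2 - x) - (y^2 - y) - c) - ((x^2 - x) - (y^2 - y) - ((x - y)^2 - (x - y)))) < 1"
      by (rule f_diff_less[OF _ _ 1 additive]) (use x y that(1) in auto)
    then have "f ((x - y)^2 - (x - y) - c) < 1" by (simp add: algebra_simps)
    then show False using that(3)[of "x - y"] x y f_diff_le by simp
  qed
  have inj: "inj_on (\<lambda>x. rp (x + c)) ((\<lambda>x. rp (x^2 - x)) ` X)" if "c \<in> K" "f c \<le> 1" for c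
  proof (rule inj_onI)
    fix x y assume xy: "x \<in> (\<lambda>x. rp (x^2 - x)) ` X" "y \<in> (\<lambda>x. rp (x^2 - x)) ` X" "rp (x + c) = rp (y + c)"
    have x: "x \<in> X" and y: "y \<in> X" using xy XK XI wp by auto
    have "f (x - y) < 1" using rpeq[of "x + c" "y + c"] xy XK[OF x] XK[OF y] that f_add_le by simp
    then show "x = y" using rpeq[of x y] XK[OF x] XK[OF y] by simp
  qed
  have "\<exists>x\<in>X. \<exists>y\<in>X. (\<lambda>x. rp (x + a)) ((\<lambda>x. rp (x^2 - x)) x) = (\<lambda>x. rp (x + b)) ((\<lambda>x. rp (x^2 - x)) y)"
  proof (rule pigeonhole_two_to_one)
    show "finite X" unfolding X_def by (rule fin)
    show "X \<noteq> {}" using XI[of 1] by auto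
    show "(\<lambda>x. rp (x^2 - x)) ` X \<subseteq> X" using XK XI wp by auto
    fix s assume "s \<in> (\<lambda>x. rp (x^2 - x)) ` X"
    then obtain x where x: "x \<in> X" "s = rp (x^2 - x)" by auto
    have "y = x \<or> y = rp (1 - x)" if y: "y \<in> X" "rp (y^2 - y) = s" for y
    proof -
      have "f ((y^2 - y) - (x^2 - x)) < 1"
        using rpeq[of "y^2 - y" "x^2 - x"] x y XK[OF x(1)] XK[OF y(1)] wp by simp
      then have "f ((y - x) * (y - (1 - x))) < 1" by (simp add: algebra_simps power2_eq_square)
      then have "f (y - x) < 1 \<or> f (y - (1 - x)) < 1"
        by (intro f_mult_less_1_cases) (use XK[OF x(1)] XK[OF y(1)] in auto)
      then show ?thesis
        using rpeq[of y x] rpeq[of y "1 - x"] XK[OF x(1)] XK[OF y(1)] f_diff_le[of 1 x 1] by auto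
    qed
    then have "{y\<in>X. rp (y^2 - y) = s} \<subseteq> {x, rp (1 - x)}" by auto
    then have "card {y\<in>X. rp (y^2 - y) = s} \<le> card {x, rp (1 - x)}" by (intro card_mono) auto
    also have "\<dots> \<le> 2" by (simp add: card_insert_le_m1)
    finally show "card {y\<in>X. rp (y^2 - y) = s} \<le> 2" .
  next
    show "(\<lambda>x. rp (x + a)) ` (\<lambda>x. rp (x^2 - x)) ` X \<subseteq> X"
      using XI XK a wp f_add_le by (auto simp: add)
    show "(\<lambda>x. rp (x + b)) ` (\<lambda>x. rp (x^2 - x)) ` X \<subseteq> X"
      using XI XK b wp f_add_le by (auto simp: add)
    show "(\<lambda>x. rp (x^2 - x)) ` X \<inter> (\<lambda>x. rp (x + a)) ` (\<lambda>x. rp (x^2 - x)) ` X = {}"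
      using dis[OF a] XK a wp by (auto simp: add)
    show "(\<lambda>x. rp (x^2 - x)) ` X \<inter> (\<lambda>x. rp (x + b)) ` (\<lambda>x. rp (x^2 - x)) ` X = {}"
      using dis[OF b] XK b wp by (auto simp: add)
  qed (use inj a b in auto)
  then obtain x y where xy: "x \<in> X" "y \<in> X" "rp ((x^2 - x) + a) = rp ((y^2 - y) + b)"
    using XK a b wp by (auto simp: add)
  note x = XK[OF xy(1)] and y = XK[OF xy(2)]
  have 1: "f (((x^2 - x) + a) - ((y^2 - y) + b)) < 1"
    using rpeq[of "(x^2 - x) + a" "(y^2 - y) + b"] xy a b wp x y f_add_le by simp
  have "f ((((x^2 - x) + a) - ((y^2 - y) + b)) - ((x^2 - x) - (y^2 - y) - ((x - y)^2 - (x - y)))) < 1"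
    by (rule f_diff_less[OF _ _ 1 additive]) (use x y a b in auto)
  then have "f ((x - y)^2 - (x - y) + a - b) < 1" by (simp add: algebra_simps)
  then show ?thesis using x y f_diff_le by (intro bexI[of _ "x - y"]) auto
qed

text \<open>In residue characteristic 2 squaring is the Frobenius map of the residue field:
  injective, hence by finiteness surjective.\<close>

lemma square_residue:
  assumes a: "a \<in> K" "f a \<le> 1" and two: "f 2 < 1"
  shows "\<exists>s\<in>K. f s \<le> 1 \<and> f (s^2 - a) < 1"
proof -
  obtain rp where fin: "finite (rp ` {x\<in>K. f x \<le> 1})"
    and rp: "\<And>x. x \<in> K \<Longrightarrow> f x \<le> 1 \<Longrightarrow> rp x \<in> K \<and> f (rp x) \<le> 1 \<and> f (x - rp x) < 1"
    and rpeq: "\<And>x y. x \<in> K \<Longrightarrow> y \<in> K \<Longrightarrow> f x \<le> 1 \<Longrightarrow> f y \<le> 1 \<Longrightarrow> (rp x = rp y \<longleftrightarrow> f (x - y) < 1)"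
    using residue_transversal by blast
  define X where "X = rp ` {x\<in>K. f x \<le> 1}"
  have XK: "x \<in> K" "f x \<le> 1" "rp x = x" if x: "x \<in> X" for x
  proof -
    obtain y where y: "y \<in> K" "f y \<le> 1" "x = rp y" using x unfolding X_def by auto
    note ry = rp[of y]
    show "x \<in> K" using ry y by simp
    show "f x \<le> 1" using ry y by simp
    then show "rp x = x" using ry y rpeq[of x y] f_diff_commute[of x y] by simp
  qed
  have sq: "x^2 \<in> K" "f (x^2) \<le> 1" if "x \<in> K" "f x \<le> 1" for x
    using that f_nonneg[of x] by (auto simp: f_power power_le_one)
  have inj: "inj_on (\<lambda>x. rp (x^2)) X"
  proof (rule inj_onI)
    fix x y assume xy: "x \<in> X" "y \<in> X" "rp (x^2) = rp (y^2)"
    note x = XK[OF xy(1)] and y = XK[OF xy(2)]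
    have 1: "f (x^2 - y^2) < 1" using rpeq[of "x^2" "y^2"] sq x y xy by simp
    have 2: "f ((y * (x - y)) * 2) < 1"
      using x y two f_diff_le[of x y 1] by (intro f_mult_less_1 f_mult_le_1) auto
    have "f ((x^2 - y^2) - (y * (x - y)) * 2) < 1" by (rule f_diff_less[OF _ _ 1 2]) (use x y in auto)
    then have "f ((x - y) * (x - y)) < 1" by (simp add: algebra_simps power2_eq_square)
    then have "f (x - y) < 1" using f_mult_less_1_cases[of "x - y" "x - y"] x y by auto
    then show "x = y" using rpeq[of x y] x y by simp
  qed
  have sub: "(\<lambda>x. rp (x^2)) ` X \<subseteq> X"
  proof (rule image_subsetI)
    fix x assume "x \<in> X"
    from sq[OF XK(1,2)[OF this]] show "rp (x^2) \<in> X" unfolding X_def by (intro imageI) simp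
  qed
  have "finite X" using fin unfolding X_def .
  then have "(\<lambda>x. rp (x^2)) ` X = X" using sub inj by (rule endo_inj_surj)
  moreover have "rp a \<in> X" using a unfolding X_def by auto
  ultimately have "rp a \<in> (\<lambda>x. rp (x^2)) ` X" by simp
  then obtain x where x: "x \<in> X" "rp a = rp (x^2)" by (rule imageE)
  then have "f (x^2 - a) < 1" using rpeq[of "x^2" a] sq[OF XK(1,2)[OF x(1)]] a by simp
  then show ?thesis using XK[OF x(1)] by blast
qed

text \<open>The map s -> s^2 - s agrees at 0 and 1, so on the finite residue field it is not
  injective and hence not onto. Using it instead of squaring gives one construction for all residue
  characteristics.\<close>

lemma ex_artin_schreier_nonresidue:
  "\<exists>a\<in>K. f a \<le> 1 \<and> (\<forall>s\<in>K. f s \<le> 1 \<longrightarrow> f (s^2 - s - a) = 1)"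
proof -
  obtain rp where fin: "finite (rp ` {x\<in>K. f x \<le> 1})"
    and rp: "\<And>x. x \<in> K \<Longrightarrow> f x \<le> 1 \<Longrightarrow> rp x \<in> K \<and> f (rp x) \<le> 1 \<and> f (x - rp x) < 1"
    and rpeq: "\<And>x y. x \<in> K \<Longrightarrow> y \<in> K \<Longrightarrow> f x \<le> 1 \<Longrightarrow> f y \<le> 1 \<Longrightarrow> (rp x = rp y \<longleftrightarrow> f (x - y) < 1)"
    using residue_transversal by blast
  define X where "X = rp ` {x\<in>K. f x \<le> 1}"
  have wp: "x^2 - x \<in> K" "f (x^2 - x) \<le> 1" if "x \<in> K" "f x \<le> 1" for x
    using that f_diff_le[of "x^2" x 1] f_nonneg[of x] by (auto simp: f_power power_le_one)
  have XK: "x \<in> K" "f x \<le> 1" if "x \<in> X" for x using that rp unfolding X_def by auto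
  have cong: "rp ((rp x)^2 - rp x) = rp (x^2 - x)" if "x \<in> K" "f x \<le> 1" for x
  proof -
    have 1: "f (rp x - x) < 1" using rp[of x] that f_diff_commute[of x "rp x"] by simp
    have "f ((rp x - x) * (rp x + x - 1)) < 1"
      unfolding mult.commute[of "rp x - x"] using 1 rp[of x] that f_add_le f_diff_le
      by (intro f_mult_less_1) auto
    then have "f (((rp x)^2 - rp x) - (x^2 - x)) < 1" by (simp add: algebra_simps power2_eq_square)
    then show ?thesis using rpeq wp rp that by simp
  qed
  have "\<not> inj_on (\<lambda>x. rp (x^2 - x)) X"
  proof
    assume inj: "inj_on (\<lambda>x. rp (x^2 - x)) X"
    have "rp ((rp 0)^2 - rp 0) = rp ((rp 1)^2 - rp 1)" using cong[of 0] cong[of 1] by simp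
    then have "rp 0 = rp 1" using inj unfolding X_def by (auto dest: inj_onD)
    then show False using rpeq[of 0 1] by simp
  qed
  moreover have fX: "finite X" using fin unfolding X_def .
  moreover have sub: "(\<lambda>x. rp (x^2 - x)) ` X \<subseteq> X"
  proof (rule image_subsetI)
    fix x assume "x \<in> X"
    from wp[OF XK[OF this]] show "rp (x^2 - x) \<in> X" unfolding X_def by (intro imageI) simp
  qed
  ultimately have "(\<lambda>x. rp (x^2 - x)) ` X \<noteq> X"
    by (metis eq_card_imp_inj_on)
  then obtain a where a: "a \<in> X" "a \<notin> (\<lambda>x. rp (x^2 - x)) ` X" using sub by blast
  then obtain b where b: "b \<in> K" "f b \<le> 1" "a = rp b" unfolding X_def by auto
  have "f (s^2 - s - b) = 1" if s: "s \<in> K" "f s \<le> 1" for s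
  proof -
    have "f (s^2 - s - b) \<le> 1" using wp[OF s] b f_diff_le by simp
    moreover have "\<not> f (s^2 - s - b) < 1"
    proof
      assume "f (s^2 - s - b) < 1"
      then have "rp (s^2 - s) = a" using rpeq[of "s^2 - s" b] wp[OF s] b by simp
      then have "rp ((rp s)^2 - rp s) = a" using cong s by simp
      then show False using a(2) s unfolding X_def by auto
    qed
    ultimately show ?thesis by simp
  qed
  then show ?thesis using b by blast
qed

end

section \<open>The unramified quadratic extension\<close>

context local_field
begin

text \<open>The polynomial t^2 - t - \<open>rho\<close> is irreducible over the residue field; a
  root of it generates the unramified quadratic extension.\<close>

definition rho :: 'a where
  "rho = (SOME a. a \<in> K \<and> f a \<le> 1 \<and> (\<forall>s\<in>K. f s \<le> 1 \<longrightarrow> f (s^2 - s - a) = 1))"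

text \<open>Discriminant of the unramified quadratic extension of K.\<close>
definition udisc :: 'a where "udisc = 1 + 4 * rho"

lemma rho: "rho \<in> K" "f rho \<le> 1" "\<And>s. s \<in> K \<Longrightarrow> f s \<le> 1 \<Longrightarrow> f (s^2 - s - rho) = 1"
proof -
  have "\<exists>a. a \<in> K \<and> f a \<le> 1 \<and> (\<forall>s\<in>K. f s \<le> 1 \<longrightarrow> f (s^2 - s - a) = 1)"
    using ex_artin_schreier_nonresidue by blast
  from someI_ex[OF this] show "rho \<in> K" "f rho \<le> 1"
    "\<And>s. s \<in> K \<Longrightarrow> f s \<le> 1 \<Longrightarrow> f (s^2 - s - rho) = 1" unfolding rho_def[symmetric] by blast+
qed

lemma f_rho: "f rho = 1" using rho(3)[of 0] rho(1) by simp

lemma rho_nonzero: "rho \<noteq> 0" using f_rho by auto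

lemma udisc_K [simp]: "udisc \<in> K" unfolding udisc_def using rho by simp

text \<open>Completing the square by s = (1 + t)/2, which is integral because 2 is a unit.\<close>

lemma udisc_nonsquare_residue:
  assumes "f 2 = 1" "t \<in> K" "f t \<le> 1" shows "f (t^2 - udisc) = 1"
proof -
  have "f ((1 + t) / 2) \<le> 1" using assms f_add_le[of 1 t 1] by (simp add: f_divide)
  then have "f (((1 + t) / 2)^2 - (1 + t) / 2 - rho) = 1" using assms by (intro rho) auto
  moreover have "((1 + t) / 2)^2 - (1 + t) / 2 - rho = (t^2 - udisc) / 4"
    unfolding udisc_def by (simp add: field_simps power2_eq_square)
  ultimately show ?thesis using assms by (simp add: f_divide f_4)
qed

lemma f_udisc: "f udisc = 1"
proof (cases "f 2 = 1")
  case True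
  then show ?thesis using udisc_nonsquare_residue[of 0] by simp
next
  case False
  then have "f 2 < 1" using f_numeral[of "num.Bit0 num.One"] by simp
  then have "f (4 * rho) < 1" using f_2_pos rho f_rho by (simp add: f_mult f_4 power_less_one_iff)
  then show ?thesis unfolding udisc_def using f_add_eq[of "4 * rho" 1] rho by (simp add: add.commute)
qed

lemma udisc_nonzero [simp]: "udisc \<noteq> 0" using f_udisc by auto

text \<open>This is the norm form of the unramified extension on an integral basis. If x dominates,
  so does x^2; otherwise dividing by y^2 leaves a unit, as t^2 - t - \<open>rho\<close> has no root
  modulo the maximal ideal. Hence norms have even valuation.\<close>

lemma unramified_norm_value:
  assumes "x \<in> K" "y \<in> K" shows "\<exists>e\<in>K. f (x^2 + x * y - rho * y^2) = f e ^ 2"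
proof (cases "f x \<le> f y")
  case True
  show ?thesis
  proof (cases "y = 0")
    case True
    then show ?thesis using assms by (intro bexI[of _ x]) (auto simp: f_power)
  next
    case False
    have "f (- x / y) \<le> 1" using assms True f_pos[of y] False by (simp add: f_divide)
    then have "f ((- x / y)^2 - (- x / y) - rho) = 1" using assms by (intro rho) auto
    moreover have "x^2 + x * y - rho * y^2 = y^2 * ((- x / y)^2 - (- x / y) - rho)"
      using False by (simp add: field_simps power2_eq_square)
    ultimately have "f (x^2 + x * y - rho * y^2) = f y ^ 2"
      using f_mult[of "y^2" "(- x / y)^2 - (- x / y) - rho"] assms rho by (simp add: f_power)
    then show ?thesis using assms by blast
  qed
next
  case False
  then have "y = 0 \<or> f y < f x" by auto
  have xp: "0 < f x" using False f_nonneg[of y] assms by linarith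
  have "f (x * y) < f x ^ 2" using False xp assms by (simp add: f_mult power2_eq_square)
  moreover have "f (rho * y^2) < f x ^ 2"
    using False f_nonneg[of y] assms rho f_rho by (simp add: f_mult f_power power_strict_mono)
  ultimately have "f (x * y - rho * y^2) < f (x^2)"
    using f_diff_less[of "x * y" "rho * y^2" "f x ^ 2"] assms rho by (simp add: f_power)
  then have "f ((x * y - rho * y^2) + x^2) = f (x^2)" using assms rho by (intro f_add_eq) auto
  then have "f (x^2 + x * y - rho * y^2) = f x ^ 2" using assms by (simp add: f_power algebra_simps)
  then show ?thesis using assms by blast
qed

lemma hil_udisc_even:
  assumes "c \<in> K" "hil K udisc c" shows "\<exists>e\<in>K. f c = f e ^ 2"
proof -
  obtain x y where xy: "x \<in> K" "y \<in> K" "c = x^2 - udisc * y^2"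
    using assms hil_iff_norm[of udisc c] by auto
  \<comment> \<open>With omega = (1 + sqrt \<open>udisc\<close>)/2, of trace 1 and norm
    -\<open>rho\<close>, one has x + y*sqrt \<open>udisc\<close> = (x - y) + 2*y*omega.\<close>
  have "c = (x - y)^2 + (x - y) * (2 * y) - rho * (2 * y)^2"
    unfolding xy udisc_def by (simp add: algebra_simps power2_eq_square)
  then show ?thesis using unramified_norm_value[of "x - y" "2 * y"] xy(1,2) by auto
qed

text \<open>Solve 1 + d = N(1 + y*omega) = 1 + y - \<open>rho\<close>*y^2, where omega has trace 1:
  the linear coefficient is a unit, so Hensel applies whether or not 2 is one. The unknown t =
  \<open>rho\<close>*y makes the equation monic.\<close>

lemma hil_udisc_one_plus:
  assumes "d \<in> K" "f d < 1" shows "hil K udisc (1 + d)"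
proof -
  have "f (rho * d) < f (- 1) ^ 2" using assms rho f_rho by (simp add: f_mult)
  then obtain t where t: "t \<in> K" "t^2 + (- 1) * t + rho * d = 0"
    using hensel_quadratic[of "-1" "rho * d"] assms rho by auto
  define y where "y = t / rho"
  have y: "y \<in> K" unfolding y_def using t rho by auto
  have "rho * d = t - t^2" using t by (simp add: algebra_simps)
  moreover have "rho * (y - rho * y^2) = t - t^2"
    unfolding y_def using rho_nonzero by (simp add: field_simps power2_eq_square)
  ultimately have "rho * (y - rho * y^2) = rho * d" by simp
  then have "d = y - rho * y^2" using rho_nonzero by simp
  then have "1 + d = (1 + y / 2)^2 - udisc * (y / 2)^2"
    unfolding udisc_def by (simp add: algebra_simps power2_eq_square)
  then show ?thesis using hil_norm[of udisc "1 + y / 2" "y / 2"] y by simp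
qed

lemma square_ratio_odd:
  assumes "f 2 = 1" "a \<in> K" "b \<in> K" "f a = 1" "f (a - b) < 1"
  shows "\<exists>s\<in>K. b = a * s^2"
proof -
  have a0: "a \<noteq> 0" using assms by auto
  have "f ((b - a) / (4 * a)) < 1"
    using assms f_diff_commute[of a b] by (simp add: f_divide f_mult f_4)
  then obtain s where s: "s \<in> K" "1 + 4 * ((b - a) / (4 * a)) = s^2"
    using square_1_plus_4[of "(b - a) / (4 * a)"] assms by auto
  have "b = a * (1 + 4 * ((b - a) / (4 * a)))" using a0 by (simp add: field_simps)
  then show ?thesis using s by auto
qed

text \<open>Otherwise all unit norms are squares modulo the maximal ideal. Then
  -\<open>udisc\<close>, the norm of sqrt \<open>udisc\<close>, is a square, so sums of two squares
  and hence all natural numbers are squares. By finiteness -1 is congruent to a natural number, and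
  \<open>udisc\<close> = (-1)*(-\<open>udisc\<close>) becomes a square.\<close>

lemma norm_nonsquare_residue:
  assumes two: "f 2 = 1"
  shows "\<exists>x\<in>K. \<exists>y\<in>K. f x \<le> 1 \<and> f y \<le> 1 \<and> f (x^2 - udisc * y^2) = 1 \<and>
    (\<forall>s\<in>K. f s \<le> 1 \<longrightarrow> \<not> f (s^2 - (x^2 - udisc * y^2)) < 1)"
proof (rule ccontr)
  assume "\<not> ?thesis"
  then have sq: "\<exists>s\<in>K. f s \<le> 1 \<and> f (s^2 - (x^2 - udisc * y^2)) < 1"
    if "x \<in> K" "y \<in> K" "f x \<le> 1" "f y \<le> 1" "f (x^2 - udisc * y^2) = 1" for x y
    using that by blast
  have le1: "f (s^2) \<le> 1" if "s \<in> K" "f s \<le> 1" for s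
    using that f_nonneg[of s] by (simp add: f_power power_le_one)
  obtain t where t: "t \<in> K" "f t \<le> 1" "f (t^2 - (- udisc)) < 1"
    using sq[of 0 1] f_udisc by auto
  have ft: "f t = 1"
  proof (rule ccontr)
    assume "f t \<noteq> 1"
    then have "f t < 1" using t by simp
    then have "f (t^2) < 1" using t f_nonneg[of t] by (simp add: f_power power_less_one_iff)
    then have "f (t^2 - (t^2 - (- udisc))) < 1" using t f_diff_less[of "t^2" "t^2 - (- udisc)" 1] by simp
    then show False using f_udisc by simp
  qed
  have sum: "\<exists>s\<in>K. f s \<le> 1 \<and> f (s^2 - (x^2 + z^2)) < 1"
    if xz: "x \<in> K" "z \<in> K" "f x \<le> 1" "f z \<le> 1" for x z
  proof -
    \<comment> \<open>As t^2 is congruent to -\<open>udisc\<close>, the norm x^2 -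
      \<open>udisc\<close>*y^2 is congruent to x^2 + z^2.\<close>
    define y where "y = z / t"
    have t0: "t \<noteq> 0" using ft by auto
    have y: "y \<in> K" "f y \<le> 1" "z = y * t" unfolding y_def using xz t ft t0 by (auto simp: f_divide)
    have "(x^2 - udisc * y^2) - (x^2 + z^2) = - (y^2 * (t^2 - (- udisc)))"
      unfolding y(3) by (simp add: algebra_simps power2_eq_square)
    then have close: "f ((x^2 - udisc * y^2) - (x^2 + z^2)) < 1"
      using f_mult_less_1[of "y^2" "t^2 - (- udisc)"] y t le1 by simp
    show ?thesis
    proof (cases "f (x^2 - udisc * y^2) = 1")
      case True
      then obtain s where s: "s \<in> K" "f s \<le> 1" "f (s^2 - (x^2 - udisc * y^2)) < 1"
        using sq xz y by blast
      have "f (s^2 - (x^2 + z^2)) < 1"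
        by (rule res_trans[OF _ _ _ s(3) close]) (use s y xz in auto)
      then show ?thesis using s by blast
    next
      case False
      have "f (x^2 - udisc * y^2) \<le> 1"
        using xz y le1 f_udisc by (intro f_diff_le) (auto simp: f_mult)
      then have "f (x^2 - udisc * y^2) < 1" using False by simp
      then have "f ((x^2 - udisc * y^2) - ((x^2 - udisc * y^2) - (x^2 + z^2))) < 1"
        using close xz y by (rule_tac f_diff_less) auto
      then have "f (x^2 + z^2) < 1" by simp
      then have "f (0^2 - (x^2 + z^2)) < 1" using xz f_uminus[of "x^2 + z^2"] by simp
      then show ?thesis by (intro bexI[of _ 0]) auto
    qed
  qed
  have nat: "\<exists>s\<in>K. f s \<le> 1 \<and> f (s^2 - of_nat n) < 1" for n
  proof (induction n)
    case 0
    then show ?case by (intro bexI[of _ 0]) auto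
  next
    case (Suc n)
    then obtain s where s: "s \<in> K" "f s \<le> 1" "f (s^2 - of_nat n) < 1" by blast
    obtain r where r: "r \<in> K" "f r \<le> 1" "f (r^2 - (s^2 + 1^2)) < 1" using sum[of s 1] s by auto
    have "f (r^2 - of_nat (Suc n)) < 1"
      by (rule res_trans[OF _ _ _ r(3)]) (use s r in auto)
    then show ?case using r by blast
  qed
  obtain rp where fin: "finite (rp ` {x\<in>K. f x \<le> 1})"
    and "\<And>x. x \<in> K \<Longrightarrow> f x \<le> 1 \<Longrightarrow> rp x \<in> K \<and> f (rp x) \<le> 1 \<and> f (x - rp x) < 1"
    and rpeq: "\<And>x y. x \<in> K \<Longrightarrow> y \<in> K \<Longrightarrow> f x \<le> 1 \<Longrightarrow> f y \<le> 1 \<Longrightarrow> (rp x = rp y \<longleftrightarrow> f (x - y) < 1)"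
    using residue_transversal by blast
  have "\<not> inj (\<lambda>n::nat. rp (of_nat n))"
  proof
    assume "inj (\<lambda>n::nat. rp (of_nat n))"
    moreover have "range (\<lambda>n::nat. rp (of_nat n)) \<subseteq> rp ` {x\<in>K. f x \<le> 1}" using f_of_nat by auto
    then have "finite (range (\<lambda>n::nat. rp (of_nat n)))" using fin finite_subset by blast
    ultimately show False using finite_imageD infinite_UNIV_nat by blast
  qed
  then obtain i j :: nat where "i \<noteq> j" "rp (of_nat i) = rp (of_nat j)" unfolding inj_on_def by auto
  then have "\<exists>i j :: nat. i < j \<and> rp (of_nat j) = rp (of_nat i)"
    by (metis linorder_less_linear)
  then obtain i j :: nat where ij: "i < j" "rp (of_nat j) = rp (of_nat i)" by blast
  have "f (of_nat j - of_nat i) < 1" using rpeq ij f_of_nat by auto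
  then have fm: "f (of_nat (j - i)) < 1" using ij by (simp add: of_nat_diff)
  \<comment> \<open>Since j - i vanishes in the residue field, n = j - i - 1 represents -1.\<close>
  obtain n where n: "j - i = Suc n" using ij by (metis Suc_diff_Suc)
  obtain s where s: "s \<in> K" "f s \<le> 1" "f (s^2 - of_nat n) < 1" using nat by blast
  have "f ((s^2 - of_nat n) + of_nat (j - i)) < 1" using s fm by (rule_tac f_add_less) auto
  then have s1: "f (s^2 - (- 1)) < 1" unfolding n by (simp add: algebra_simps)
  have "f (s^2 * t^2 - (- 1) * (- udisc)) < 1"
    by (rule res_mult) (use s s1 t le1 f_udisc in auto)
  then have "f ((s * t)^2 - udisc) < 1" by (simp add: power_mult_distrib)
  then show False using udisc_nonsquare_residue[OF two, of "s * t"] s t f_mult_le_1 by simp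
qed

text \<open>A unit is matched with a norm modulo the maximal ideal, and the quotient is then a norm
  by Hensel. In residue characteristic 2 every residue is a square; otherwise a nonsquare residue
  lies in the class of the norm from \<open>norm_nonsquare_residue\<close>.\<close>

lemma hil_udisc_unit:
  assumes c: "c \<in> K" "f c = 1" shows "hil K udisc c"
proof (cases "f 2 < 1")
  case True
  obtain s where s: "s \<in> K" "f s \<le> 1" "f (s^2 - c) < 1" using square_residue[of c] c True by auto
  have "f (c + (s^2 - c)) = 1" using f_add_eq[of "s^2 - c" c] s c by (simp add: add.commute)
  then have fs: "f (s^2) = 1" by simp
  then have s0: "s \<noteq> 0" by auto
  have "f ((c - s^2) / s^2) < 1" using s c fs f_diff_commute[of c "s^2"] by (simp add: f_divide)
  then have "hil K udisc (1 + (c - s^2) / s^2)" using s c by (intro hil_udisc_one_plus) auto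
  then have "hil K udisc ((1 + (c - s^2) / s^2) * s^2)"
    using hil_mult_square[of udisc "1 + (c - s^2) / s^2" s] s c s0 by simp
  then show ?thesis using s0 by (simp add: field_simps)
next
  case False
  then have two: "f 2 = 1" using f_numeral[of "num.Bit0 num.One"] by simp
  show ?thesis
  proof (cases "\<exists>s\<in>K. f s \<le> 1 \<and> f (s^2 - c) < 1")
    case True
    then obtain s where s: "s \<in> K" "f s \<le> 1" "f (s^2 - c) < 1" by blast
    obtain r where r: "r \<in> K" "s^2 = c * r^2"
      using square_ratio_odd[of c "s^2"] two c s f_diff_commute[of c "s^2"] by auto
    have "f (c + (s^2 - c)) = 1" using f_add_eq[of "s^2 - c" c] s c by (simp add: add.commute)
    then have "s \<noteq> 0" by auto
    then have r0: "r \<noteq> 0" using r by auto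
    have "hil K udisc (c * r^2)" using r s hil_square_right[of s] by simp
    then show ?thesis using hil_mult_square[of udisc c r] c r r0 by simp
  next
    case False
    obtain x y where xy: "x \<in> K" "y \<in> K" "f x \<le> 1" "f y \<le> 1" "f (x^2 - udisc * y^2) = 1"
      "\<And>s. s \<in> K \<Longrightarrow> f s \<le> 1 \<Longrightarrow> \<not> f (s^2 - (x^2 - udisc * y^2)) < 1"
      using norm_nonsquare_residue[OF two] by blast
    define d where "d = x^2 - udisc * y^2"
    have d: "d \<in> K" "f d = 1" "hil K udisc d" unfolding d_def using xy hil_norm by auto
    obtain s where s: "s \<in> K" "f s = 1" "f (d * s^2 - c) < 1"
      using nonsquare_residues[of d c] d(1,2) xy(6)[folded d_def] c False by blast
    obtain r where r: "r \<in> K" "c = d * s^2 * r^2"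
      using square_ratio_odd[of "d * s^2" c] two c s d by (auto simp: f_mult f_power)
    have "hil K udisc (d * (s * r)^2)" using hil_mult[of udisc d "(s * r)^2"] hil_square_right[of "s * r"] d s r
      by simp
    then show ?thesis unfolding r by (simp add: power_mult_distrib mult.assoc)
  qed
qed

lemma even_hil_udisc:
  assumes "c \<in> K" "e \<in> K" "c \<noteq> 0" "f c = f e ^ 2" shows "hil K udisc c"
proof -
  have e0: "e \<noteq> 0" using assms f_pos[of c] by auto
  have "f (c / e^2) = 1" using assms e0 f_pos[of e] by (simp add: f_divide f_power)
  then have "hil K udisc (c / e^2)" using assms by (intro hil_udisc_unit) auto
  then have "hil K udisc (c / e^2 * e^2)" using assms e0 hil_mult_square[of udisc "c / e^2" e] by simp
  then show ?thesis using e0 by simp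
qed

text \<open>Up to squares there is only one unramified discriminant.\<close>
lemma unramified_disc:
  assumes T: "T \<in> K" "f T \<le> 1" and n: "n \<in> K" "f n \<le> 1"
    and irr: "\<And>t. t \<in> K \<Longrightarrow> f t \<le> 1 \<Longrightarrow> f (t^2 - T * t + n) = 1"
  shows "\<exists>s\<in>K. s \<noteq> 0 \<and> T^2 - 4 * n = udisc * s^2"
proof (cases "f 2 < 1")
  case False
  then have two: "f 2 = 1" using f_numeral[of "num.Bit0 num.One"] by simp
  have irr': "f (s^2 - (T^2 - 4 * n)) = 1" if s: "s \<in> K" "f s \<le> 1" for s
  proof -
    have "f ((s + T) / 2) \<le> 1" using s T two f_add_le by (simp add: f_divide)
    then have "f (((s + T) / 2)^2 - T * ((s + T) / 2) + n) = 1" using s T by (intro irr) auto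
    moreover have "((s + T) / 2)^2 - T * ((s + T) / 2) + n = (s^2 - (T^2 - 4 * n)) / 4"
      by (simp add: field_simps power2_eq_square)
    ultimately have "f ((s^2 - (T^2 - 4 * n)) / 4) = 1" by (simp only:)
    then show ?thesis using s T n two f_divide[of "s^2 - (T^2 - 4 * n)" 4] by (simp add: f_4)
  qed
  have fd: "f (T^2 - 4 * n) = 1" using irr'[of 0] f_uminus[of "T^2 - 4 * n"] T n by simp
  obtain s where s: "s \<in> K" "f s = 1" "f (udisc * s^2 - (T^2 - 4 * n)) < 1"
    using nonsquare_residues[of udisc "T^2 - 4 * n"] f_udisc udisc_nonsquare_residue[OF two] irr' fd T n
    by auto
  obtain r where r: "r \<in> K" "T^2 - 4 * n = udisc * s^2 * r^2"
    using square_ratio_odd[of "udisc * s^2" "T^2 - 4 * n"] two s T n f_udisc by (auto simp: f_mult f_power)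
  have "T^2 - 4 * n = udisc * (s * r)^2" using r by (simp add: power_mult_distrib mult.assoc)
  moreover have "s * r \<noteq> 0" using calculation fd by auto
  ultimately show ?thesis using s r by blast
next
  case True
  obtain t where t: "t \<in> K" "f t \<le> 1" "f (t^2 - (- n)) < 1" using square_residue[of "- n"] n True by auto
  \<comment> \<open>With t^2 congruent to -n, a non-unit T would make t a root modulo the maximal
    ideal.\<close>
  have fT: "f T = 1"
  proof (rule ccontr)
    assume "f T \<noteq> 1"
    then have "f (t * T) < 1" using T t by (intro f_mult_less_1) auto
    then have "f ((t^2 - (- n)) - t * T) < 1" using t T n by (rule_tac f_diff_less) auto
    then show False using irr[of t] t by (simp add: algebra_simps)
  qed
  have T0: "T \<noteq> 0" using fT by auto
  \<comment> \<open>The substitution t = T*s turns t^2 - T*t + n into T^2*(s^2 - s - b).\<close>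
  define b where "b = - n / T^2"
  have b: "b \<in> K" "f b \<le> 1" unfolding b_def using n T fT by (auto simp: f_divide f_power)
  have irrb: "\<not> f (s^2 - s - b) < 1" if s: "s \<in> K" "f s \<le> 1" for s
  proof -
    have "f ((T * s)^2 - T * (T * s) + n) = 1" using s T fT by (intro irr) (auto simp: f_mult)
    moreover have "(T * s)^2 - T * (T * s) + n = T^2 * (s^2 - s - b)"
      unfolding b_def using T0 by (simp add: field_simps power2_eq_square)
    ultimately show ?thesis using s b T fT f_mult[of "T^2" "s^2 - s - b"] by (simp add: f_power)
  qed
  have "\<And>s. s \<in> K \<Longrightarrow> f s \<le> 1 \<Longrightarrow> \<not> f (s^2 - s - rho) < 1" using rho(3) by simp
  then obtain x where x: "x \<in> K" "f x \<le> 1" "f (x^2 - x + rho - b) < 1"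
    using artin_schreier_residues[of rho b] rho(1,2) b irrb True by blast
  define m where "m = x^2 - x"
  have m: "m \<in> K" "f m \<le> 1" unfolding m_def
    using x f_nonneg[of x] f_diff_le[of "x^2" x 1] by (auto simp: f_power power_le_one)
  \<comment> \<open>Since 1 + 4*m = (1 - 2*x)^2, this A satisfies 1 + 4*A = (1 +
    4*\<open>rho\<close>)*(1 + 4*m). It is congruent to b, so 1 + 4*b and 1 + 4*A differ by a square
    factor.\<close>
  define A where "A = rho + m + 4 * rho * m"
  have A: "A \<in> K" unfolding A_def using rho m by auto
  have f4: "f 4 < 1" using True f_2_pos by (simp add: f_4 power_less_one_iff)
  have "f ((rho * m) * 4) < 1" using f4 rho m by (intro f_mult_less_1 f_mult_le_1) auto
  then have "f ((x^2 - x + rho - b) + (rho * m) * 4) < 1" using x rho m b by (rule_tac f_add_less) auto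
  then have Ab: "f (A - b) < 1" unfolding A_def m_def by (simp add: algebra_simps)
  have eqA: "1 + 4 * A = udisc * (1 - 2 * x)^2"
    unfolding A_def m_def udisc_def by (simp add: algebra_simps power2_eq_square)
  have fA: "f A \<le> 1" unfolding A_def using rho m f_numeral by (intro f_add_le f_mult_le_1) auto
  have "f (A * 4) < 1" using f4 A fA by (intro f_mult_less_1) auto
  then have f1A: "f (1 + 4 * A) = 1" using f_add_eq[of "A * 4" 1] A by (simp add: algebra_simps)
  then have A0: "1 + 4 * A \<noteq> 0" by auto
  have "f ((b - A) / (1 + 4 * A)) < 1" using Ab f1A A b f_diff_commute[of A b] by (simp add: f_divide)
  then obtain r where r: "r \<in> K" "1 + 4 * ((b - A) / (1 + 4 * A)) = r^2"
    using square_1_plus_4[of "(b - A) / (1 + 4 * A)"] A b by auto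
  have "1 + 4 * b = (1 + 4 * A) * (1 + 4 * ((b - A) / (1 + 4 * A)))"
    using A0 by (simp add: field_simps)
  then have b4: "1 + 4 * b = udisc * ((1 - 2 * x) * r)^2" using r eqA by (simp add: power_mult_distrib)
  have eq: "T^2 - 4 * n = T^2 * (1 + 4 * b)" unfolding b_def using T0 by (simp add: field_simps)
  then have "T^2 - 4 * n = udisc * (T * ((1 - 2 * x) * r))^2" unfolding b4 by (simp add: power_mult_distrib)
  moreover have "1 + 4 * b \<noteq> 0"
  proof -
    have "f (b * 4) < 1" using f4 b by (intro f_mult_less_1) auto
    then have "f (1 + 4 * b) = 1" using f_add_eq[of "b * 4" 1] b by (simp add: algebra_simps)
    then show ?thesis by auto
  qed
  then have "T * ((1 - 2 * x) * r) \<noteq> 0" using b4 T0 by auto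
  ultimately show ?thesis using T x r by blast
qed

end

section \<open>Anisotropic quadratic forms\<close>

text \<open>\<open>B\<close> is the polar form Q(x + y) - Q x - Q y and not half of it, so residue
  characteristic 2 is covered; \<open>Q_comb\<close> bundles this with the homogeneity of
  \<open>Q\<close>. The instances are norm forms in two variables and the form on trace zero
  quaternions.\<close>

locale anisotropic_form = local_field K f
  for K :: "'a::field_char_0 set" and f :: "'a \<Rightarrow> real" +
  fixes V :: "'v::ab_group_add set" and sc :: "'a \<Rightarrow> 'v \<Rightarrow> 'v" and Q :: "'v \<Rightarrow> 'a" and B :: "'v \<Rightarrow> 'v \<Rightarrow> 'a"
  assumes V_add: "x \<in> V \<Longrightarrow> y \<in> V \<Longrightarrow> x + y \<in> V"
    and V_sc: "a \<in> K \<Longrightarrow> x \<in> V \<Longrightarrow> sc a x \<in> V"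
    and sc_add: "sc (a + b) x = sc a x + sc b x"
    and sc_sc: "sc a (sc b x) = sc (a * b) x"
    and sc_1: "sc 1 x = x"
    and Q_K: "x \<in> V \<Longrightarrow> Q x \<in> K" and B_K: "x \<in> V \<Longrightarrow> y \<in> V \<Longrightarrow> B x y \<in> K"
    and Q_comb: "a \<in> K \<Longrightarrow> b \<in> K \<Longrightarrow> Q (sc a x + sc b y) = a^2 * Q x + a * b * B x y + b^2 * Q y"
    and Q_anisotropic: "x \<in> V \<Longrightarrow> Q x = 0 \<Longrightarrow> x = 0"
begin

lemma sc_0 [simp]: "sc 0 x = 0" using sc_add[of 0 0 x] by simp

lemma sc_uminus: "sc (- a) x = - sc a x"
  using sc_add[of a "- a" x] by (simp add: eq_neg_iff_add_eq_0 add.commute)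

lemma Q_sc: "a \<in> K \<Longrightarrow> Q (sc a x) = a^2 * Q x"
  using Q_comb[of a 0 x x] by simp

lemma Q_0 [simp]: "Q 0 = 0" using Q_sc[of 0 0] by simp

lemma Q_add: "Q (x + y) = Q x + B x y + Q y"
  using Q_comb[of 1 1 x y] by (simp add: sc_1)

lemma Q_diff_sc: assumes "c \<in> K" shows "Q (y - sc c x) = Q y - c * B x y + c^2 * Q x"
proof -
  have "y - sc c x = sc (- c) x + sc 1 y" by (simp add: sc_uminus sc_1)
  then show ?thesis using assms by (simp add: Q_comb)
qed

lemma V_diff: "x \<in> V \<Longrightarrow> y \<in> V \<Longrightarrow> x - y \<in> V"
  using V_add[of x "sc (- 1) y"] V_sc[of "-1" y] by (simp add: sc_uminus sc_1)

lemma f_Q_pos: "x \<in> V \<Longrightarrow> x \<noteq> 0 \<Longrightarrow> f (Q x) > 0"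
  using f_pos[of "Q x"] Q_K Q_anisotropic by blast

text \<open>If the bound failed, Hensel would give a root t of Q(y + t*x) = 0, anisotropy would
  force y = -t*x, and then B x y = -2*t*Q x satisfies the bound after all. It makes the square root
  of f (Q x) an ultrametric norm.\<close>

lemma f_B_bound:
  assumes x: "x \<in> V" and y: "y \<in> V" shows "f (B x y) ^ 2 \<le> f (Q x) * f (Q y)"
proof (cases "x = 0")
  case True
  have "B x y = 0" using Q_add[of x y] True by simp
  then show ?thesis using x y f_nonneg Q_K by simp
next
  case False
  then have Qx: "Q x \<noteq> 0" "Q x \<in> K" using Q_anisotropic x Q_K by auto
  show ?thesis
  proof (rule ccontr)
    assume neg: "\<not> ?thesis"
    have "f (Q y / Q x) < f (B x y / Q x) ^ 2"
      using neg Qx Q_K[OF y] B_K[OF x y] f_pos[of "Q x"]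
      by (simp add: f_divide field_simps power2_eq_square)
    then obtain t where t: "t \<in> K" "t^2 + B x y / Q x * t + Q y / Q x = 0"
      using hensel_quadratic[of "B x y / Q x" "Q y / Q x"] Qx Q_K[OF y] B_K[OF x y] by auto
    have "Q (y - sc (- t) x) = Q x * (t^2 + B x y / Q x * t + Q y / Q x)"
      using Qx t(1) by (simp add: Q_diff_sc field_simps)
    then have "y - sc (- t) x = 0" using t x y V_diff[of y "sc (- t) x"] V_sc[of "- t" x] Q_anisotropic[of "y - sc (- t) x"] by simp
    then have y_eq: "y = sc (- t) x" by simp
    then have "x + y = sc (1 - t) x" using sc_add[of 1 "- t" x] by (simp add: sc_1)
    then have "Q (x + y) = (1 - t)^2 * Q x" using Q_sc t(1) by simp
    moreover have Qy: "Q y = t^2 * Q x" using y_eq Q_sc[of "- t" x] t(1) by simp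
    ultimately have "(1 - t)^2 * Q x = Q x + B x y + t^2 * Q x" using Q_add[of x y] by simp
    then have "B x y = - (2 * t * Q x)"
      by (simp add: algebra_simps power2_eq_square eq_neg_iff_add_eq_0)
    then have "f (B x y) = f 2 * f t * f (Q x)" using t Qx by (simp add: f_mult)
    then have "f (B x y) ^ 2 = f 4 * (f (Q x) * f (Q y))"
      using Qy t Qx by (simp add: f_mult f_power f_4 power2_eq_square)
    also have "\<dots> \<le> 1 * (f (Q x) * f (Q y))"
      using f_numeral f_nonneg Q_K x y by (intro mult_right_mono) auto
    finally show False using neg by simp
  qed
qed

lemma f_B_le:
  assumes "x \<in> V" "y \<in> V" "f (Q x) \<le> r" "f (Q y) \<le> r" shows "f (B x y) \<le> r"
proof -
  have r: "0 \<le> r" using assms f_nonneg[of "Q x"] Q_K by force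
  have "f (B x y) ^ 2 \<le> r ^ 2"
    using f_B_bound[OF assms(1,2)] assms f_nonneg Q_K
    by (smt (verit) mult_mono power2_eq_square)
  then show ?thesis using r power2_le_imp_le by blast
qed

lemma f_Q_add_le:
  assumes "x \<in> V" "y \<in> V" "f (Q x) \<le> r" "f (Q y) \<le> r" shows "f (Q (x + y)) \<le> r"
  unfolding Q_add using assms f_B_le Q_K B_K by (intro f_add_le) auto

lemma f_Q_uminus: "x \<in> V \<Longrightarrow> Q (- x) = Q x"
  using Q_sc[of "- 1" x] by (simp add: sc_uminus sc_1)

lemma f_Q_diff_le:
  assumes "x \<in> V" "y \<in> V" "f (Q x) \<le> r" "f (Q y) \<le> r" shows "f (Q (x - y)) \<le> r"
  using f_Q_add_le[of x "- y" r] assms V_diff[of 0 y] V_diff[of y y] f_Q_uminus[of y] by simp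

lemma f_less_unif:
  assumes "a \<in> K" "b \<in> K" "f a < f b" shows "f a \<le> f unif * f b"
proof -
  have "f b > 0" using assms f_nonneg[of a] by linarith
  moreover from this have "f (a / b) < 1" using assms by (simp add: f_divide)
  then have "f (a / b) \<le> f unif" using assms unif(4) by auto
  ultimately show ?thesis using assms by (simp add: f_divide field_simps)
qed

text \<open>Successive approximation: if every vector can be shortened by a combination of two fixed
  vectors, completeness of the field puts it into their span.\<close>
lemma span_by_approximation:
  assumes x0: "x0 \<in> V" and x1: "x1 \<in> V" and M: "M \<ge> 0"
    and step: "\<And>y. y \<in> V \<Longrightarrow> \<exists>a\<in>K. \<exists>b\<in>K. f a ^ 2 \<le> M * f (Q y) \<and> f b ^ 2 \<le> M * f (Q y) \<and>
      f (Q (y - sc a x0 - sc b x1)) \<le> f unif * f (Q y)"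
    and y: "y \<in> V"
  shows "\<exists>a\<in>K. \<exists>b\<in>K. y = sc a x0 + sc b x1"
proof -
  define good where "good = (\<lambda>y p. fst p \<in> K \<and> snd p \<in> K \<and> f (fst p) ^ 2 \<le> M * f (Q y) \<and>
    f (snd p) ^ 2 \<le> M * f (Q y) \<and> f (Q (y - sc (fst p) x0 - sc (snd p) x1)) \<le> f unif * f (Q y))"
  define pick where "pick = (\<lambda>y. SOME p. good y p)"
  have pick: "good z (pick z)" if z: "z \<in> V" for z
  proof -
    obtain a b where "good z (a, b)" using step[OF z] unfolding good_def by auto
    then show ?thesis unfolding pick_def by (rule someI)
  qed
  define rest where "rest = (\<lambda>p. y - sc (fst p) x0 - sc (snd p) x1)"
  \<comment> \<open>\<open>s\<close> collects the partial sums of both coefficients;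
    \<open>rest\<close> is the remainder of y, which shrinks by the factor \<open>f unif\<close> in
    each round.\<close>
  define s where "s = rec_nat (0, 0) (\<lambda>_ p. (fst p + fst (pick (rest p)), snd p + snd (pick (rest p))))"
  have s0: "s 0 = (0, 0)" and sS: "s (Suc n) = (fst (s n) + fst (pick (rest (s n))), snd (s n) + snd (pick (rest (s n))))" for n
    unfolding s_def by auto
  have restV: "rest p \<in> V" if "fst p \<in> K" "snd p \<in> K" for p
    unfolding rest_def using that x0 x1 y V_diff V_sc by auto
  have sK: "fst (s n) \<in> K \<and> snd (s n) \<in> K" for n
  proof (induction n)
    case (Suc n)
    then show ?case using pick[OF restV[of "s n"]] unfolding sS good_def by auto
  qed (simp add: s0)
  define w where "w = (\<lambda>n. rest (s n))"
  have wV: "w n \<in> V" for n unfolding w_def using restV sK by auto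
  have wS: "w (Suc n) = w n - sc (fst (pick (w n))) x0 - sc (snd (pick (w n))) x1" for n
    unfolding w_def sS rest_def by (simp add: sc_add algebra_simps)
  define C where "C = f (Q y)"
  have C: "C \<ge> 0" unfolding C_def using f_nonneg Q_K y by auto
  have wb: "f (Q (w n)) \<le> C * f unif ^ n" for n
  proof (induction n)
    case 0
    then show ?case unfolding w_def s0 rest_def C_def by simp
  next
    case (Suc n)
    have "f (Q (w (Suc n))) \<le> f unif * f (Q (w n))" using pick[OF wV[of n]] unfolding wS good_def by auto
    also have "\<dots> \<le> f unif * (C * f unif ^ n)" using Suc unif by (intro mult_left_mono) auto
    finally show ?case by (simp add: mult_ac)
  qed
  \<comment> \<open>M transfers the decay of the remainders to the coefficients, with ratio sqrt (f
    unif) because Q is quadratic.\<close>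
  have coeff: "f a \<le> sqrt (M * C) * sqrt (f unif) ^ n" if "a \<in> K" "f a ^ 2 \<le> M * f (Q (w n))" for a n
  proof -
    have "f a ^ 2 \<le> M * (C * f unif ^ n)"
      using that(2) mult_left_mono[OF wb[of n] M] by linarith
    then have "f a \<le> sqrt (M * (C * f unif ^ n))" using real_le_rsqrt by blast
    then show ?thesis by (simp add: real_sqrt_mult real_sqrt_power)
  qed
  have q: "0 \<le> sqrt (f unif)" "sqrt (f unif) < 1" using unif by auto
  have p: "fst (pick (w n)) \<in> K" "snd (pick (w n)) \<in> K"
    "f (fst (pick (w n))) ^ 2 \<le> M * f (Q (w n))" "f (snd (pick (w n))) ^ 2 \<le> M * f (Q (w n))" for n
    using pick[OF wV[of n]] unfolding good_def by auto
  have step_fst: "f (fst (s (Suc n)) - fst (s n)) \<le> sqrt (M * C) * sqrt (f unif) ^ n" for n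
    using coeff[OF p(1,3)] unfolding sS w_def by simp
  have "\<exists>l\<in>K. \<forall>e>0. \<exists>N. \<forall>n\<ge>N. f (fst (s n) - l) < e"
    by (rule f_complete_geometric[of "\<lambda>n. fst (s n)", OF _ q step_fst]) (simp add: sK)
  then obtain a where a: "a \<in> K" "\<And>e. e > 0 \<Longrightarrow> \<exists>N. \<forall>n\<ge>N. f (fst (s n) - a) < e"
    by blast
  have step_snd: "f (snd (s (Suc n)) - snd (s n)) \<le> sqrt (M * C) * sqrt (f unif) ^ n" for n
    using coeff[OF p(2,4)] unfolding sS w_def by simp
  have "\<exists>l\<in>K. \<forall>e>0. \<exists>N. \<forall>n\<ge>N. f (snd (s n) - l) < e"
    by (rule f_complete_geometric[of "\<lambda>n. snd (s n)", OF _ q step_snd]) (simp add: sK)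
  then obtain b where b: "b \<in> K" "\<And>e. e > 0 \<Longrightarrow> \<exists>N. \<forall>n\<ge>N. f (snd (s n) - b) < e"
    by blast
  define z where "z = y - sc a x0 - sc b x1"
  have zV: "z \<in> V" unfolding z_def using x0 x1 y a b V_diff V_sc by auto
  have small: "\<exists>\<delta>>0. \<forall>c\<in>K. f c < \<delta> \<longrightarrow> f (Q (sc c x)) \<le> e" if "e > 0" "x \<in> V" for e x
  proof -
    have fx: "f (Q x) \<ge> 0" using f_nonneg[OF Q_K[OF that(2)]] .
    have "f (Q (sc c x)) \<le> e" if "c \<in> K" "f c < min 1 (e / (f (Q x) + 1))" for c
    proof -
      have c0: "0 \<le> f c" "f c < 1" "f c < e / (f (Q x) + 1)" using that f_nonneg[of c] by auto
      have "f c ^ 2 \<le> f c" using c0(1,2) by (simp add: power2_eq_square mult_left_le)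
      then have "f c ^ 2 * f (Q x) \<le> f c * (f (Q x) + 1)" using fx c0(1) by (intro mult_mono) auto
      also have "\<dots> \<le> e"
      proof -
        have "0 < f (Q x) + 1" using fx by simp
        then have "f c * (f (Q x) + 1) < e" using c0(3) by (simp only: pos_less_divide_eq)
        then show ?thesis by simp
      qed
      finally show ?thesis using that Q_K \<open>x \<in> V\<close> by (simp add: Q_sc f_mult f_power)
    qed
    moreover have "min 1 (e / (f (Q x) + 1)) > 0" using \<open>e > 0\<close> fx by simp
    ultimately show ?thesis by blast
  qed
  \<comment> \<open>The remainder z of the limit differs from \<open>w n\<close> by small multiples
    of x0 and x1, so all three pieces can be made smaller than z itself.\<close>
  have "Q z = 0"
  proof (rule ccontr)
    assume "Q z \<noteq> 0"
    then have e0: "f (Q z) / 2 > 0" using f_pos[of "Q z"] Q_K zV by simp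
    define e where "e = f (Q z) / 2"
    obtain d0 where d0: "d0 > 0" "\<And>c. c \<in> K \<Longrightarrow> f c < d0 \<Longrightarrow> f (Q (sc c x0)) \<le> e"
      using small[OF e0 x0] unfolding e_def by blast
    obtain d1 where d1: "d1 > 0" "\<And>c. c \<in> K \<Longrightarrow> f c < d1 \<Longrightarrow> f (Q (sc c x1)) \<le> e"
      using small[OF e0 x1] unfolding e_def by blast
    obtain N0 where N0: "\<And>n. n \<ge> N0 \<Longrightarrow> f (fst (s n) - a) < d0" using a(2)[OF d0(1)] by blast
    obtain N1 where N1: "\<And>n. n \<ge> N1 \<Longrightarrow> f (snd (s n) - b) < d1" using b(2)[OF d1(1)] by blast
    have "(\<lambda>n. C * f unif ^ n) \<longlonglongrightarrow> C * 0"
      using unif by (intro tendsto_mult tendsto_const LIMSEQ_power_zero) auto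
    then obtain N2 where N2: "\<And>n. n \<ge> N2 \<Longrightarrow> C * f unif ^ n < e"
      using order_tendstoD(2)[of "\<lambda>n. C * f unif ^ n" 0 sequentially e] e0 unfolding e_def
      by (auto simp: eventually_sequentially)
    define n where "n = max N0 (max N1 N2)"
    have "z = w n + sc (fst (s n) - a) x0 + sc (snd (s n) - b) x1"
      unfolding z_def w_def rest_def
      using sc_add[of "fst (s n) - a" a x0] sc_add[of "snd (s n) - b" b x1] by (simp add: algebra_simps)
    moreover have "f (Q (w n + sc (fst (s n) - a) x0 + sc (snd (s n) - b) x1)) \<le> e"
    proof (intro f_Q_add_le)
      show "f (Q (w n)) \<le> e" using wb[of n] N2[of n] unfolding n_def by linarith
      show "f (Q (sc (fst (s n) - a) x0)) \<le> e" using d0(2) N0[of n] sK a unfolding n_def by simp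
      show "f (Q (sc (snd (s n) - b) x1)) \<le> e" using d1(2) N1[of n] sK b unfolding n_def by simp
    qed (use wV sK a b x0 x1 V_sc V_add in auto)
    ultimately show False using e0 unfolding e_def by simp
  qed
  then have "z = 0" using zV Q_anisotropic by blast
  then show ?thesis unfolding z_def using a b by (metis diff_diff_eq eq_iff_diff_eq_0)
qed

text \<open>Divided by Q x, the form on the plane of x and y is integral, and the minimality of y
  says that its reduction modulo the maximal ideal has no zero. Such a plane has the unramified
  discriminant.\<close>

definition unramified_pair :: "'v \<Rightarrow> 'v \<Rightarrow> bool" where
  "unramified_pair x y \<longleftrightarrow> x \<in> V \<and> y \<in> V \<and> x \<noteq> 0 \<and> f (Q x) = f (Q y) \<and> (\<forall>c\<in>K. f (Q y) \<le> f (Q (y - sc c x)))"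

text \<open>Q(y - t*x)/Q x = t^2 - T*t + n is a unit for all integral t, which is the hypothesis of
  \<open>unramified_disc\<close>; the discriminant of the plane is (Q x)^2 times that of this
  polynomial.\<close>

lemma unramified_pair_disc:
  assumes "unramified_pair x y"
  shows "\<exists>s\<in>K. s \<noteq> 0 \<and> B x y ^ 2 - 4 * Q x * Q y = udisc * s^2"
proof -
  have x: "x \<in> V" "x \<noteq> 0" and y: "y \<in> V" and eq: "f (Q x) = f (Q y)"
    and min: "\<And>c. c \<in> K \<Longrightarrow> f (Q y) \<le> f (Q (y - sc c x))"
    using assms unfolding unramified_pair_def by auto
  have Qx: "Q x \<in> K" "Q x \<noteq> 0" "f (Q x) > 0" using x Q_K f_Q_pos Q_anisotropic by auto
  define T where "T = B x y / Q x"
  define n where "n = Q y / Q x"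
  have T: "T \<in> K" "f T \<le> 1"
  proof -
    show "T \<in> K" unfolding T_def using Qx B_K x y by auto
    have "f (B x y) \<le> f (Q x)" using f_B_le x y eq by simp
    then show "f T \<le> 1" unfolding T_def using Qx B_K x y by (simp add: f_divide)
  qed
  have n: "n \<in> K" "f n = 1" unfolding n_def using Qx Q_K y eq by (auto simp: f_divide)
  have "f (t^2 - T * t + n) = 1" if t: "t \<in> K" "f t \<le> 1" for t
  proof -
    have "Q (y - sc t x) = Q x * (t^2 - T * t + n)"
      unfolding T_def n_def using Qx t(1) by (simp add: Q_diff_sc field_simps)
    then have "f (Q (y - sc t x)) = f (Q x) * f (t^2 - T * t + n)" using Qx t T n by (simp add: f_mult)
    then have "1 \<le> f (t^2 - T * t + n)" using min[of t] t Qx eq by simp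
    moreover have "f (t^2 - T * t + n) \<le> 1"
      using t T n f_nonneg[of t] by (intro f_add_le f_diff_le f_mult_le_1) (auto simp: f_power power_le_one)
    ultimately show ?thesis by simp
  qed
  then obtain s where s: "s \<in> K" "s \<noteq> 0" "T^2 - 4 * n = udisc * s^2"
    using unramified_disc[of T n] T n by auto
  have "B x y ^ 2 - 4 * Q x * Q y = Q x ^ 2 * (T^2 - 4 * n)"
    unfolding T_def n_def using Qx by (simp add: field_simps power2_eq_square)
  then have "B x y ^ 2 - 4 * Q x * Q y = udisc * (Q x * s)^2"
    unfolding s by (simp add: power_mult_distrib)
  then show ?thesis using s Qx by (intro bexI[of _ "Q x * s"]) auto
qed

text \<open>Without unramified pairs, a vector y of the same parity as a nonzero x can be shortened
  by a multiple of x. Hence x0 and one vector x1 of the opposite parity shorten everything, and by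
  approximation they span.\<close>

lemma ramified_span:
  assumes none: "\<And>x y. \<not> unramified_pair x y" and x0: "x0 \<in> V" "x0 \<noteq> 0"
  shows "\<exists>x1\<in>V. (x1 = 0 \<or> (\<exists>e\<in>K. e \<noteq> 0 \<and> f (Q x1) = f unif * f e ^ 2 * f (Q x0))) \<and>
    (\<forall>y\<in>V. \<exists>a\<in>K. \<exists>b\<in>K. y = sc a x0 + sc b x1)"
proof -
  define even where "even = (\<lambda>y. \<exists>e\<in>K. f (Q y) = f e ^ 2 * f (Q x0))"
  have Q0: "Q x0 \<in> K" "Q x0 \<noteq> 0" "f (Q x0) > 0" using x0 Q_K f_Q_pos Q_anisotropic by auto
  have odd: "\<exists>e\<in>K. e \<noteq> 0 \<and> f (Q y) = f unif * f e ^ 2 * f (Q x0)" if y: "y \<in> V" "y \<noteq> 0" "\<not> even y" for y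
  proof -
    have "Q y / Q x0 \<in> K" "Q y / Q x0 \<noteq> 0" using y Q0 Q_K Q_anisotropic by auto
    then obtain e where e: "e \<in> K" "e \<noteq> 0" "f (Q y / Q x0) = f e ^ 2 \<or> f (Q y / Q x0) = f unif * f e ^ 2"
      using parity by blast
    have "f (Q y / Q x0) * f (Q x0) = f (Q y)" using Q0 Q_K y by (simp add: f_divide)
    then show ?thesis using e y(3) unfolding even_def by metis
  qed
  \<comment> \<open>If all vectors have the parity of x0, then x1 = 0 and x0 alone spans.\<close>
  define x1 where "x1 = (if \<exists>y\<in>V. y \<noteq> 0 \<and> \<not> even y then SOME y. y \<in> V \<and> y \<noteq> 0 \<and> \<not> even y else 0)"
  have x1: "x1 \<in> V" "(\<exists>y\<in>V. y \<noteq> 0 \<and> \<not> even y) \<Longrightarrow> x1 \<noteq> 0 \<and> \<not> even x1"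
    "\<not> (\<exists>y\<in>V. y \<noteq> 0 \<and> \<not> even y) \<Longrightarrow> x1 = 0"
  proof -
    have *: "x1 \<in> V \<and> x1 \<noteq> 0 \<and> \<not> even x1" if "\<exists>y\<in>V. y \<noteq> 0 \<and> \<not> even y"
      using someI_ex[of "\<lambda>y. y \<in> V \<and> y \<noteq> 0 \<and> \<not> even y"] that unfolding x1_def by auto
    show "(\<exists>y\<in>V. y \<noteq> 0 \<and> \<not> even y) \<Longrightarrow> x1 \<noteq> 0 \<and> \<not> even x1" using * by blast
    show "\<not> (\<exists>y\<in>V. y \<noteq> 0 \<and> \<not> even y) \<Longrightarrow> x1 = 0" unfolding x1_def by (simp only: if_False)
    then show "x1 \<in> V" using * V_sc[OF zero_K x0(1)] by (cases "\<exists>y\<in>V. y \<noteq> 0 \<and> \<not> even y") auto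
  qed
  define M where "M = inverse (f (Q x0)) + inverse (f (Q x1))"
  have fx1: "f (Q x1) \<ge> 0" using f_nonneg Q_K x1 by auto
  have M: "M \<ge> 0" "inverse (f (Q x0)) \<le> M" "inverse (f (Q x1)) \<le> M" unfolding M_def using Q0 fx1 by auto
  have single: "\<exists>a\<in>K. f a ^ 2 \<le> M * f (Q y) \<and> f (Q (y - sc a x)) \<le> f unif * f (Q y)"
    if x: "x \<in> V" "x \<noteq> 0" "inverse (f (Q x)) \<le> M" and y: "y \<in> V" and e: "e \<in> K" "e \<noteq> 0" "f (Q y) = f e ^ 2 * f (Q x)"
    for x y e
  proof -
    have xV: "sc e x \<in> V" using V_sc e x by blast
    have Qex: "f (Q (sc e x)) = f (Q y)" using e x Q_K by (simp add: Q_sc f_mult f_power)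
    have "sc e x \<noteq> 0"
    proof
      assume "sc e x = 0"
      then have "f (Q y) = 0" using Qex by simp
      then show False using e f_pos[of e] f_Q_pos[OF x(1,2)] by simp
    qed
    then obtain c where c: "c \<in> K" "f (Q (y - sc c (sc e x))) < f (Q y)"
      using none[of "sc e x" y] xV y Qex unfolding unramified_pair_def by (auto simp: not_le)
    have diff: "f (Q (y - sc (c * e) x)) < f (Q y)" using c by (simp add: sc_sc)
    have dV: "y - sc (c * e) x \<in> V" using V_diff V_sc c e x y by auto
    have le: "f (Q (y - sc (c * e) x)) \<le> f unif * f (Q y)"
      using diff f_less_unif dV y Q_K by blast
    \<comment> \<open>The removed multiple of x is a difference of two vectors no longer than y,
      which bounds its coefficient in terms of y.\<close>
    have "f (Q (y - (y - sc (c * e) x))) \<le> f (Q y)"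
      using f_Q_diff_le[OF y dV, of "f (Q y)"] diff by simp
    then have "f (c * e) ^ 2 * f (Q x) \<le> f (Q y)" using c e x Q_K by (simp add: Q_sc f_mult f_power)
    then have "f (c * e) ^ 2 \<le> inverse (f (Q x)) * f (Q y)"
      using f_Q_pos[OF x(1,2)] by (simp add: field_simps)
    also have "\<dots> \<le> M * f (Q y)" using x f_nonneg Q_K y by (intro mult_right_mono) auto
    finally show ?thesis using le c e by (intro bexI[of _ "c * e"]) auto
  qed
  have "\<exists>a\<in>K. \<exists>b\<in>K. f a ^ 2 \<le> M * f (Q y) \<and> f b ^ 2 \<le> M * f (Q y) \<and>
      f (Q (y - sc a x0 - sc b x1)) \<le> f unif * f (Q y)" if y: "y \<in> V" for y
  proof (cases "y = 0")
    case True
    then show ?thesis by (intro bexI[of _ 0]) auto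
  next
    case False
    have fy: "f (Q y) > 0" using f_Q_pos y False by blast
    have My: "0 \<le> M * f (Q y)" using M fy by simp
    show ?thesis
    proof (cases "even y")
      case True
      then obtain e where e: "e \<in> K" "f (Q y) = f e ^ 2 * f (Q x0)" unfolding even_def by blast
      then have "e \<noteq> 0" using fy by auto
      then obtain a where "a \<in> K" "f a ^ 2 \<le> M * f (Q y)" "f (Q (y - sc a x0)) \<le> f unif * f (Q y)"
        using single[of x0 y e] x0 M y e by blast
      then show ?thesis using My by (intro bexI[of _ a] bexI[of _ 0]) auto
    next
      case odd_y: False
      then have ex: "\<exists>y\<in>V. y \<noteq> 0 \<and> \<not> even y" using y False by blast
      note x1' = x1(2)[OF ex]
      obtain e where e: "e \<in> K" "e \<noteq> 0" "f (Q y) = f unif * f e ^ 2 * f (Q x0)" using odd[OF y False odd_y] by blast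
      obtain d where d: "d \<in> K" "d \<noteq> 0" "f (Q x1) = f unif * f d ^ 2 * f (Q x0)" using odd[of x1] x1 x1' by blast
      have eq: "f (Q y) = f (e / d) ^ 2 * f (Q x1)"
        unfolding e d using e(1) d(1,2) f_pos[of d] by (simp add: f_divide power_divide)
      have ed: "e / d \<in> K" "e / d \<noteq> 0" using e(1,2) d(1,2) by auto
      obtain b where "b \<in> K" "f b ^ 2 \<le> M * f (Q y)" "f (Q (y - sc b x1)) \<le> f unif * f (Q y)"
        using single[OF x1(1) conjunct1[OF x1'] M(3) y ed eq] by blast
      then show ?thesis using My by (intro bexI[of _ 0] bexI[of _ b]) auto
    qed
  qed
  then have "\<forall>y\<in>V. \<exists>a\<in>K. \<exists>b\<in>K. y = sc a x0 + sc b x1"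
    using span_by_approximation[OF x0(1) x1(1) M(1)] by blast
  moreover have "x1 = 0 \<or> (\<exists>e\<in>K. e \<noteq> 0 \<and> f (Q x1) = f unif * f e ^ 2 * f (Q x0))"
    using odd[of x1] x1 by (cases "\<exists>y\<in>V. y \<noteq> 0 \<and> \<not> even y") auto
  ultimately show ?thesis using x1(1) by blast
qed

end

section \<open>Bilinearity and nondegeneracy of the Hilbert symbol\<close>

context local_field
begin

text \<open>A quaternion division algebra contains the unramified quadratic extension.\<close>
lemma ternary_represents_udisc:
  assumes ab: "a \<in> K" "b \<in> K" "a \<noteq> 0" "b \<noteq> 0" and neg: "\<not> hil K a b"
  shows "\<exists>x\<in>K. \<exists>y\<in>K. \<exists>z\<in>K. udisc = a * x^2 + b * y^2 - a * b * z^2"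
proof -
  define V :: "('a \<times> 'a \<times> 'a) set" where "V = K \<times> K \<times> K"
  define sc :: "'a \<Rightarrow> 'a \<times> 'a \<times> 'a \<Rightarrow> 'a \<times> 'a \<times> 'a" where "sc = (\<lambda>c (x, y, z). (c * x, c * y, c * z))"
  \<comment> \<open>The square of the trace zero quaternion x*i + y*j + z*k, with i^2 = a, j^2 = b
    and k = i*j.\<close>
  define Q :: "'a \<times> 'a \<times> 'a \<Rightarrow> 'a" where "Q = (\<lambda>(x, y, z). a * x^2 + b * y^2 - a * b * z^2)"
  define B :: "'a \<times> 'a \<times> 'a \<Rightarrow> 'a \<times> 'a \<times> 'a \<Rightarrow> 'a" where
    "B = (\<lambda>(x, y, z) (x', y', z'). 2 * (a * x * x' + b * y * y' - a * b * z * z'))"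
  have aniso: "x = 0 \<and> y = 0 \<and> z = 0"
    if K: "x \<in> K" "y \<in> K" "z \<in> K" and eq: "a * x^2 + b * y^2 - a * b * z^2 = 0" for x y z
  proof (rule ccontr)
    assume nz: "\<not> ?thesis"
    have "b * (x / b)^2 + a * (y / a)^2 = z^2"
    proof -
      have "a * b * (b * (x / b)^2 + a * (y / a)^2) = a * x^2 + b * y^2"
        using ab by (simp add: field_simps power2_eq_square)
      then have "a * b * (b * (x / b)^2 + a * (y / a)^2) = a * b * z^2" using eq by simp
      then show ?thesis using ab by simp
    qed
    moreover have "(x / b, y / a, z) \<noteq> (0, 0, 0)" using nz ab by auto
    ultimately have "hil K b a" unfolding hil_def using K ab by blast
    then show False using neg hil_sym by blast
  qed
  interpret form: anisotropic_form K f V sc Q B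
  proof
    fix x :: "'a \<times> 'a \<times> 'a" assume "x \<in> V" "Q x = 0"
    then show "x = 0" using aniso unfolding V_def Q_def zero_prod_def by auto
  qed (use ab in \<open>auto simp: V_def sc_def Q_def B_def algebra_simps power2_eq_square\<close>)
  have "\<exists>X Y. form.unramified_pair X Y"
  proof (rule ccontr)
    assume "\<nexists>X Y. form.unramified_pair X Y"
    then have none: "\<And>X Y. \<not> form.unramified_pair X Y" by blast
    \<comment> \<open>Two vectors would span a space of dimension three.\<close>
    obtain X1 where span: "\<forall>Y\<in>V. \<exists>c\<in>K. \<exists>d\<in>K. Y = sc c (1, 0, 0) + sc d X1"
      using form.ramified_span[OF none, of "(1, 0, 0)"] unfolding V_def zero_prod_def by auto
    obtain p q r where X1: "X1 = (p, q, r)" by (cases X1) auto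
    obtain c d where 1: "(0, 1, 0) = sc c (1, 0, 0) + sc d X1"
      using span[THEN bspec, of "(0, 1, 0)"] unfolding V_def by auto
    obtain c' d' where 2: "(0, 0, 1) = sc c' (1, 0, 0) + sc d' X1"
      using span[THEN bspec, of "(0, 0, 1)"] unfolding V_def by auto
    have "d * q = 1" "d * r = 0" "d' * r = 1" using 1 2 unfolding X1 sc_def by auto
    then show False by auto
  qed
  then obtain X Y where XY: "form.unramified_pair X Y" by blast
  obtain s where s: "s \<in> K" "s \<noteq> 0" "B X Y ^ 2 - 4 * Q X * Q Y = udisc * s^2"
    using form.unramified_pair_disc[OF XY] by blast
  obtain x1 x2 x3 where X: "X = (x1, x2, x3)" by (cases X) auto
  obtain y1 y2 y3 where Y: "Y = (y1, y2, y3)" by (cases Y) auto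
  have K: "x1 \<in> K" "x2 \<in> K" "x3 \<in> K" "y1 \<in> K" "y2 \<in> K" "y3 \<in> K"
    using XY unfolding form.unramified_pair_def X Y by (auto simp: V_def)
  \<comment> \<open>Up to signs the coordinates of half the commutator of X and Y as quaternions.
    The commutator has trace zero, and its square is (X*Y + Y*X)^2 - 4*X^2*Y^2, the discriminant of
    the plane.\<close>
  define z1 z2 z3 where "z1 = b * (x2 * y3 - x3 * y2)" and "z2 = a * (x3 * y1 - x1 * y3)"
    and "z3 = x1 * y2 - x2 * y1"
  have "B X Y ^ 2 - 4 * Q X * Q Y = 4 * (a * z1^2 + b * z2^2 - a * b * z3^2)"
    unfolding X Y B_def Q_def z1_def z2_def z3_def by (simp add: algebra_simps power2_eq_square)
  then have "udisc * s^2 = 4 * (a * z1^2 + b * z2^2 - a * b * z3^2)" using s by simp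
  then have "udisc = 4 * (a * z1^2 + b * z2^2 - a * b * z3^2) / s^2" using s by (simp add: field_simps)
  also have "\<dots> = a * (2 * z1 / s)^2 + b * (2 * z2 / s)^2 - a * b * (2 * z3 / s)^2"
    using s by (simp add: field_simps power2_eq_square)
  finally have "udisc = a * (2 * z1 / s)^2 + b * (2 * z2 / s)^2 - a * b * (2 * z3 / s)^2" .
  moreover have "2 * z1 / s \<in> K" "2 * z2 / s \<in> K" "2 * z3 / s \<in> K"
    unfolding z1_def z2_def z3_def using K ab s by auto
  ultimately show ?thesis by blast
qed

text \<open>Elements of even valuation are norms from the unramified extension, so two non-norms
  have odd valuation and their product is even.\<close>

lemma hil_udisc_odd_mult:
  assumes "b \<in> K" "c \<in> K" "b \<noteq> 0" "c \<noteq> 0" "\<not> hil K udisc b" "\<not> hil K udisc c"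
  shows "hil K udisc (b * c)"
proof -
  obtain d where d: "d \<in> K" "f b = f d ^ 2 \<or> f b = f unif * f d ^ 2" using parity[of b] assms by blast
  obtain e where e: "e \<in> K" "f c = f e ^ 2 \<or> f c = f unif * f e ^ 2" using parity[of c] assms by blast
  have "f b = f unif * f d ^ 2" "f c = f unif * f e ^ 2"
    using d e assms even_hil_udisc by blast+
  then have "f (b * c) = f (unif * d * e) ^ 2"
    using assms d e unif by (simp add: f_mult power2_eq_square)
  then show ?thesis using even_hil_udisc[of "b * c" "unif * d * e"] assms d e unif by simp
qed

lemma not_hil_udisc_unif:
  assumes "c \<in> K" "e \<in> K" "e \<noteq> 0" "f c = f unif * f e ^ 2" shows "\<not> hil K udisc c"
  using hil_udisc_even[of c] unif_odd[of e] assms by metis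

text \<open>The form <a, e> represents u, hence is isometric to <u, u*a*e>; the isometry is (p, q)
  -> (x*p - e*q, p + a*x*q). Because (u, -u) = 1, the hypothesis says that the second form
  represents a square.\<close>

lemma hil_trade:
  assumes K: "a \<in> K" "e \<in> K" "u \<in> K" "x \<in> K" and nz: "a \<noteq> 0" "e \<noteq> 0" "u \<noteq> 0"
    and u: "u = a * x^2 + e" and h: "hil K u (- (a * e))"
  shows "hil K a e"
proof -
  have "hil K u (- u * - (a * e))" using hil_cancel[of u "- u" "- (a * e)"] K nz h hil_uminus[of u] by simp
  then have "hil K u (u * a * e)" by (simp add: mult_ac)
  then obtain p q r where pqr: "p \<in> K" "q \<in> K" "r \<in> K" "(p, q, r) \<noteq> (0, 0, 0)"
    "u * p^2 + u * a * e * q^2 = r^2" unfolding hil_def by blast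
  have eq: "a * (x * p - e * q)^2 + e * (p + a * x * q)^2 = r^2"
    using pqr(5) unfolding u by (simp add: algebra_simps power2_eq_square)
  have "(x * p - e * q, p + a * x * q, r) \<noteq> (0, 0, 0)"
  proof
    assume "(x * p - e * q, p + a * x * q, r) = (0, 0, 0)"
    then have 1: "x * p = e * q" "p = - (a * x * q)" "r = 0" by (auto simp: add_eq_0_iff2)
    have "(a * x^2 + e) * q = e * q - x * (- (a * x * q))" by (simp add: algebra_simps power2_eq_square)
    then have "(a * x^2 + e) * q = 0" using 1(1) unfolding 1(2)[symmetric] by simp
    then have "q = 0" using u nz by simp
    then show False using 1 pqr by simp
  qed
  then show ?thesis unfolding hil_def using eq pqr K by blast
qed

text \<open>Norms from K(sqrt a) have index at most two. For \<open>udisc\<close> this is known from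
  valuations, and \<open>udisc\<close> is represented by the trace zero forms of both (a, b) and (a,
  c). Writing it as a*x^2 + e with b*e a norm, and as a*y^2 + d with c*d a norm, replaces b and c by
  e and d, which can be compared through symbols with \<open>udisc\<close> and
  \<open>udisc\<close>*a.\<close>

lemma hil_neg_mult:
  assumes K: "a \<in> K" "b \<in> K" "c \<in> K" and nz: "a \<noteq> 0" "b \<noteq> 0" "c \<noteq> 0"
    and neg: "\<not> hil K a b" "\<not> hil K a c"
  shows "hil K a (b * c)"
proof -
  define good where "good = (\<lambda>b x e. x \<in> K \<and> e \<in> K \<and> udisc = a * x^2 + e \<and> e \<noteq> 0 \<and> hil K a (b * e))"
  have split: "(\<exists>s\<in>K. s \<noteq> 0 \<and> udisc = a * s^2) \<or> (\<exists>x e. good b x e)"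
    if b: "b \<in> K" "b \<noteq> 0" "\<not> hil K a b" for b
  proof -
    obtain x y z where xyz: "x \<in> K" "y \<in> K" "z \<in> K" "udisc = a * x^2 + b * y^2 - a * b * z^2"
      using ternary_represents_udisc[of a b] K nz b by blast
    define e where "e = b * (y^2 - a * z^2)"
    have e: "udisc = a * x^2 + e" "e \<in> K" unfolding e_def using xyz K b by (auto simp: algebra_simps)
    show ?thesis
    proof (cases "e = 0")
      case True
      then have "udisc = a * x^2" using e by simp
      then show ?thesis using xyz udisc_nonzero by (intro disjI1 bexI[of _ x]) auto
    next
      case False
      have "hil K a (y^2 - a * z^2)" using hil_norm K nz xyz by simp
      then have "hil K a ((y^2 - a * z^2) * b^2)"
        using hil_mult_square[of a "y^2 - a * z^2" b] K xyz b nz by simp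
      then have "hil K a (b * e)" unfolding e_def by (simp add: power2_eq_square mult_ac)
      then show ?thesis using e xyz False unfolding good_def by blast
    qed
  qed
  show ?thesis
  proof (cases "\<exists>s\<in>K. s \<noteq> 0 \<and> udisc = a * s^2")
    case True
    then obtain s where s: "s \<in> K" "s \<noteq> 0" "udisc = a * s^2" by blast
    have "hil K udisc d \<longleftrightarrow> hil K a d" if "d \<in> K" "d \<noteq> 0" for d
      unfolding s hil_sym[of _ d] using hil_mult_square[of d a s] K s that by simp
    then show ?thesis using hil_udisc_odd_mult[of b c] K nz neg by simp
  next
    case False
    then obtain x e where be: "good b x e" using split[of b] K nz neg by blast
    obtain y d where cd: "good c y d" using split[of c] False K nz neg by blast
    \<comment> \<open>If (\<open>udisc\<close>, -a*e) were 1, \<open>hil_trade\<close> would give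
      (a, e) = 1 and thus (a, b) = 1. The second symbol is the norm equation \<open>udisc\<close>*e
      = \<open>udisc\<close>^2 - (\<open>udisc\<close>*a)*x^2.\<close>
    have odd: "\<not> hil K udisc (- (a * e)) \<and> hil K (udisc * a) (udisc * e)"
      if b: "b \<in> K" "b \<noteq> 0" "\<not> hil K a b" and g: "good b x e" for b x e
    proof
      have g': "x \<in> K" "e \<in> K" "udisc = a * x^2 + e" "e \<noteq> 0" "hil K a (b * e)" using g unfolding good_def by auto
      have "\<not> hil K a e" using hil_cancel[of a e b] g' b K nz by (auto simp: mult.commute)
      then show "\<not> hil K udisc (- (a * e))" using hil_trade[of a e udisc x] g'(1,2,4) g'(3) K(1) nz(1) udisc_K udisc_nonzero by metis
      have "udisc * e = udisc * (udisc - a * x^2)" using g' by simp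
      also have "\<dots> = udisc^2 - (udisc * a) * x^2" by (simp add: algebra_simps power2_eq_square)
      finally show "hil K (udisc * a) (udisc * e)" using hil_norm[of "udisc * a" udisc x] g'(1) K nz by simp
    qed
    have be': "e \<in> K" "e \<noteq> 0" "hil K a (b * e)" and cd': "d \<in> K" "d \<noteq> 0" "hil K a (c * d)"
      using be cd unfolding good_def by auto
    note ob = odd[OF K(2) nz(2) neg(1) be] and oc = odd[OF K(3) nz(3) neg(2) cd]
    have "hil K udisc (- (a * e) * - (a * d))" using hil_udisc_odd_mult[of "- (a * e)" "- (a * d)"] ob oc K nz be' cd' by simp
    then have "hil K udisc (e * d * a^2)" by (simp add: power2_eq_square mult_ac)
    then have 1: "hil K udisc (e * d)" using hil_mult_square[of udisc "e * d" a] K nz be' cd' by simp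
    have "hil K (udisc * a) (udisc * e * (udisc * d))"
      using hil_mult[of "udisc * a" "udisc * e" "udisc * d"] ob oc K nz be' cd' by simp
    then have "hil K (udisc * a) (e * d * udisc^2)" by (simp add: power2_eq_square mult_ac)
    then have 2: "hil K (udisc * a) (e * d)"
      using hil_mult_square[of "udisc * a" "e * d" udisc] K nz be' cd' by simp
    have "hil K (e * d) a" using hil_cancel[of "e * d" udisc a] 1 2 hil_sym K nz be' cd' by auto
    then have 3: "hil K a (e * d)" using hil_sym by blast
    have "hil K a (b * e * (c * d))" using hil_mult[of a "b * e" "c * d"] K nz be' cd' by simp
    then have "hil K a (e * d * (b * c))" by (simp add: mult_ac)
    then show ?thesis using hil_cancel[of a "e * d" "b * c"] 3 K nz be' cd' by simp
  qed
qed

text \<open>The dichotomy for anisotropic forms is applied to x^2 - d*y^2. An unramified pair makes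
  d equal to \<open>udisc\<close> up to squares, and a uniformizer is not a norm. Otherwise the form
  represents an n of odd valuation, from which the witness m is built.\<close>

lemma hil_nondegenerate:
  assumes d: "d \<in> K" "\<And>s. s \<in> K \<Longrightarrow> d \<noteq> s^2"
  shows "\<exists>e\<in>K. e \<noteq> 0 \<and> \<not> hil K d e"
proof -
  have d0: "d \<noteq> 0" using d(2)[of 0] by auto
  define V :: "('a \<times> 'a) set" where "V = K \<times> K"
  define sc :: "'a \<Rightarrow> 'a \<times> 'a \<Rightarrow> 'a \<times> 'a" where "sc = (\<lambda>c (x, y). (c * x, c * y))"
  define Q :: "'a \<times> 'a \<Rightarrow> 'a" where "Q = (\<lambda>(x, y). x^2 - d * y^2)"
  define B :: "'a \<times> 'a \<Rightarrow> 'a \<times> 'a \<Rightarrow> 'a" where "B = (\<lambda>(x, y) (x', y'). 2 * (x * x' - d * y * y'))"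
  have aniso: "x = 0 \<and> y = 0" if K: "x \<in> K" "y \<in> K" and eq: "x^2 - d * y^2 = 0" for x y
  proof (cases "y = 0")
    case False
    then have "d = (x / y)^2" using eq by (simp add: field_simps)
    then show ?thesis using d(2)[of "x / y"] K by auto
  qed (use eq in auto)
  interpret form: anisotropic_form K f V sc Q B
  proof
    fix x :: "'a \<times> 'a" assume "x \<in> V" "Q x = 0"
    then show "x = 0" using aniso unfolding V_def Q_def zero_prod_def by auto
  qed (use d(1) in \<open>auto simp: V_def sc_def Q_def B_def algebra_simps power2_eq_square\<close>)
  show ?thesis
  proof (cases "\<exists>X Y. form.unramified_pair X Y")
    case True
    then obtain X Y where XY: "form.unramified_pair X Y" by blast
    obtain s where s: "s \<in> K" "s \<noteq> 0" "B X Y ^ 2 - 4 * Q X * Q Y = udisc * s^2"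
      using form.unramified_pair_disc[OF XY] by blast
    obtain x1 x2 where X: "X = (x1, x2)" by (cases X) auto
    obtain y1 y2 where Y: "Y = (y1, y2)" by (cases Y) auto
    have K: "x1 \<in> K" "x2 \<in> K" "y1 \<in> K" "y2 \<in> K"
      using XY unfolding form.unramified_pair_def X Y by (auto simp: V_def)
    define w where "w = 2 * (x1 * y2 - x2 * y1)"
    have w: "w \<in> K" unfolding w_def using K by auto
    have "B X Y ^ 2 - 4 * Q X * Q Y = d * w^2"
      unfolding X Y B_def Q_def w_def by (simp add: algebra_simps power2_eq_square)
    then have eq: "d * w^2 = udisc * s^2" using s by simp
    then have w0: "w \<noteq> 0" using s by auto
    have "\<not> hil K d unif"
    proof
      assume "hil K d unif"
      then have "hil K unif (udisc * s^2)"
        using hil_mult_square[of unif d w] unif unif_nonzero d w w0 hil_sym eq by auto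
      then have "hil K udisc unif"
        using hil_mult_square[of unif udisc s] unif unif_nonzero s hil_sym by auto
      then show False using not_hil_udisc_unif[of unif 1] unif by simp
    qed
    then show ?thesis using unif unif_nonzero by blast
  next
    case False
    then have none: "\<And>X Y. \<not> form.unramified_pair X Y" by blast
    have one: "(1, 0) \<in> V" "Q (1, 0) = 1" unfolding V_def Q_def by auto
    obtain X1 where X1: "X1 \<in> V" "X1 = 0 \<or> (\<exists>e\<in>K. e \<noteq> 0 \<and> f (Q X1) = f unif * f e ^ 2)"
      "\<forall>Y\<in>V. \<exists>a\<in>K. \<exists>b\<in>K. Y = sc a (1, 0) + sc b X1"
      using form.ramified_span[OF none, of "(1, 0)"] one unfolding zero_prod_def by auto
    have "X1 \<noteq> 0"
    proof
      assume "X1 = 0"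
      moreover obtain a b where "(0, 1) = sc a (1, 0) + sc b X1"
        using X1(3)[THEN bspec, of "(0, 1)"] unfolding V_def by auto
      ultimately show False unfolding sc_def zero_prod_def by auto
    qed
    then obtain e where e: "e \<in> K" "e \<noteq> 0" "f (Q X1) = f unif * f e ^ 2" using X1 by blast
    obtain x' y' where X1': "X1 = (x', y')" by (cases X1) auto
    define x where "x = x' / e"
    define y where "y = y' / e"
    have K: "x \<in> K" "y \<in> K" using X1(1) e unfolding X1' V_def x_def y_def by auto
    define n where "n = x^2 - d * y^2"
    have nK: "n \<in> K" unfolding n_def using K d by auto
    have "Q X1 = n * e^2" unfolding X1' Q_def n_def x_def y_def using e by (simp add: field_simps)
    then have fn: "f n = f unif" using e nK f_pos[of e] by (simp add: f_mult f_power)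
    define T where "T = 2 * x"
    have TK: "T \<in> K" unfolding T_def using K by auto
    \<comment> \<open>Cauchy-Schwarz bounds the trace T of x + y*sqrt d by f T ^ 2 \<le> f unif; as
      \<open>f unif\<close> is no square of a value, the inequality is strict.\<close>
    have "f (B (1, 0) (x, y)) ^ 2 \<le> f (Q (1, 0)) * f (Q (x, y))"
      using K one by (intro form.f_B_bound) (auto simp: V_def)
    then have fT: "f T ^ 2 \<le> f unif" unfolding B_def Q_def T_def using fn n_def by simp
    then have "f T ^ 2 < 1" using unif by simp
    then have "f T < 1" using f_nonneg[OF TK] by (simp add: power_less_one_iff)
    then have "f T \<le> f unif" using unif(4) TK by blast
    then have "f T ^ 2 \<le> f unif ^ 2" using f_nonneg[OF TK] by (intro power_mono) auto
    also have "\<dots> < f unif" using unif by (simp add: power2_eq_square)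
    finally have "f T ^ 2 < f unif" .
    then have small: "f (- (rho * T^2)) < f (n * udisc)"
      using rho f_rho TK nK fn f_udisc by (simp add: f_mult f_power)
    \<comment> \<open>Multiplying T^2 - 4*n = d*(2*y)^2 by \<open>udisc\<close> = 1 +
      4*\<open>rho\<close> gives T^2 = \<open>udisc\<close>*d*(2*y)^2 + 4*m, so
      (\<open>udisc\<close>*d, m) = 1. Since m keeps the odd valuation of n, (\<open>udisc\<close>,
      m) = -1.\<close>
    define m where "m = n * udisc - rho * T^2"
    have mK: "m \<in> K" unfolding m_def using nK rho TK by auto
    have fm: "f m = f unif"
      using f_add_eq[OF _ _ small] rho TK nK fn f_udisc unfolding m_def by (simp add: f_mult)
    have m0: "m \<noteq> 0" using fm unif by auto
    have "(udisc * d) * (2 * y)^2 + m * 2^2 = T^2"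
      unfolding m_def n_def T_def udisc_def by (simp add: algebra_simps power2_eq_square)
    then have "hil K (udisc * d) m"
      unfolding hil_def using K TK by (intro bexI[of _ "2 * y"] bexI[of _ 2] bexI[of _ T]) auto
    moreover have "\<not> hil K udisc m" using not_hil_udisc_unif[of m 1] mK fm by simp
    ultimately have "\<not> hil K d m"
      using hil_cancel[of m d udisc] mK m0 d d0 hil_sym by (auto simp: mult.commute)
    then show ?thesis using mK m0 by blast
  qed
qed

definition hs :: "'a \<Rightarrow> 'a \<Rightarrow> int" where "hs a b = (if hil K a b then 1 else - 1)"

lemma hs_mult:
  assumes "a \<in> K" "b \<in> K" "c \<in> K" "a \<noteq> 0" "b \<noteq> 0" "c \<noteq> 0"
  shows "hs a (b * c) = hs a b * hs a c"
  using hil_neg_mult[OF assms] hil_cancel[of a b c] hil_cancel[of a c b] assms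
  unfolding hs_def by (auto simp: mult.commute)

lemma hs_sym: "hs a b = hs b a" unfolding hs_def using hil_sym by auto

lemma hs_mult_left:
  assumes "a \<in> K" "b \<in> K" "c \<in> K" "a \<noteq> 0" "b \<noteq> 0" "c \<noteq> 0"
  shows "hs (b * c) a = hs b a * hs c a"
  using hs_mult[OF assms] hs_sym by metis

lemma hs_self_mult [simp]: "hs a b * hs a b = 1" "hs a b * (hs a b * c) = c"
  unfolding hs_def by auto

end

section \<open>Quadratic extensions\<close>

lemma hil_mono: "hil K a b \<Longrightarrow> K \<subseteq> L \<Longrightarrow> hil L a b"
  unfolding hil_def by blast

locale quadratic_extension = local_field F f
  for F :: "'a::field_char_0 set" and f :: "'a \<Rightarrow> real" +
  fixes \<delta> :: 'a
  assumes \<delta>_square: "\<delta>^2 \<in> F" and \<delta>_notin: "\<delta> \<notin> F"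
    and spanned: "\<And>x. \<exists>a\<in>F. \<exists>b\<in>F. x = a + b * \<delta>"

lemma quadratic_ext_imp:
  assumes "local_field F f" "quadratic_ext F"
  shows "\<exists>\<delta>. quadratic_extension F f \<delta>"
proof -
  interpret local_field F f by fact
  obtain \<theta> where \<theta>: "\<theta> \<notin> F" "\<And>x. \<exists>a\<in>F. \<exists>b\<in>F. x = a + b * \<theta>"
    using assms(2) unfolding quadratic_ext_def by auto
  obtain p q where pq: "p \<in> F" "q \<in> F" "\<theta>^2 = p + q * \<theta>" using \<theta>(2) by blast
  have "quadratic_extension F f (\<theta> - q / 2)"
  proof
    have "(\<theta> - q / 2)^2 = \<theta>^2 - q * \<theta> + q^2 / 4" by (simp add: algebra_simps power2_eq_square)
    also have "\<dots> = p + q^2 / 4" unfolding pq by simp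
    finally show "(\<theta> - q / 2)^2 \<in> F" using pq by simp
    show "\<theta> - q / 2 \<notin> F"
    proof
      assume "\<theta> - q / 2 \<in> F"
      then have "(\<theta> - q / 2) + q / 2 \<in> F" using pq by blast
      then show False using \<theta> by simp
    qed
    fix x
    obtain a b where ab: "a \<in> F" "b \<in> F" "x = a + b * \<theta>" using \<theta>(2) by blast
    have "x = (a + b * q / 2) + b * (\<theta> - q / 2)" unfolding ab by (simp add: algebra_simps)
    then show "\<exists>a\<in>F. \<exists>b\<in>F. x = a + b * (\<theta> - q / 2)" using ab pq by blast
  qed
  then show ?thesis by blast
qed

context quadratic_extension
begin

definition d0 :: 'a where "d0 = \<delta>^2"

lemma d0_F [simp, intro]: "d0 \<in> F" unfolding d0_def by (rule \<delta>_square)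

lemma \<delta>_nonzero [simp]: "\<delta> \<noteq> 0" using \<delta>_notin by auto

lemma d0_nonzero [simp]: "d0 \<noteq> 0" unfolding d0_def by simp

lemma d0_nonsquare: "s \<in> F \<Longrightarrow> d0 \<noteq> s^2"
  unfolding d0_def using \<delta>_notin by (auto simp: power2_eq_iff)

lemma coord_unique:
  assumes "a \<in> F" "b \<in> F" "a' \<in> F" "b' \<in> F" "a + b * \<delta> = a' + b' * \<delta>"
  shows "a = a' \<and> b = b'"
proof (cases "b = b'")
  case False
  have "\<delta> = (a' - a) / (b - b')" using assms(5) False by (simp add: field_simps)
  then show ?thesis using assms \<delta>_notin by auto
qed (use assms in auto)

definition cj :: "'a \<Rightarrow> 'a" where
  "cj x = (THE y. \<exists>a\<in>F. \<exists>b\<in>F. x = a + b * \<delta> \<and> y = a - b * \<delta>)"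

lemma cj_eq: assumes "a \<in> F" "b \<in> F" shows "cj (a + b * \<delta>) = a - b * \<delta>"
  unfolding cj_def
proof (rule the_equality)
  fix y assume "\<exists>a'\<in>F. \<exists>b'\<in>F. a + b * \<delta> = a' + b' * \<delta> \<and> y = a' - b' * \<delta>"
  then show "y = a - b * \<delta>" using coord_unique assms by metis
qed (use assms in auto)

lemma cj_F [simp]: "x \<in> F \<Longrightarrow> cj x = x"
  using cj_eq[of x 0] by simp

lemma cj_\<delta> [simp]: "cj \<delta> = - \<delta>" using cj_eq[of 0 1] by simp

lemma cj_add: "cj (x + y) = cj x + cj y"
proof -
  obtain a b a' b' where 1: "a \<in> F" "b \<in> F" "x = a + b * \<delta>" "a' \<in> F" "b' \<in> F" "y = a' + b' * \<delta>"
    using spanned by metis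
  have "x + y = (a + a') + (b + b') * \<delta>" unfolding 1 by (simp add: algebra_simps)
  then have "cj (x + y) = cj ((a + a') + (b + b') * \<delta>)" by (simp only:)
  also have "\<dots> = (a + a') - (b + b') * \<delta>" using 1 by (intro cj_eq) auto
  also have "\<dots> = (a - b * \<delta>) + (a' - b' * \<delta>)" by (simp add: algebra_simps)
  also have "\<dots> = cj x + cj y" using cj_eq 1 by simp
  finally show ?thesis .
qed

lemma cj_mult: "cj (x * y) = cj x * cj y"
proof -
  obtain a b a' b' where 1: "a \<in> F" "b \<in> F" "x = a + b * \<delta>" "a' \<in> F" "b' \<in> F" "y = a' + b' * \<delta>"
    using spanned by metis
  have "x * y = (a * a' + b * b' * d0) + (a * b' + b * a') * \<delta>"
    unfolding 1 d0_def by (simp add: algebra_simps power2_eq_square)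
  then have "cj (x * y) = cj ((a * a' + b * b' * d0) + (a * b' + b * a') * \<delta>)" by (simp only:)
  also have "\<dots> = (a * a' + b * b' * d0) - (a * b' + b * a') * \<delta>" using 1 by (intro cj_eq) auto
  also have "\<dots> = (a - b * \<delta>) * (a' - b' * \<delta>)" by (simp add: algebra_simps d0_def power2_eq_square)
  also have "\<dots> = cj x * cj y" using cj_eq 1 by simp
  finally show ?thesis .
qed

lemma cj_cj [simp]: "cj (cj x) = x"
proof -
  obtain a b where 1: "a \<in> F" "b \<in> F" "x = a + b * \<delta>" using spanned by metis
  have "cj (a - b * \<delta>) = a + b * \<delta>" using cj_eq[of a "- b"] 1 by simp
  then show ?thesis unfolding 1 using cj_eq 1 by simp
qed

lemma cj_uminus: "cj (- x) = - cj x" using cj_mult[of "- 1" x] by simp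

lemma cj_diff: "cj (x - y) = cj x - cj y" using cj_add[of x "- y"] cj_uminus by simp

lemma cj_0 [simp]: "cj 0 = 0" and cj_1 [simp]: "cj 1 = 1" by simp_all

lemma cj_eq_0 [simp]: "cj x = 0 \<longleftrightarrow> x = 0" by (metis cj_0 cj_cj)

lemma cj_inverse: "cj (inverse x) = inverse (cj x)"
proof (cases "x = 0")
  case False
  then have "cj x * cj (inverse x) = 1" by (simp flip: cj_mult)
  then show ?thesis by (metis inverse_unique)
qed simp

lemma cj_divide: "cj (x / y) = cj x / cj y"
  by (simp add: divide_inverse cj_mult cj_inverse)

lemma cj_fixed: assumes "cj x = x" shows "x \<in> F"
proof -
  obtain a b where 1: "a \<in> F" "b \<in> F" "x = a + b * \<delta>" using spanned by metis
  have "b * \<delta> = 0" using assms unfolding 1 using cj_eq[of a b] 1 by (simp add: eq_neg_iff_add_eq_0 flip: mult_2)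
  then show ?thesis using 1 by auto
qed

section \<open>The norm of the quadratic extension\<close>

definition nm :: "'a \<Rightarrow> 'a" where "nm x = x * cj x"

lemma nm_F [simp, intro]: "nm x \<in> F"
  by (rule cj_fixed) (simp add: nm_def cj_mult mult.commute)

lemma trace_F [simp, intro]: "x + cj x \<in> F"
  by (rule cj_fixed) (simp add: cj_add add.commute)

lemma nm_mult: "nm (x * y) = nm x * nm y" unfolding nm_def by (simp add: cj_mult mult_ac)

lemma nm_eq_0 [simp]: "nm x = 0 \<longleftrightarrow> x = 0" unfolding nm_def by simp

lemma nm_cj [simp]: "nm (cj x) = nm x" unfolding nm_def by (simp add: mult.commute)

lemma nm_of_F: "x \<in> F \<Longrightarrow> nm x = x^2" unfolding nm_def by (simp add: power2_eq_square)

lemma nm_1 [simp]: "nm 1 = 1" unfolding nm_def by simp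

lemma nm_\<delta>: "nm \<delta> = - d0" unfolding nm_def d0_def by (simp add: power2_eq_square)

lemma nm_coord: "a \<in> F \<Longrightarrow> b \<in> F \<Longrightarrow> nm (a + b * \<delta>) = a^2 - d0 * b^2"
  unfolding nm_def d0_def cj_eq by (simp add: algebra_simps power2_eq_square)

lemma hil_d0_iff: assumes "e \<in> F" shows "hil F d0 e \<longleftrightarrow> (\<exists>z. e = nm z)"
proof
  assume "hil F d0 e"
  then obtain x y where "x \<in> F" "y \<in> F" "e = x^2 - d0 * y^2" using hil_iff_norm assms by auto
  then show "\<exists>z. e = nm z" using nm_coord by metis
next
  assume "\<exists>z. e = nm z"
  then obtain z where z: "e = nm z" by blast
  obtain a b where "a \<in> F" "b \<in> F" "z = a + b * \<delta>" using spanned by metis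
  then show "hil F d0 e" unfolding z using nm_coord hil_norm by simp
qed

text \<open>E as an anisotropic plane over F. The gain is the Cauchy-Schwarz bound, which yields the
  ultrametric inequality for the extended absolute value.\<close>

sublocale norm_form: anisotropic_form F f "UNIV :: 'a set" "(*)" nm "\<lambda>x y. x * cj y + y * cj x"
proof
  fix x y :: 'a
  show "x * cj y + y * cj x \<in> F" by (rule cj_fixed) (simp add: cj_add cj_mult mult.commute)
  fix a b
  show "nm (a * x + b * y) = a\<^sup>2 * nm x + a * b * (x * cj y + y * cj x) + b\<^sup>2 * nm y"
    if "a \<in> F" "b \<in> F"
    using that unfolding nm_def by (simp add: cj_add cj_mult algebra_simps power2_eq_square)
qed (auto simp: algebra_simps)


section \<open>The extended absolute value makes E a local field\<close>

definition fE :: "'a \<Rightarrow> real" where "fE x = sqrt (f (nm x))"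

definition re :: "'a \<Rightarrow> 'a" where "re x = (x + cj x) / 2"
definition im :: "'a \<Rightarrow> 'a" where "im x = (x - cj x) / (2 * \<delta>)"

lemma re_F [simp]: "re x \<in> F" unfolding re_def by (intro divide_K trace_F) simp

lemma im_F [simp]: "im x \<in> F"
  by (rule cj_fixed) (simp add: im_def cj_divide cj_diff cj_mult divide_simps)

lemma re_im: "x = re x + im x * \<delta>" unfolding re_def im_def by (simp add: field_simps)

lemma re_diff: "re (x - y) = re x - re y" unfolding re_def by (simp add: cj_diff diff_divide_distrib add_divide_distrib)
lemma im_diff: "im (x - y) = im x - im y" unfolding im_def by (simp add: cj_diff diff_divide_distrib)

lemma fE_F: "x \<in> F \<Longrightarrow> fE x = f x"
  unfolding fE_def using f_nonneg by (simp add: nm_of_F f_power)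

lemma fE_nonneg: "fE x \<ge> 0" unfolding fE_def using f_nonneg by simp

lemma fE_mult: "fE (x * y) = fE x * fE y"
  unfolding fE_def by (simp add: nm_mult f_mult real_sqrt_mult)

lemma fE_eq_0: "fE x = 0 \<longleftrightarrow> x = 0" unfolding fE_def using f_eq_0 by simp

lemma fE_add: "fE (x + y) \<le> max (fE x) (fE y)"
  using norm_form.f_Q_add_le[of x y "max (f (nm x)) (f (nm y))"] unfolding fE_def
  by (auto simp: max_def split: if_splits)

text \<open>Cauchy-Schwarz for the norm form against 1, and in the next lemma against \<delta>.
  Coordinates are thus controlled by the absolute value, and Cauchy sequences in E have Cauchy
  coordinates.\<close>

lemma fE_re: "f 2 * f (re x) \<le> fE x"
proof -
  have "f (1 * cj x + x * cj 1) ^ 2 \<le> f (nm 1) * f (nm x)" by (rule norm_form.f_B_bound) auto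
  moreover have "1 * cj x + x * cj 1 = 2 * re x" unfolding re_def by (simp add: field_simps)
  ultimately have "(f 2 * f (re x)) ^ 2 \<le> f (nm x)" by (simp add: f_mult)
  then show ?thesis unfolding fE_def using real_le_rsqrt by blast
qed

lemma fE_im: "f 2 * f (im x) * fE \<delta> \<le> fE x"
proof -
  have "f (\<delta> * cj x + x * cj \<delta>) ^ 2 \<le> f (nm \<delta>) * f (nm x)" by (rule norm_form.f_B_bound) auto
  moreover have "\<delta> * cj x + x * cj \<delta> = - (2 * d0 * im x)"
    unfolding im_def d0_def by (simp add: field_simps power2_eq_square)
  ultimately have "(f 2 * f d0 * f (im x)) ^ 2 \<le> f d0 * f (nm x)" by (simp add: f_mult nm_\<delta>)
  moreover have d: "f d0 > 0" using f_pos[of d0] by simp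
  ultimately have "(f 2 * f (im x)) ^ 2 * f d0 \<le> f (nm x)" by (simp add: power2_eq_square mult_ac)
  then have "sqrt ((f 2 * f (im x)) ^ 2 * f d0) \<le> fE x" unfolding fE_def by (rule real_sqrt_le_mono)
  moreover have "0 \<le> f 2 * f (im x)" using f_nonneg by simp
  ultimately show ?thesis unfolding fE_def by (simp add: real_sqrt_mult nm_\<delta>)
qed

lemma fE_complete:
  fixes u :: "nat \<Rightarrow> 'a"
  assumes cauchy: "\<And>e. e > 0 \<Longrightarrow> \<exists>N. \<forall>m\<ge>N. \<forall>n\<ge>N. fE (u m - u n) < e"
  shows "\<exists>l. \<forall>e>0. \<exists>N. \<forall>n\<ge>N. fE (u n - l) < e"
proof -
  have \<delta>: "fE \<delta> > 0" using fE_nonneg[of \<delta>] fE_eq_0[of \<delta>] by simp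
  have lim: "\<exists>l\<in>F. \<forall>e>0. \<exists>N. \<forall>n\<ge>N. f (g (u n) - l) < e"
    if g: "\<And>x. g x \<in> F" "\<And>x y. g (x - y) = g x - g y" and C: "C > 0" "\<And>x. C * f (g x) \<le> fE x" for g C
  proof (rule f_complete)
    fix e :: real assume e: "e > 0"
    then obtain N where N: "\<And>m n. m \<ge> N \<Longrightarrow> n \<ge> N \<Longrightarrow> fE (u m - u n) < C * e"
      using cauchy[of "C * e"] C by auto
    have "f (g (u m) - g (u n)) < e" if mn: "m \<ge> N" "n \<ge> N" for m n
    proof -
      have "C * f (g (u m) - g (u n)) < C * e"
        using C(2)[of "u m - u n"] N[OF mn] g(2)[of "u m" "u n"] by simp
      then show ?thesis using C(1) by simp
    qed
    then show "\<exists>N. \<forall>m\<ge>N. \<forall>n\<ge>N. f (g (u m) - g (u n)) < e" by blast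
  qed (rule g)
  obtain a where a: "a \<in> F" "\<And>e. e > 0 \<Longrightarrow> \<exists>N. \<forall>n\<ge>N. f (re (u n) - a) < e"
    using lim[of re "f 2", OF re_F re_diff f_2_pos fE_re] by blast
  have "f 2 * fE \<delta> > 0" using f_2_pos \<delta> by simp
  moreover have "f 2 * fE \<delta> * f (im x) \<le> fE x" for x using fE_im[of x] by (simp add: mult_ac)
  ultimately obtain b where b: "b \<in> F" "\<And>e. e > 0 \<Longrightarrow> \<exists>N. \<forall>n\<ge>N. f (im (u n) - b) < e"
    using lim[of im "f 2 * fE \<delta>", OF im_F im_diff] by blast
  have "\<exists>N. \<forall>n\<ge>N. fE (u n - (a + b * \<delta>)) < e" if e: "e > 0" for e
  proof -
    obtain N1 where N1: "\<And>n. n \<ge> N1 \<Longrightarrow> f (re (u n) - a) < e" using a(2)[OF e] by blast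
    obtain N2 where N2: "\<And>n. n \<ge> N2 \<Longrightarrow> f (im (u n) - b) < e / fE \<delta>" using b(2)[of "e / fE \<delta>"] e \<delta> by auto
    have "fE (u n - (a + b * \<delta>)) < e" if n: "n \<ge> max N1 N2" for n
    proof -
      have eq: "u n - (a + b * \<delta>) = (re (u n) - a) + (im (u n) - b) * \<delta>"
        by (subst re_im[of "u n"]) (simp add: algebra_simps)
      have "fE (re (u n) - a) < e" using N1[of n] n a by (simp add: fE_F)
      moreover have "fE ((im (u n) - b) * \<delta>) < e"
        using N2[of n] n b(1) \<delta> by (simp add: fE_mult fE_F pos_less_divide_eq)
      ultimately show ?thesis unfolding eq using fE_add[of "re (u n) - a" "(im (u n) - b) * \<delta>"] by simp
    qed
    then show ?thesis by blast
  qed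
  then show ?thesis by blast
qed

text \<open>Either every integral element of E is congruent to an integral element of F, or some
  integral w is not. In the second case w + t is never small for t in F, so integral elements are a
  + b*w with a and b integral, and the representatives r + s*w suffice.\<close>

lemma fE_finite_residue:
  "\<exists>R. finite R \<and> R \<subseteq> {x. fE x \<le> 1} \<and> (\<forall>x. fE x \<le> 1 \<longrightarrow> (\<exists>r\<in>R. fE (x - r) < 1))"
proof -
  obtain R where R: "finite R" "R \<subseteq> {x\<in>F. f x \<le> 1}"
    "\<And>x. x \<in> F \<Longrightarrow> f x \<le> 1 \<Longrightarrow> \<exists>r\<in>R. f (x - r) < 1"
    using finite_residue by blast
  have RF: "r \<in> F" "fE r \<le> 1" if "r \<in> R" for r using R(2) that fE_F by auto
  have fE_less: "fE (x + y) < 1" if "fE x < 1" "fE y < 1" for x y using fE_add[of x y] that by simp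
  show ?thesis
  proof (cases "\<forall>x. fE x \<le> 1 \<longrightarrow> (\<exists>c\<in>F. f c \<le> 1 \<and> fE (x - c) < 1)")
    case True
    have "\<exists>r\<in>R. fE (x - r) < 1" if x: "fE x \<le> 1" for x
    proof -
      obtain c where c: "c \<in> F" "f c \<le> 1" "fE (x - c) < 1" using True x by blast
      obtain r where r: "r \<in> R" "f (c - r) < 1" using R(3) c by blast
      have "fE ((x - c) + (c - r)) < 1" using c r RF by (intro fE_less) (auto simp: fE_F)
      then show ?thesis using r by auto
    qed
    then show ?thesis using R(1) RF by blast
  next
    case False
    then obtain w where w: "fE w \<le> 1" "\<And>c. c \<in> F \<Longrightarrow> f c \<le> 1 \<Longrightarrow> \<not> fE (w - c) < 1" by blast
    have wF: "w \<notin> F" using w(2)[of w] w(1) fE_F[of w] fE_eq_0[of 0] by auto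
    have big: "fE (w + t) \<ge> 1" if t: "t \<in> F" for t
    proof (cases "f t \<le> 1")
      case True
      then show ?thesis using w(2)[of "- t"] t by simp
    next
      case False
      show ?thesis
      proof (rule ccontr)
        assume "\<not> ?thesis"
        then have "fE ((w + t) + (- w)) \<le> 1"
          using fE_add[of "w + t" "- w"] w(1) fE_mult[of "-1" w] fE_F[of "-1"] by simp
        then show False using False fE_F[OF t] by simp
      qed
    qed
    have imw: "im w \<noteq> 0" using wF re_im[of w] re_F[of w] by force
    have rep: "\<exists>a\<in>F. \<exists>b\<in>F. f a \<le> 1 \<and> f b \<le> 1 \<and> x = a + b * w" if x: "fE x \<le> 1" for x
    proof -
      define b where "b = im x / im w"
      define a where "a = re x - b * re w"
      have F: "a \<in> F" "b \<in> F" unfolding a_def b_def by auto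
      have "a + b * w = re x + b * (w - re w)" unfolding a_def by (simp add: algebra_simps)
      also have "w - re w = im w * \<delta>" using re_im[of w] by (metis add_diff_cancel_left')
      also have "re x + b * (im w * \<delta>) = x" unfolding b_def using imw re_im[of x] by simp
      finally have x_eq: "x = a + b * w" by simp
      have fb: "f b \<le> 1"
      proof (cases "b = 0")
        case False
        have "x = b * (w + a / b)" using x_eq False by (simp add: field_simps)
        then have "fE x = f b * fE (w + a / b)" using F by (simp add: fE_mult fE_F)
        then have "f b * 1 \<le> fE x" using mult_left_mono[OF big[of "a / b"] f_nonneg[of b]] F by simp
        then show ?thesis using x by simp
      qed simp
      have "fE (b * w) \<le> 1" using fb w(1) F f_nonneg fE_nonneg by (simp add: fE_mult fE_F mult_le_one)
      then have "fE (x + (- (b * w))) \<le> 1"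
        using fE_add[of x "- (b * w)"] x fE_mult[of "- 1" "b * w"] fE_F[of "-1"] by simp
      then have "f a \<le> 1" using fE_F[of a] F unfolding x_eq by simp
      then show ?thesis using F fb x_eq by blast
    qed
    define R' where "R' = (\<lambda>(r, s). r + s * w) ` (R \<times> R)"
    have "finite R'" unfolding R'_def using R by simp
    moreover have "fE (r + s * w) \<le> 1" if "r \<in> R" "s \<in> R" for r s
    proof -
      have "fE (s * w) \<le> 1" using RF[OF that(2)] w(1) fE_nonneg by (simp add: fE_mult mult_le_one)
      then show ?thesis using fE_add[of r "s * w"] RF[OF that(1)] by simp
    qed
    then have "R' \<subseteq> {x. fE x \<le> 1}" unfolding R'_def by auto
    moreover have "\<exists>r\<in>R'. fE (x - r) < 1" if x: "fE x \<le> 1" for x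
    proof -
      obtain a b where ab: "a \<in> F" "b \<in> F" "f a \<le> 1" "f b \<le> 1" "x = a + b * w" using rep[OF x] by blast
      obtain r where r: "r \<in> R" "f (a - r) < 1" using R(3) ab by blast
      obtain s where s: "s \<in> R" "f (b - s) < 1" using R(3) ab by blast
      have "fE ((b - s) * w) < 1"
      proof -
        have "fE ((b - s) * w) = f (b - s) * fE w" using ab RF[OF s(1)] by (simp add: fE_mult fE_F)
        also have "\<dots> \<le> f (b - s)" using w(1) f_nonneg[of "b - s"] ab RF[OF s(1)] by (simp add: mult_left_le)
        finally show ?thesis using s by simp
      qed
      then have "fE ((a - r) + (b - s) * w) < 1"
        using r ab RF by (intro fE_less) (auto simp: fE_F)
      then have "fE (x - (r + s * w)) < 1" unfolding ab by (simp add: algebra_simps)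
      then show ?thesis using r s unfolding R'_def by auto
    qed
    ultimately show ?thesis by blast
  qed
qed

sublocale E: local_field "UNIV :: 'a set" fE
proof
  show "subfield (UNIV :: 'a set)" unfolding subfield_def by simp
  obtain x where "x \<in> F" "f x \<noteq> 0" "f x \<noteq> 1" using f_nontrivial by blast
  then show "\<exists>x\<in>UNIV. fE x \<noteq> 0 \<and> fE x \<noteq> 1" using fE_F by (intro bexI[of _ x]) auto
  obtain c where c: "c < 1" "\<And>x. x \<in> F \<Longrightarrow> f x < 1 \<Longrightarrow> f x \<le> c" using f_discrete by blast
  have "fE x \<le> sqrt (max c 0)" if "fE x < 1" for x
  proof -
    have "f (nm x) < 1" using that unfolding fE_def by simp
    then have "f (nm x) \<le> max c 0" using c(2)[of "nm x"] by auto
    then show ?thesis unfolding fE_def by (rule real_sqrt_le_mono)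
  qed
  moreover have "sqrt (max c 0) < 1" using c by simp
  ultimately show "\<exists>c<1. \<forall>x\<in>UNIV. fE x < 1 \<longrightarrow> fE x \<le> c" by blast
  show "\<exists>R. finite R \<and> R \<subseteq> {x \<in> UNIV. fE x \<le> 1} \<and> (\<forall>x\<in>UNIV. fE x \<le> 1 \<longrightarrow> (\<exists>r\<in>R. fE (x - r) < 1))"
    using fE_finite_residue by simp
  fix u :: "nat \<Rightarrow> 'a"
  assume "\<And>e. e > 0 \<Longrightarrow> \<exists>N. \<forall>m\<ge>N. \<forall>n\<ge>N. fE (u m - u n) < e"
  then show "\<exists>l\<in>UNIV. \<forall>e>0. \<exists>N. \<forall>n\<ge>N. fE (u n - l) < e" using fE_complete by simp
qed (use fE_nonneg fE_eq_0 fE_mult fE_add in auto)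

section \<open>Symbols of E with entries in F\<close>

lemma hil_E_mono: "hil F a b \<Longrightarrow> hil UNIV a b" by (rule hil_mono) auto

text \<open>Every quaternion algebra over F is split by the quadratic extension.\<close>
lemma hil_E_of_F:
  assumes F: "a \<in> F" "b \<in> F" shows "hil UNIV a b"
proof (cases "a = 0 \<or> b = 0 \<or> hil F a b")
  case True
  moreover have "hil UNIV a 0" if "a \<in> UNIV" for a :: 'a
    using E.hil_square_right[of 0 a] by simp
  then have "hil UNIV 0 b" "hil UNIV a 0" using E.hil_sym by blast+
  ultimately show ?thesis using hil_E_mono by auto
next
  case False
  then have nz: "a \<noteq> 0" "b \<noteq> 0" and neg: "hs a b = - 1" unfolding hs_def by auto
  obtain e where e: "e \<in> F" "e \<noteq> 0" "\<not> hil F d0 e" using hil_nondegenerate[OF d0_F d0_nonsquare] by blast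
  have prod: "hs (a * d0) y = hs a y * hs d0 y" if "y \<in> F" "y \<noteq> 0" for y
    using hs_mult_left[of y a d0] F nz that by simp
  have m1: "hs a (y * z) = hs a y * hs a z" and m2: "hs (a * d0) (y * z) = hs (a * d0) y * hs (a * d0) z"
    if "y \<in> F" "y \<noteq> 0" "z \<in> F" "z \<noteq> 0" for y z
    using hs_mult that F nz by simp_all
  have pm: "hs x y = 1 \<or> hs x y = - 1" for x y unfolding hs_def by simp
  have he: "hs (a * d0) e = - hs a e" using prod[of e] e unfolding hs_def by simp
  \<comment> \<open>Over E the element \<open>d0\<close> is a square, so the two symbols become (a,
    x*b) = 1 and (a, x) = 1, whence (a, b) = 1. If x = b fails in the second symbol, it is corrected
    by a factor y with (a, y) = 1 and (a*\<open>d0\<close>, y) = -1.\<close>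
  have "\<exists>x\<in>F. x \<noteq> 0 \<and> hs a (x * b) = 1 \<and> hs (a * d0) (x * d0) = 1"
  proof (cases "hs (a * d0) (b * d0) = 1")
    case True
    then show ?thesis using F nz m1[of b b] by (intro bexI[of _ b]) auto
  next
    case False
    then have bd: "hs (a * d0) (b * d0) = - 1" using pm by blast
    have "\<exists>y\<in>F. y \<noteq> 0 \<and> hs a y = 1 \<and> hs (a * d0) y = - 1"
    proof (cases "hs a e = 1")
      case True
      then show ?thesis using e he by auto
    next
      case False
      then have ae: "hs a e = - 1" "hs (a * d0) e = 1" using pm[of a e] he by auto
      show ?thesis
      proof (cases "hs (a * d0) b = - 1")
        case True
        then show ?thesis using ae neg e F nz m1[of e b] m2[of e b] by (intro bexI[of _ "e * b"]) auto
      next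
        case False
        then have "hs (a * d0) b = 1" using pm by blast
        then have dd: "hs (a * d0) d0 = - 1" using bd m2[of b d0] F nz by simp
        show ?thesis
        proof (cases "hs a d0 = 1")
          case True
          then show ?thesis using dd by (intro bexI[of _ d0]) auto
        next
          case False
          then have "hs a d0 = - 1" using pm by blast
          then show ?thesis using dd ae e m1[of d0 e] m2[of d0 e] by (intro bexI[of _ "d0 * e"]) auto
        qed
      qed
    qed
    then obtain y where y: "y \<in> F" "y \<noteq> 0" "hs a y = 1" "hs (a * d0) y = - 1" by blast
    have "hs a (y * b * b) = 1" using y m1[of "y * b" b] m1[of y b] F nz by simp
    moreover have "hs (a * d0) (y * (b * d0)) = 1" using y bd m2[of y "b * d0"] F nz by simp
    ultimately show ?thesis using y F nz by (intro bexI[of _ "y * b"]) (auto simp: mult.assoc)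
  qed
  then obtain x where x: "x \<in> F" "x \<noteq> 0" "hs a (x * b) = 1" "hs (a * d0) (x * d0) = 1" by blast
  have h1: "hil UNIV a (x * b)" and h2: "hil UNIV (a * d0) (x * d0)"
    using x(3,4) hil_E_mono unfolding hs_def by (auto split: if_splits)
  have "hil UNIV (a * \<delta>^2) x" using h2 E.hil_mult_square[of "a * d0" x \<delta>] nz unfolding d0_def by simp
  then have "hil UNIV a x" using E.hil_mult_square[of x a \<delta>] x E.hil_sym[of x] by simp
  then show ?thesis using E.hil_cancel[of a x b] h1 nz x by simp
qed

lemma hilbert_F: "a \<in> F \<Longrightarrow> b \<in> F \<Longrightarrow> hilbert a b = 1"
  using hil_E_of_F by (simp add: hilbert_hil)

text \<open>Transitivity of norms: if x is the norm of X + Y*sqrt a from E(sqrt a) to E, then N x is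
  the norm from F(sqrt a) of N X + a*N Y + (X*cj Y + Y*cj X)*sqrt a.\<close>

lemma hil_E_imp_norm:
  assumes a: "a \<in> F" "a \<noteq> 0" and h: "hil UNIV a x" shows "hil F a (nm x)"
proof -
  obtain X Y where x: "x = X^2 - a * Y^2" using E.hil_iff_norm[of a x] a h by auto
  have "nm x = (nm X + a * nm Y)^2 - a * (X * cj Y + Y * cj X)^2"
    unfolding x nm_def using a by (simp add: cj_diff cj_mult power2_eq_square algebra_simps)
  then show ?thesis using hil_norm[of a "nm X + a * nm Y" "X * cj Y + Y * cj X"] a norm_form.B_K[of X Y] by simp
qed

text \<open>The projection formula. One direction is transitivity of norms. For the other, suppose
  (a, x)_E = -1 but (a, N x)_F = 1, and take y with (a, N y)_F = -1. Then (a, y)_E = -1, bilinearity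
  over E gives (a, x*y)_E = 1, and the first direction contradicts this.\<close>

lemma hilbert_norm:
  assumes a: "a \<in> F" "a \<noteq> 0" and x: "x \<noteq> 0" shows "hilbert a x = hs a (nm x)"
proof -
  have "hil UNIV a x" if h: "hil F a (nm x)"
  proof (rule ccontr)
    assume neg: "\<not> hil UNIV a x"
    \<comment> \<open>Otherwise every norm from E is a norm from F(sqrt a). Nondegeneracy for a and
      for a*\<open>d0\<close> gives e and e', neither a norm from E, with (a, e) = -1 and (a, e') =
      1; then e*e' is a norm from E but not from F(sqrt a).\<close>
    have "\<exists>y. y \<noteq> 0 \<and> \<not> hil F a (nm y)"
    proof (rule ccontr)
      assume "\<not> ?thesis"
      then have all: "\<And>e. e \<in> F \<Longrightarrow> e \<noteq> 0 \<Longrightarrow> hil F d0 e \<Longrightarrow> hil F a e" using hil_d0_iff by fastforce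
      have nonsq: "a \<noteq> s^2" for s using neg E.hil_square_right[of s x] E.hil_sym by auto
      have "a * d0 \<noteq> s^2" for s
      proof
        assume "a * d0 = s^2"
        then have "a = (s / \<delta>)^2" unfolding d0_def by (simp add: field_simps)
        then show False using nonsq by blast
      qed
      then obtain e' where e': "e' \<in> F" "e' \<noteq> 0" "\<not> hil F (a * d0) e'"
        using hil_nondegenerate[of "a * d0"] a by auto
      obtain e where e: "e \<in> F" "e \<noteq> 0" "\<not> hil F a e" using hil_nondegenerate[of a] a nonsq by auto
      have 1: "hs a e = - 1" "hs d0 e = - 1" using e all unfolding hs_def by auto
      have "hs (a * d0) e' = hs a e' * hs d0 e'" using hs_mult_left[of e' a d0] e' a by simp
      then have 2: "hs a e' = 1" "hs d0 e' = - 1" using all[of e'] e' unfolding hs_def by (auto split: if_splits)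
      have "hs d0 (e * e') = 1" "hs a (e * e') = - 1" using 1 2 hs_mult e e' a by simp_all
      then show False using all[of "e * e'"] e e' unfolding hs_def by (auto split: if_splits)
    qed
    then obtain y where y: "y \<noteq> 0" "\<not> hil F a (nm y)" by blast
    then have "\<not> hil UNIV a y" using hil_E_imp_norm a by blast
    then have "hil UNIV a (x * y)" using E.hil_neg_mult[of a x y] neg a x y by simp
    then have "hil F a (nm x * nm y)" using hil_E_imp_norm a nm_mult by metis
    then show False using hil_cancel[of a "nm x" "nm y"] h y a x by simp
  qed
  then show ?thesis using hil_E_imp_norm[OF a] unfolding hilbert_hil hs_def by auto
qed

lemma splits_GL2: "splits_twofold (GL2_over F)"
proof -
  have "beta g1 g2 = 1" if g: "g1 \<in> GL2_over F" "g2 \<in> GL2_over F" for g1 g2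
  proof -
    obtain a b c e where g1: "g1 = M2 a b c e" by (cases g1) auto
    obtain a' b' c' e' where g2: "g2 = M2 a' b' c' e'" by (cases g2) auto
    have K: "a \<in> F" "b \<in> F" "c \<in> F" "e \<in> F" "a' \<in> F" "b' \<in> F" "c' \<in> F" "e' \<in> F"
      using g unfolding g1 g2 GL2_over_def by auto
    have D: "mdet g1 \<in> F" "mdet g2 \<in> F" unfolding g1 g2 mdet_def using K by auto
    have "xg (conj_y (mdet g2) (pg g1)) \<in> F" "xg (pg g2) \<in> F"
      "xg (mmul (conj_y (mdet g2) (pg g1)) (pg g2)) \<in> F" "m22 (pg g1) \<in> F"
      using K D unfolding xg_def conj_y_def pg_def mmul_def by (auto simp: g1 g2)
    then show ?thesis unfolding beta_def beta_SL_def vfac_def using D by (simp add: hilbert_F)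
  qed
  then show ?thesis unfolding splits_twofold_def by (intro exI[of _ "\<lambda>_. 1"]) auto
qed

end

text \<open>Identities between signs are proved as a*b = 1: with all symbols on one side,
  simplification expands them and cancels equal pairs.\<close>

lemma sign_eqI: "a * b = 1 \<Longrightarrow> b * b = 1 \<Longrightarrow> a = b" for a b :: int
  by (metis mult.assoc mult.right_neutral mult.left_neutral)

context local_field
begin

section \<open>Rules for computing with symbols as signs\<close>

lemma hs_1 [simp]: "hs a 1 = 1" "hs 1 a = 1"
  using hil_square_right[of 1 a] hil_sym[of 1 a] unfolding hs_def by auto

lemma hs_cases: "hs a b = 1 \<or> hs a b = - 1" unfolding hs_def by auto

lemma hs_square: "c \<in> K \<Longrightarrow> hs a (c^2) = 1"
  using hil_square_right unfolding hs_def by simp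

lemma hs_uminus_self: "hs a (- a) = 1" "hs (- a) a = 1"
  using hil_uminus[of a] hil_sym[of a "- a"] unfolding hs_def by auto

lemma hs_uminus:
  assumes "a \<in> K" "b \<in> K" "a \<noteq> 0" "b \<noteq> 0"
  shows "hs a (- b) = hs a (- 1) * hs a b" "hs (- b) a = hs (- 1) a * hs b a"
  using hs_mult[of a "- 1" b] hs_mult_left[of a "- 1" b] assms by simp_all

lemma hs_self: assumes "a \<in> K" "a \<noteq> 0" shows "hs a a = hs (- 1) a"
  using hs_uminus(2)[of a a] hs_uminus_self(2)[of a] assms hs_cases[of "- 1" a] hs_cases[of a a] by auto

lemma hs_inverse: assumes "a \<in> K" "b \<in> K" "a \<noteq> 0" "b \<noteq> 0" shows "hs a (inverse b) = hs a b"
  using hs_mult[of a b "inverse b"] assms hs_cases[of a b] hs_cases[of a "inverse b"] by auto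

lemma hs_solution:
  assumes "a \<in> K" "b \<in> K" "p \<in> K" "q \<in> K" "r \<in> K" "p \<noteq> 0 \<or> q \<noteq> 0" "a * p^2 + b * q^2 = r^2"
  shows "hs a b = 1"
proof -
  have "hil K a b" unfolding hil_def using assms by (intro bexI[of _ p] bexI[of _ q] bexI[of _ r]) auto
  then show ?thesis unfolding hs_def by simp
qed

text \<open>Since x*z + y*z = z^2, the symbol (x*z, y*z) is 1; expanding it gives the sum rule
  behind the symbol identities below.\<close>

lemma hs_sum:
  assumes K: "x \<in> K" "y \<in> K" "z \<in> K" and nz: "x \<noteq> 0" "y \<noteq> 0" "z \<noteq> 0" and z: "x + y = z"
  shows "hs x y = hs (- 1) z * hs x z * hs y z"
proof -
  have "hs (x * z) (y * z) = 1"
  proof (rule hs_solution)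
    show "x * z * 1^2 + y * z * 1^2 = z^2" unfolding z[symmetric] by (simp add: algebra_simps power2_eq_square)
  qed (use K in auto)
  moreover have "hs (x * z) (y * z) = hs x y * hs x z * hs z y * hs z z"
    using hs_mult[of "x * z" y z] hs_mult_left[of y x z] hs_mult_left[of z x z] K nz by simp
  ultimately have "hs x y * (hs (- 1) z * hs x z * hs y z) = 1"
    using hs_self[of z] hs_sym[of z y] K nz by (simp add: mult_ac)
  then show ?thesis by (rule sign_eqI) (simp add: mult_ac)
qed

lemma hs_left_commute_self: "hs a b * (c * hs a b) = c" by (metis hs_self_mult(2) mult.commute)

end

context quadratic_extension
begin

abbreviation H :: "'a \<Rightarrow> 'a \<Rightarrow> int" where "H \<equiv> E.hs"

lemma hilbert_eq_H: "hilbert a b = H a b" unfolding E.hs_def hilbert_hil by simp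

lemma H_F: "a \<in> F \<Longrightarrow> b \<in> F \<Longrightarrow> H a b = 1" using hilbert_F hilbert_eq_H by simp

lemma H_norm: "a \<in> F \<Longrightarrow> a \<noteq> 0 \<Longrightarrow> x \<noteq> 0 \<Longrightarrow> H a x = hs a (nm x)"
  using hilbert_norm hilbert_eq_H by simp

lemma H_mult: "a \<noteq> 0 \<Longrightarrow> b \<noteq> 0 \<Longrightarrow> c \<noteq> 0 \<Longrightarrow> H a (b * c) = H a b * H a c"
  and H_mult_left: "a \<noteq> 0 \<Longrightarrow> b \<noteq> 0 \<Longrightarrow> c \<noteq> 0 \<Longrightarrow> H (b * c) a = H b a * H c a"
  using E.hs_mult E.hs_mult_left by simp_all

lemma H_self: "a \<noteq> 0 \<Longrightarrow> H a a = H (- 1) a" using E.hs_self by simp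

lemma H_square_right: "a \<noteq> 0 \<Longrightarrow> b \<noteq> 0 \<Longrightarrow> H a (b * b) = 1" by (simp add: H_mult)


text \<open>A, B, C are the Kubota coordinates of three elements, P and Q those of the products of
  neighbours, R that of the triple product, and D is the norm of the middle element. Generically
  they satisfy the Pluecker relation P*Q = B*R + D*A*C; in degenerate positions two of its three
  terms survive.\<close>

lemma cocycle_core:
  assumes nz: "A \<noteq> 0" "B \<noteq> 0" "C \<noteq> 0" "P \<noteq> 0" "Q \<noteq> 0" "R \<noteq> 0" "D \<noteq> 0" and D: "D \<in> F"
    and rel: "P * Q = B * R \<or> P * Q = D * (A * C) \<or> B * R = - (D * (A * C)) \<or> P * Q = B * R + D * (A * C)"
  shows "H A B * H (- (A * B)) P * (H P C * H (- (P * C)) R) =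
    H A Q * H (- (A * Q)) R * (H B C * H (- (B * C)) Q) * H D (P * R * (B * Q))"
proof (rule sign_eqI)
  define m :: 'a where "m = - 1"
  have m: "m \<noteq> 0" unfolding m_def by simp
  have neg: "- x = m * x" for x unfolding m_def by simp
  have self: "H x x = H m x" if "x \<noteq> 0" for x using H_self that m_def by simp
  have FF: "H m D = 1" "H D m = 1" "H D D = 1" "H m m = 1" using H_F D unfolding m_def by auto
  note ex = H_mult H_mult_left self FF mult_ac neg nz m E.hs_sym E.hs_left_commute_self
  show "H A B * H (- (A * B)) P * (H P C * H (- (P * C)) R) *
    (H A Q * H (- (A * Q)) R * (H B C * H (- (B * C)) Q) * H D (P * R * (B * Q))) = 1"
  proof -
    have red: "H A B * H (- (A * B)) P * (H P C * H (- (P * C)) R) *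
      (H A Q * H (- (A * Q)) R * (H B C * H (- (B * C)) Q) * H D (P * R * (B * Q))) =
      H (A * C) B * H (m * (A * B * C)) (P * Q) * H (A * C) R * H (P * Q) R * H D (B * R) * H D (P * Q)"
      by (simp add: ex)
    consider "P * Q = B * R" | "P * Q = D * (A * C)" | "B * R = m * (D * (A * C))" | "P * Q = B * R + D * (A * C)"
      using rel unfolding neg by blast
    then show ?thesis
    proof cases
      case 1
      show ?thesis unfolding red 1 by (simp add: ex)
    next
      case 2
      show ?thesis unfolding red 2 by (simp add: ex)
    next
      case 3
      then have R: "R = m * (D * (A * C)) * inverse B" using nz by (simp add: field_simps)
      have inv: "H x (inverse B) = H x B" "H (inverse B) x = H B x" if "x \<noteq> 0" for x
        using E.hs_inverse[of x B] E.hs_sym that nz by auto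
      show ?thesis unfolding red 3 unfolding R by (simp add: ex inv)
    next
      case 4
      \<comment> \<open>The generic case is the sum rule applied to the Pluecker relation.\<close>
      have "H (B * R) (D * (A * C)) = H (- 1) (P * Q) * H (B * R) (P * Q) * H (D * (A * C)) (P * Q)"
        by (rule E.hs_sum) (use nz 4 in auto)
      then have "H (B * R) (D * (A * C)) * (H m (P * Q) * H (B * R) (P * Q) * H (D * (A * C)) (P * Q)) = 1"
        unfolding m_def by (simp add: mult_ac)
      moreover have "H (B * R) (D * (A * C)) * (H m (P * Q) * H (B * R) (P * Q) * H (D * (A * C)) (P * Q)) =
        H (A * C) B * H (m * (A * B * C)) (P * Q) * H (A * C) R * H (P * Q) R * H D (B * R) * H D (P * Q)"
        by (simp add: ex)
      ultimately show ?thesis unfolding red by simp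
    qed
  qed
  show "H A Q * H (- (A * Q)) R * (H B C * H (- (B * C)) Q) * H D (P * R * (B * Q)) *
    (H A Q * H (- (A * Q)) R * (H B C * H (- (B * C)) Q) * H D (P * R * (B * Q))) = 1"
    by (simp add: mult_ac E.hs_left_commute_self)
qed

end

section \<open>The quaternion algebra and the Kubota cocycle\<close>

context local_field
begin

lemma hs_mult_square: assumes "a \<in> K" "b \<in> K" "c \<in> K" "a \<noteq> 0" "c \<noteq> 0"
  shows "hs a (b * c^2) = hs a b"
  using hil_mult_square[OF assms] unfolding hs_def by simp

end

text \<open>D is the cyclic algebra generated by E and an element of square \<open>w\<close> that
  induces \<open>cj\<close> on E; it is a division algebra because \<open>w\<close> is not a
  norm.\<close>

locale quaternion_algebra = quadratic_extension F f \<delta>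
  for F :: "'a::field_char_0 set" and f :: "'a \<Rightarrow> real" and \<delta> :: 'a +
  fixes w :: 'a
  assumes w_F [simp]: "w \<in> F" and w_nonnorm: "\<not> hil F d0 w"
begin

lemma w_nonzero [simp]: "w \<noteq> 0"
  using w_nonnorm hil_square_right[of 0 d0] by auto

lemma hs_d0_w: "hs d0 w = - 1" unfolding hs_def using w_nonnorm by simp

lemma hs_d0_nm: "x \<noteq> 0 \<Longrightarrow> hs d0 (nm x) = 1" unfolding hs_def using hil_d0_iff by auto

text \<open>The pair (c, d) is the bottom row of the matrix [[cj d, w cj c], [c, d]].\<close>
definition qm :: "'a \<times> 'a \<Rightarrow> 'a \<times> 'a \<Rightarrow> 'a \<times> 'a" where
  "qm p q = (fst p * cj (snd q) + snd p * fst q, w * fst p * cj (fst q) + snd p * snd q)"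

definition qn :: "'a \<times> 'a \<Rightarrow> 'a" where "qn p = nm (snd p) - w * nm (fst p)"

definition qx :: "'a \<times> 'a \<Rightarrow> 'a" where "qx p = (if fst p \<noteq> 0 then fst p else snd p)"

definition bt :: "'a \<times> 'a \<Rightarrow> 'a \<times> 'a \<Rightarrow> int" where
  "bt p q = H (qx p) (qx q) * H (- (qx p * qx q)) (qx (qm p q)) * H (qn p) (qx p * qx (qm p q))"

definition qi :: "'a \<times> 'a \<Rightarrow> 'a \<times> 'a" where "qi p = (- fst p / qn p, cj (snd p) / qn p)"

lemma qn_F [simp, intro]: "qn p \<in> F" unfolding qn_def by auto

lemma qm_assoc: "qm (qm p q) r = qm p (qm q r)"
  unfolding qm_def by (simp add: cj_add cj_mult algebra_simps)

lemma qm_one [simp]: "qm (0, 1) p = p" "qm p (0, 1) = p"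
  unfolding qm_def by simp_all

lemma qn_mult: "qn (qm p q) = qn p * qn q"
  unfolding qn_def qm_def nm_def by (simp add: cj_add cj_mult algebra_simps)

lemma qn_eq_0 [simp]: "qn p = 0 \<longleftrightarrow> p = (0, 0)"
proof
  assume 0: "qn p = 0"
  show "p = (0, 0)"
  proof (cases "fst p = 0")
    case True
    then show ?thesis using 0 unfolding qn_def by (cases p) auto
  next
    case False
    then have "nm (snd p / fst p) * nm (fst p) = nm (snd p)" by (simp flip: nm_mult)
    then have "nm (snd p / fst p) * nm (fst p) = w * nm (fst p)" using 0 unfolding qn_def by simp
    then have "w = nm (snd p / fst p)" using False by simp
    then show ?thesis using w_nonnorm hil_d0_iff[of w] by auto
  qed
qed (auto simp: qn_def)

lemma qn_one [simp]: "qn (0, 1) = 1" unfolding qn_def by simp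

lemma qm_inverse: assumes "p \<noteq> (0, 0)" shows "qm (qi p) p = (0, 1)" "qm p (qi p) = (0, 1)"
proof -
  obtain c d where p: "p = (c, d)" by (cases p)
  define n where "n = qn p"
  have n: "n \<noteq> 0" unfolding n_def using assms by simp
  have c1: "cj (- c / n) = - cj c / n" "cj (cj d / n) = d / n"
    unfolding n_def by (simp_all add: cj_divide cj_uminus)
  have qi: "qi p = (- c / n, cj d / n)" unfolding qi_def n_def p by simp
  have "(d * cj d - w * (c * cj c)) / n = 1" using n unfolding n_def qn_def nm_def p by simp
  then have 1: "w * (- c / n) * cj c + cj d / n * d = 1" "w * c * (- cj c / n) + d * (cj d / n) = 1"
    using n by (simp_all add: field_simps)
  have 2: "- c / n * cj d + cj d / n * c = 0" "c * (d / n) + d * (- c / n) = 0"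
    using n by (simp_all add: field_simps)
  show "qm (qi p) p = (0, 1)" unfolding qi unfolding qm_def p using 1(1) 2(1) by simp
  show "qm p (qi p) = (0, 1)" unfolding qi unfolding qm_def p fst_conv snd_conv c1 using 1(2) 2(2) by simp
qed

lemma qm_nonzero: "p \<noteq> (0, 0) \<Longrightarrow> q \<noteq> (0, 0) \<Longrightarrow> qm p q \<noteq> (0, 0)"
  using qn_mult[of p q] qn_eq_0 by (metis mult_eq_0_iff)

lemma qi_nonzero: "p \<noteq> (0, 0) \<Longrightarrow> qi p \<noteq> (0, 0)"
  using qm_inverse(1)[of p] by (auto simp: qm_def)

lemma qm_right_cancel: assumes "r \<noteq> (0, 0)" "qm p r = qm q r" shows "p = q"
proof -
  have "p = qm (qm p r) (qi r)" unfolding qm_assoc qm_inverse(2)[OF assms(1)] by simp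
  also have "\<dots> = q" unfolding assms(2) qm_assoc qm_inverse(2)[OF assms(1)] by simp
  finally show ?thesis .
qed

lemma qx_nonzero: "p \<noteq> (0, 0) \<Longrightarrow> qx p \<noteq> 0" unfolding qx_def by (cases p) auto

lemma qx_F_left: "fst p = 0 \<Longrightarrow> p \<noteq> (0, 0) \<Longrightarrow> qx (qm p q) = snd p * qx q"
  unfolding qx_def qm_def by (cases p) auto

text \<open>The identity is checked on bottom rows. Which lower left entries vanish decides which of
  the four relations of \<open>cocycle_core\<close> holds.\<close>

lemma bt_cocycle:
  assumes nz: "p \<noteq> (0, 0)" "q \<noteq> (0, 0)" "r \<noteq> (0, 0)"
  shows "bt p q * bt (qm p q) r = bt p (qm q r) * bt q r"
proof -
  define A B C P Q R where "A = qx p" and "B = qx q" and "C = qx r" and "P = qx (qm p q)"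
    and "Q = qx (qm q r)" and "R = qx (qm p (qm q r))"
  define D where "D = qn q"
  have nzs: "A \<noteq> 0" "B \<noteq> 0" "C \<noteq> 0" "P \<noteq> 0" "Q \<noteq> 0" "R \<noteq> 0" "D \<noteq> 0" "qn p \<noteq> 0"
    unfolding A_def B_def C_def P_def Q_def R_def D_def using nz qx_nonzero qm_nonzero by auto
  obtain c1 d1 where p: "p = (c1, d1)" by (cases p)
  obtain c2 d2 where q: "q = (c2, d2)" by (cases q)
  obtain c3 d3 where r: "r = (c3, d3)" by (cases r)
  have D: "D = d2 * cj d2 - w * (c2 * cj c2)" unfolding D_def qn_def q nm_def by simp
  define c12 where "c12 = c1 * cj d2 + d1 * c2"
  define d12 where "d12 = w * c1 * cj c2 + d1 * d2"
  define c23 where "c23 = c2 * cj d3 + d2 * c3"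
  define d23 where "d23 = w * c2 * cj c3 + d2 * d3"
  have pq: "qm p q = (c12, d12)" unfolding p q qm_def c12_def d12_def by simp
  have qr: "qm q r = (c23, d23)" unfolding q r qm_def c23_def d23_def by simp
  have pqr: "qm p (qm q r) = (c12 * cj d3 + d12 * c3, w * c12 * cj c3 + d12 * d3)"
    unfolding qm_assoc[symmetric] pq unfolding r qm_def by simp
  have pqr': "qm p (qm q r) = (c1 * cj d23 + d1 * c23, w * c1 * cj c23 + d1 * d23)"
    unfolding qr unfolding p qm_def by simp
  have rel: "P * Q = B * R \<or> P * Q = D * (A * C) \<or> B * R = - (D * (A * C)) \<or> P * Q = B * R + D * (A * C)"
  proof (cases "c1 = 0")
    case True
    then have "P = d1 * B" "R = d1 * Q"
      unfolding P_def R_def B_def Q_def using qx_F_left[of p] nz p by auto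
    then show ?thesis by simp
  next
    case c1: False
    then have A: "A = c1" unfolding A_def qx_def p by simp
    show ?thesis
    proof (cases "c2 = 0")
      case True
      then have "d2 \<noteq> 0" using nz q by auto
      then have "P = c1 * cj d2" unfolding P_def pq qx_def c12_def using True c1 by simp
      moreover have "Q = d2 * C" unfolding Q_def C_def using qx_F_left[of q r] nz q True by auto
      ultimately show ?thesis unfolding D A using True by simp
    next
      case c2: False
      then have B: "B = c2" unfolding B_def qx_def q by simp
      \<comment> \<open>The rows of p*q and q arise from (c1, d1) and (0, 1) by multiplication with
        q, so their determinant is c1*D.\<close>
      have key: "c12 * d2 - c2 * d12 = c1 * D" unfolding c12_def d12_def D by (simp add: algebra_simps)
      show ?thesis
      proof (cases "c3 = 0")
        case True
        then have d3: "d3 \<noteq> 0" using nz r by auto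
        have C: "C = d3" unfolding C_def qx_def r using True by simp
        have Q: "Q = c2 * cj d3" unfolding Q_def qr qx_def c23_def using True c2 d3 by simp
        show ?thesis
        proof (cases "c12 = 0")
          case True
          have "R = d12 * d3" unfolding R_def pqr qx_def using True \<open>c3 = 0\<close> by simp
          moreover have "c2 * d12 = - (c1 * D)" using key True by (simp add: minus_equation_iff)
          ultimately have "B * R = - (c1 * D) * d3" unfolding B by (metis mult.assoc)
          then show ?thesis unfolding A C by (simp add: mult_ac)
        next
          case False
          then have "P = c12" "R = c12 * cj d3"
            unfolding P_def pq R_def pqr qx_def using True d3 by auto
          then show ?thesis unfolding Q B by simp
        qed
      next
        case c3: False
        then have C: "C = c3" unfolding C_def qx_def r by simp
        show ?thesis
        proof (cases "c12 = 0")
          case True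
          then have "d12 \<noteq> 0" using qm_nonzero[OF nz(1,2)] pq by auto
          then have "R = d12 * c3" unfolding R_def pqr qx_def using True c3 by simp
          moreover have "c2 * d12 = - (c1 * D)" using key True by (simp add: minus_equation_iff)
          ultimately have "B * R = - (c1 * D) * c3" unfolding B by (metis mult.assoc)
          then show ?thesis unfolding A C by (simp add: mult_ac)
        next
          case c12: False
          then have P: "P = c12" unfolding P_def pq qx_def by simp
          show ?thesis
          proof (cases "c23 = 0")
            case True
            then have "d23 \<noteq> 0" using qm_nonzero[OF nz(2,3)] qr by auto
            then have R: "R = c1 * cj d23" unfolding R_def pqr' qx_def using True c1 by simp
            have "c2 * cj d3 = - (d2 * c3)" using True unfolding c23_def by (simp add: eq_neg_iff_add_eq_0)
            then have "cj d2 * (c2 * cj d3) = - (cj d2 * (d2 * c3))" by simp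
            then have "c2 * cj d23 = - (D * c3)"
              unfolding d23_def D by (simp add: cj_add cj_mult algebra_simps)
            then have "B * R = c1 * - (D * c3)" unfolding B R by (metis mult.left_commute)
            then show ?thesis unfolding A C by (simp add: mult_ac)
          next
            case False
            then have Q: "Q = c23" unfolding Q_def qr qx_def by simp
            have pl: "c12 * c23 = c2 * (c12 * cj d3 + d12 * c3) + D * (c1 * c3)"
            proof -
              have "c12 * c23 - c2 * (c12 * cj d3 + d12 * c3) = c3 * (c12 * d2 - c2 * d12)"
                unfolding c23_def by (simp add: algebra_simps)
              then show ?thesis unfolding key by (simp add: algebra_simps)
            qed
            show ?thesis
            proof (cases "c12 * cj d3 + d12 * c3 = 0")
              case True
              then show ?thesis using pl unfolding P Q A C by simp
            next
              case False
              then have "R = c12 * cj d3 + d12 * c3" unfolding R_def pqr qx_def by simp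
              then show ?thesis using pl unfolding P Q A C B by simp
            qed
          qed
        qed
      qed
    qed
  qed
  have core: "H A B * H (- (A * B)) P * (H P C * H (- (P * C)) R) =
    H A Q * H (- (A * Q)) R * (H B C * H (- (B * C)) Q) * H D (P * R * (B * Q))"
    by (rule cocycle_core[OF nzs(1-7) _ rel]) (simp add: D_def)
  have "bt p q * bt (qm p q) r = (H A B * H (- (A * B)) P * (H P C * H (- (P * C)) R)) *
      (H (qn p) (A * P) * H (qn p * D) (P * R))"
    unfolding bt_def A_def B_def C_def P_def R_def D_def qn_mult qm_assoc by (simp add: mult_ac)
  also have "\<dots> = H A Q * H (- (A * Q)) R * (H B C * H (- (B * C)) Q) *
      (H D (P * R * (B * Q)) * (H (qn p) (A * P) * H (qn p * D) (P * R)))"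
    unfolding core by (simp add: mult_ac)
  also have "H D (P * R * (B * Q)) * (H (qn p) (A * P) * H (qn p * D) (P * R)) = H (qn p) (A * R) * H D (B * Q)"
    using nzs by (simp add: H_mult H_mult_left mult_ac E.hs_left_commute_self)
  also have "H A Q * H (- (A * Q)) R * (H B C * H (- (B * C)) Q) * (H (qn p) (A * R) * H D (B * Q)) =
      bt p (qm q r) * bt q r"
    unfolding bt_def A_def B_def C_def Q_def R_def D_def by (simp add: mult_ac)
  finally show ?thesis .
qed

section \<open>Comparison with the cocycle on matrices\<close>

definition dm :: "'a \<times> 'a \<Rightarrow> 'a mat2" where
  "dm p = M2 (cj (snd p)) (w * cj (fst p)) (fst p) (snd p)"

lemma mmul_dm: "mmul (dm p) (dm q) = dm (qm p q)"
  unfolding mmul_def dm_def qm_def by (simp add: cj_add cj_mult algebra_simps)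

lemma mdet_dm: "mdet (dm p) = qn p"
  unfolding mdet_def dm_def qn_def nm_def by (simp add: mult_ac)

text \<open>Determinants of elements of D lie in F, where symbols of E are trivial. Of all factors
  introduced by the normalisations \<open>pg\<close> and \<open>conj_y\<close>, only the symbol with
  the first norm survives.\<close>

lemma beta_rows:
  assumes g: "m21 g = c1" "m22 g = d1" "mdet g = qn (c1, d1)" and h: "m21 h = c2" "m22 h = d2" "mdet h = qn (c2, d2)"
    and gh: "m21 (mmul g h) = fst (qm (c1, d1) (c2, d2))"
      "m21 (mmul g h) = 0 \<Longrightarrow> m22 (mmul g h) = snd (qm (c1, d1) (c2, d2))"
    and nz: "(c1, d1) \<noteq> (0, 0)" "(c2, d2) \<noteq> (0, 0)"
  shows "beta g h = bt (c1, d1) (c2, d2)"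
proof -
  define D1 D2 where "D1 = qn (c1, d1)" and "D2 = qn (c2, d2)"
  define A B P where "A = qx (c1, d1)" and "B = qx (c2, d2)" and "P = qx (qm (c1, d1) (c2, d2))"
  have nzs: "A \<noteq> 0" "B \<noteq> 0" "P \<noteq> 0" "D1 \<noteq> 0" "D2 \<noteq> 0"
    unfolding A_def B_def P_def D1_def D2_def using nz qx_nonzero qm_nonzero by auto
  have DF: "D1 \<in> F" "D2 \<in> F" unfolding D1_def D2_def by auto
  have m21: "m21 (mmul g h) = c1 * m11 h + d1 * c2" "m22 (mmul g h) = c1 * m12 h + d1 * d2"
    using g h by (auto simp: mmul_def)
  define m :: 'a where "m = - 1"
  have m: "m \<noteq> 0" unfolding m_def by simp
  have neg: "- x = m * x" for x unfolding m_def by simp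
  have self: "H x x = H m x" if "x \<noteq> 0" for x using H_self that m_def by simp
  have div: "H x (y / z) = H x y * H x z" "H (y / z) x = H y x * H z x" if "x \<noteq> 0" "y \<noteq> 0" "z \<noteq> 0" for x y z
    using E.hs_inverse[of x z] E.hs_sym H_mult[of x y "inverse z"] H_mult_left[of x y "inverse z"] that
    by (auto simp: divide_inverse)
  have FF: "H m D1 = 1" "H D1 m = 1" "H D1 D1 = 1" "H m m = 1" "H D1 D2 = 1" "H D2 D1 = 1" "H D2 D2 = 1" "H m D2 = 1" "H D2 m = 1"
    using H_F DF unfolding m_def by auto
  note ex = H_mult H_mult_left self FF mult_ac neg nzs m E.hs_sym E.hs_left_commute_self div
  have x2: "xg (pg h) = B / D2" unfolding xg_def pg_def B_def qx_def D2_def[symmetric] using h nzs by (auto simp: D2_def)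
  let ?g = "conj_y (mdet h) (pg g)"
  have row: "m21 (mmul ?g (pg h)) = m21 (mmul g h) / (D1 * D2)" "m22 (mmul ?g (pg h)) = m22 (mmul g h) / (D1 * D2)"
    unfolding m21 using g h nzs by (simp_all add: mmul_def conj_y_def pg_def D1_def D2_def field_simps)
  have x3: "xg (mmul ?g (pg h)) = P / (D1 * D2)"
    unfolding xg_def row P_def qx_def using gh nzs by auto
  show ?thesis
  proof (cases "c1 = 0")
    case False
    have x1: "xg ?g = A / (D1 * D2)" unfolding xg_def A_def qx_def using False g h nzs
      by (simp add: conj_y_def pg_def D1_def D2_def)
    have v: "vfac (mdet h) (pg g) = 1" unfolding vfac_def pg_def using False g nzs by (simp add: D1_def)
    have "- inverse (A / (D1 * D2)) * (B / D2) = - (B * D1 / A)" using nzs by (simp add: field_simps)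
    then have "beta g h = H (A / (D1 * D2)) (B / D2) * H (- (B * D1 / A)) (P / (D1 * D2))"
      unfolding beta_def beta_SL_def x1 x2 x3 v hilbert_eq_H by simp
    also have "\<dots> = H A B * H (- (A * B)) P * H D1 (A * P)" by (simp add: ex)
    finally show ?thesis unfolding bt_def A_def B_def P_def D1_def .
  next
    case True
    \<comment> \<open>The diagonal conjugation leaves the lower right entry alone, so D2 is absent
      from this denominator; \<open>vfac\<close> supplies the corresponding symbol.\<close>
    have x1: "xg ?g = A / D1" unfolding xg_def A_def qx_def using True g h nzs
      by (simp add: conj_y_def pg_def D1_def D2_def)
    have P: "P = A * B" using qx_F_left[of "(c1, d1)" "(c2, d2)"] True nz unfolding P_def A_def B_def qx_def by auto
    have v: "vfac (mdet h) (pg g) = H D2 (A / D1)" unfolding vfac_def pg_def hilbert_eq_H A_def qx_def using True g h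
      by (simp add: D1_def D2_def)
    have "- inverse (A / D1) * (B / D2) = - (B * D1 / (A * D2))" using nzs by (simp add: field_simps)
    then have "beta g h = H (A / D1) (B / D2) * H (- (B * D1 / (A * D2))) (P / (D1 * D2)) * H D2 (A / D1)"
      unfolding beta_def beta_SL_def x1 x2 x3 v hilbert_eq_H by (simp add: mult_ac)
    also have "\<dots> = H A B * H (- (A * B)) P * H D1 (A * P)" unfolding P by (simp add: ex)
    finally show ?thesis unfolding bt_def A_def B_def P_def D1_def .
  qed
qed

lemma beta_dm: assumes "p \<noteq> (0, 0)" "q \<noteq> (0, 0)" shows "beta (dm p) (dm q) = bt p q"
proof -
  obtain c1 d1 where p: "p = (c1, d1)" by (cases p)
  obtain c2 d2 where q: "q = (c2, d2)" by (cases q)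
  show ?thesis unfolding p q
    by (rule beta_rows) (use assms p q in \<open>auto simp: mdet_dm mmul_dm, auto simp: dm_def\<close>)
qed

end

section \<open>Splitting over the norm one group\<close>

context quaternion_algebra
begin

definition \<mu> :: 'a where "\<mu> = - (d0 * w)"

lemma \<mu>_F [simp]: "\<mu> \<in> F" and \<mu>_nonzero [simp]: "\<mu> \<noteq> 0" unfolding \<mu>_def by auto

text \<open>The value of (r, -n)_E for every trace zero quaternion of norm n with lower left entry r
  nonzero. Here \<mu> is minus the product of the coefficients of \<open>d0\<close>*t^2 + w*N, the
  form taken by -n.\<close>

definition lam :: "'a \<Rightarrow> int" where "lam n = - hs \<mu> (- n)"

lemma lam_sign: "lam n * lam n = 1" unfolding lam_def by simp

text \<open>\<open>lam\<close> is a character times a constant sign, and a constant sign survives in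
  a product of three factors.\<close>

lemma lam_mult3:
  assumes "a \<in> F" "b \<in> F" "c \<in> F" "a \<noteq> 0" "b \<noteq> 0" "c \<noteq> 0"
  shows "lam a * lam b * lam c = lam (a * b * c)"
proof -
  have neg: "hs \<mu> (- x) = hs \<mu> (- 1) * hs \<mu> x" if "x \<in> F" "x \<noteq> 0" for x using hs_uminus(1)[of \<mu> x] that by simp
  show ?thesis unfolding lam_def using neg[of a] neg[of b] neg[of c] neg[of "a * b * c"] assms
    by (simp add: hs_mult mult_ac hs_left_commute_self)
qed

lemma hs_\<mu>: assumes "x \<in> F" "x \<noteq> 0" shows "hs \<mu> x = hs (- 1) x * hs d0 x * hs w x"
  unfolding \<mu>_def using hs_uminus(2)[of x "d0 * w"] hs_mult_left[of x d0 w] assms by simp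

text \<open>Here -n = \<open>d0\<close>*t^2 + w*N r, and (\<open>d0\<close>, w*N r) = -1 since N r
  is a norm and w is not. The sum rule turns this into (\<mu>, -n)*(N r, -n) = -1, and (N r, -n)_F =
  (r, -n)_E by the projection formula.\<close>

lemma lam_pure:
  assumes n: "n \<in> F" "n \<noteq> 0" and e: "cj e = - e" and eq: "n = e * cj e - w * nm r" and r: "r \<noteq> 0"
  shows "H r (- n) = lam n"
proof -
  define t where "t = e / \<delta>"
  have t: "t \<in> F" by (rule cj_fixed) (simp add: t_def cj_divide e)
  have e2: "e * cj e = - (d0 * t^2)" unfolding t_def d0_def e by (simp add: power_divide power2_eq_square)
  define S where "S = - n"
  have S: "S \<in> F" "S \<noteq> 0" unfolding S_def using n by auto
  have sum: "d0 * t^2 + w * nm r = S" unfolding S_def eq e2 by simp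
  define N where "N = nm r"
  have N: "N \<in> F" "N \<noteq> 0" "hs d0 N = 1" unfolding N_def using r hs_d0_nm by auto
  have HN: "H r S = hs S N" unfolding N_def using H_norm[of S r] S r E.hs_sym by simp
  have dwN: "hs d0 (w * N) = - 1" using hs_mult[of d0 w N] N hs_d0_w by simp
  have "hs S N = - hs \<mu> S"
  proof (cases "t = 0")
    case False
    have "hs (d0 * t^2) (w * N) = hs (- 1) S * hs (d0 * t^2) S * hs (w * N) S"
      by (rule hs_sum) (use S N t False sum N_def in auto)
    moreover have "hs (d0 * t^2) x = hs d0 x" if "x \<in> F" "x \<noteq> 0" for x
      using hs_mult_square[of x d0 t] hs_sym[of x] that t False by simp
    ultimately have "- 1 = hs (- 1) S * hs d0 S * (hs w S * hs N S)"
      using dwN S N hs_mult_left[of S w N] by simp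
    then have "- 1 = hs \<mu> S * hs S N" using hs_\<mu>[OF S] hs_sym[of S N] by (simp add: mult_ac)
    then show ?thesis using hs_cases[of \<mu> S] hs_cases[of S N] by auto
  next
    case True
    then have S': "S = w * N" using sum N_def by simp
    have "hs \<mu> S = - (hs (- 1) (w * N) * hs w (w * N))" unfolding hs_\<mu>[OF S] unfolding S' dwN by simp
    also have "hs (- 1) (w * N) * hs w (w * N) = hs S N"
      unfolding S' using N hs_mult[of "- 1" w N] hs_mult[of w w N] hs_self[of w] hs_self[of N] hs_mult_left[of N w N]
      by (simp add: mult_ac hs_left_commute_self)
    finally show ?thesis by simp
  qed
  then show ?thesis using HN unfolding lam_def S_def by simp
qed

text \<open>The case r = 0: now -n is a square in E, so its symbols in E are trivial, and
  \<open>lam\<close> takes the matching value.\<close>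

lemma lam_pure0:
  assumes e: "cj e = - e" and eq: "n = e * cj e" and n: "n \<noteq> 0"
  shows "lam n = 1" "- n = e^2"
proof -
  define t where "t = e / \<delta>"
  have t: "t \<in> F" by (rule cj_fixed) (simp add: t_def cj_divide e)
  show ne: "- n = e^2" unfolding eq e by (simp add: power2_eq_square)
  also have "\<dots> = d0 * t^2" unfolding t_def d0_def by (simp add: power_divide)
  finally have nt: "- n = d0 * t^2" .
  then have t0: "t \<noteq> 0" using n by auto
  have "hs \<mu> (- n) = hs \<mu> d0" unfolding nt using hs_mult_square[of \<mu> d0 t] t t0 by simp
  also have "\<dots> = hs (- 1) d0 * hs d0 d0 * hs w d0" by (rule hs_\<mu>) auto
  also have "\<dots> = - 1" using hs_self[of d0] hs_sym[of w d0] hs_d0_w by simp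
  finally show "lam n = 1" unfolding lam_def by simp
qed

text \<open>The reduced norm of x - 1. Half the sum of the Cayley transforms of x and y is a trace zero
  quaternion of norm nu (xy) / (nu x nu y); evaluating the symbol on such quaternions gives the
  formula for the splitting.\<close>
definition nu :: "'a \<times> 'a \<Rightarrow> 'a" where "nu x = qn (fst x, snd x - 1)"

definition sg :: "'a \<times> 'a \<Rightarrow> int" where
  "sg x = (if x = (0, 1) then 1 else lam (nu x) * H (qx x) (- nu x))"

lemma nu_F [simp, intro]: "nu x \<in> F" unfolding nu_def by auto

lemma nu_nonzero: "x \<noteq> (0, 1) \<Longrightarrow> nu x \<noteq> 0" unfolding nu_def by (cases x) auto

lemma sg_sign: "sg x * sg x = 1" unfolding sg_def using lam_sign[of "nu x"] by (simp add: mult_ac E.hs_left_commute_self)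

lemma bt_sign: "bt p q * bt p q = 1"
  unfolding bt_def by (simp add: mult_ac E.hs_left_commute_self)

lemma qn1_nonzero: "qn x = 1 \<Longrightarrow> x \<noteq> (0, 0)" by (metis qn_eq_0 zero_neq_one)

lemma qn1_eq: "qn (c, d) = 1 \<Longrightarrow> w * (c * cj c) = d * cj d - 1"
  unfolding qn_def nm_def by (simp add: algebra_simps)

lemma nu_eq: assumes "qn x = 1" shows "nu x = 2 - snd x - cj (snd x)"
proof -
  obtain c d where x: "x = (c, d)" by (cases x)
  show ?thesis using qn1_eq[of c d] assms unfolding x nu_def qn_def nm_def by (simp add: cj_diff algebra_simps)
qed

lemma torus_square:
  assumes "qn x = 1" "fst x = 0" shows "- nu x * snd x = (1 - snd x)^2"
proof -
  obtain c d where x: "x = (c, d)" by (cases x)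
  have c: "c = 0" using assms x by simp
  have 1: "d * cj d = 1" using qn1_eq[of c d] assms x c by simp
  have nu: "nu x = 2 - d - cj d" using nu_eq[OF assms(1)] x by simp
  have "- nu x * d = d * cj d - 2 * d + d^2" unfolding nu by (simp add: algebra_simps power2_eq_square)
  then show ?thesis unfolding 1 x by (simp add: algebra_simps power2_eq_square)
qed

text \<open>On the torus, where the lower left entry is 0, \<open>torus_square\<close> puts the
  coordinate of x and -\<open>nu x\<close> into one square class of E; the latter lies in F, so its
  symbols with F are trivial.\<close>

lemma H_torus:
  assumes "qn x = 1" "fst x = 0" "x \<noteq> (0, 1)" "y \<noteq> 0"
  shows "H (qx x) y = H (- nu x) y" "H y (qx x) = H y (- nu x)"
proof -
  have x0: "snd x \<noteq> 0" using qn1_nonzero[OF assms(1)] assms(2) by (cases x) auto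
  have "qx x = snd x" unfolding qx_def using assms by simp
  moreover have "H y ((- nu x) * snd x) = 1" unfolding torus_square[OF assms(1,2)] by (rule E.hs_square) simp
  then have "H y (- nu x) * H y (snd x) = 1" using H_mult[of y "- nu x" "snd x"] assms nu_nonzero x0 by simp
  ultimately show 1: "H y (qx x) = H y (- nu x)"
    using E.hs_cases[of y "- nu x"] E.hs_cases[of y "snd x"] by auto
  then show "H (qx x) y = H (- nu x) y" using E.hs_sym by metis
qed

lemma sg_inverse:
  assumes x: "qn x = 1" "qn y = 1" "qm x y = (0, 1)"
  shows "sg x * sg y * bt x y = 1"
proof (cases "x = (0, 1)")
  case True
  then show ?thesis using x by (simp add: sg_def bt_def qx_def)
next
  case False
  have y: "y = (- fst x, cj (snd x))"
  proof -
    have "x \<noteq> (0, 0)" using qn1_nonzero x by blast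
    then have "y = qm (qm (qi x) x) y" using qm_inverse(1) by simp
    also have "\<dots> = qi x" unfolding qm_assoc x(3) by simp
    finally show ?thesis unfolding qi_def x(1) by simp
  qed
  have y1: "y \<noteq> (0, 1)" using False y by (cases x) (auto, metis cj_1 cj_cj)
  have nu: "nu y = nu x" using nu_eq[OF x(1)] nu_eq[OF x(2)] unfolding y by simp
  have n0: "nu x \<noteq> 0" using nu_nonzero False by blast
  have s: "sg x * sg y = H (qx x) (- nu x) * H (qx y) (- nu x)"
    unfolding sg_def nu using False y1 lam_sign[of "nu x"] by (simp add: mult_ac)
  have b: "bt x y = H (qx x) (qx y)" unfolding bt_def x(3) using x(1) by (simp add: qx_def)
  show ?thesis
  proof (cases "fst x = 0")
    case True
    then have ty: "fst y = 0" using y by simp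
    have "H (qx x) (- nu x) = 1" "H (qx y) (- nu x) = 1"
      using H_torus(1)[OF x(1) True False, of "- nu x"] H_torus(1)[OF x(2) ty y1, of "- nu x"] n0 nu H_F by auto
    moreover have "H (qx x) (qx y) = 1"
      using H_torus(1)[OF x(1) True False, of "qx y"] H_torus(2)[OF x(2) ty y1, of "- nu x"] n0 nu H_F
        qx_nonzero qn1_nonzero x by auto
    ultimately show ?thesis unfolding s b by simp
  next
    case False
    then have q: "qx x = fst x" "qx y = - fst x" unfolding qx_def y by auto
    have "H (- fst x) (- nu x) = H (- 1) (- nu x) * H (fst x) (- nu x)"
      using E.hs_uminus(2)[of "- nu x" "fst x"] False n0 by simp
    then show ?thesis unfolding s b q using H_F[of "- 1" "- nu x"] E.hs_uminus_self(1)[of "fst x"] by simp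
  qed
qed

text \<open>The three factors \<open>lam\<close> combine to lam (n1*n2*n3), which is the symbol (R,
  -n1*n2*n3) of the trace zero quaternion with entries R and e. The remaining identity follows from
  R = c1*n2 + c2*n1 and from \<open>pluck\<close>. The case distinction isolates the vanishing of
  c1, c2, c3 or R.\<close>

lemma sg_mult:
  assumes x: "qn x = 1" and y: "qn y = 1"
  shows "sg (qm x y) = sg x * sg y * bt x y"
proof -
  have nz: "x \<noteq> (0, 0)" "y \<noteq> (0, 0)" using x y qn1_nonzero by auto
  consider "x = (0, 1)" | "y = (0, 1)" | "qm x y = (0, 1)" | "x \<noteq> (0, 1)" "y \<noteq> (0, 1)" "qm x y \<noteq> (0, 1)" by blast
  then show ?thesis
  proof cases
    case 1
    then show ?thesis using E.hs_uminus_self(2)[of "qx y"] by (simp add: sg_def[of "(0, 1)"] bt_def) (simp add: qx_def)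
  next
    case 2
    then show ?thesis using E.hs_uminus_self(2)[of "qx x"] x by (simp add: sg_def[of "(0, 1)"] bt_def) (simp add: qx_def)
  next
    case 3
    then show ?thesis using sg_inverse[OF x y] by (simp add: sg_def)
  next
    case 4
    define z where "z = qm x y"
    have z: "qn z = 1" unfolding z_def using qn_mult x y by simp
    obtain c1 d1 where xe: "x = (c1, d1)" by (cases x)
    obtain c2 d2 where ye: "y = (c2, d2)" by (cases y)
    define c3 d3 where "c3 = fst z" and "d3 = snd z"
    have c3: "c3 = c1 * cj d2 + d1 * c2" and d3: "d3 = w * c1 * cj c2 + d1 * d2"
      unfolding c3_def d3_def z_def xe ye qm_def by auto
    define n1 n2 n3 where "n1 = nu x" and "n2 = nu y" and "n3 = nu z"
    have n: "n1 \<noteq> 0" "n2 \<noteq> 0" "n3 \<noteq> 0" "n1 \<in> F" "n2 \<in> F" "n3 \<in> F"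
      unfolding n1_def n2_def n3_def using nu_nonzero 4 z_def by auto
    have ne: "n1 = 2 - d1 - cj d1" "n2 = 2 - d2 - cj d2" "n3 = 2 - d3 - cj d3"
      unfolding n1_def n2_def n3_def using nu_eq[OF x] nu_eq[OF y] nu_eq[OF z] xe ye d3_def by simp_all
    have q1: "w * (c1 * cj c1) = d1 * cj d1 - 1" and q2: "w * (c2 * cj c2) = d2 * cj d2 - 1"
      using qn1_eq x y xe ye by auto
    \<comment> \<open>R and -e are n1*n2 times the entries of the half sum of the Cayley transforms
      of x and y.\<close>
    define R where "R = c1 * n2 + c2 * n1"
    define e where "e = (cj d1 - 1) * n2 + (cj d2 - 1) * n1 + n1 * n2"
    have cjn: "cj n1 = n1" "cj n2 = n2" using n by auto
    have ece: "cj e = - e"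
      unfolding e_def by (simp add: cj_add cj_mult cj_diff cjn) (simp add: ne algebra_simps)
    have nuprod: "n1 * n2 * n3 = e * cj e - w * nm R"
    proof -
      have "w * nm R = (w * (c1 * cj c1)) * n2^2 + (w * (c2 * cj c2)) * n1^2 + n1 * n2 * (w * (c1 * cj c2 + c2 * cj c1))"
        unfolding R_def nm_def by (simp add: cj_add cj_mult cjn algebra_simps power2_eq_square)
      also have "w * (c1 * cj c2 + c2 * cj c1) = 2 - n3 - d1 * d2 - cj d1 * cj d2"
        unfolding ne d3 by (simp add: cj_add cj_mult algebra_simps)
      finally have wR: "w * nm R = (d1 * cj d1 - 1) * n2^2 + (d2 * cj d2 - 1) * n1^2 + n1 * n2 * (2 - n3 - d1 * d2 - cj d1 * cj d2)"
        unfolding q1 q2 .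
      have ee: "e * cj e = ((cj d1 - 1) * n2 + (cj d2 - 1) * n1 + n1 * n2) * ((d1 - 1) * n2 + (d2 - 1) * n1 + n1 * n2)"
        unfolding e_def by (simp add: cj_add cj_mult cj_diff cjn)
      show ?thesis unfolding ee wR unfolding ne(1,2) by (simp add: algebra_simps power2_eq_square)
    qed
    define v where "v = n1 * n2 * n3"
    have v: "v \<in> F" "v \<noteq> 0" unfolding v_def using n by auto
    have lamR: "R \<noteq> 0 \<Longrightarrow> lam v = H R (- v)"
      using lam_pure[OF v ece, of R] nuprod unfolding v_def by simp
    have lam0: "lam v = 1" "\<And>a. H a (- v) = 1" if "R = 0"
    proof -
      have "v = e * cj e" using nuprod that unfolding v_def nm_def by simp
      note l = lam_pure0[OF ece this v(2)]
      show "lam v = 1" by (rule l)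
      show "H a (- v) = 1" for a unfolding l(2) by (rule E.hs_square) simp
    qed
    \<comment> \<open>This makes c1*c2*n3 - c3*R a square, hence (-c3*R, c1*c2*n3) = 1
      generically.\<close>
    have pluck: "c3 * R - c1 * c2 * n3 = - ((c2 * (d1 - 1) + c1 * (cj d2 - 1))^2)"
    proof -
      have "c1 * c2 * (d3 + cj d3) = c1^2 * (w * (c2 * cj c2)) + c2^2 * (w * (c1 * cj c1)) + c1 * c2 * (d1 * d2 + cj d1 * cj d2)"
        unfolding d3 by (simp add: cj_add cj_mult algebra_simps power2_eq_square)
      then have "c1 * c2 * (d3 + cj d3) = c1^2 * (d2 * cj d2 - 1) + c2^2 * (d1 * cj d1 - 1) + c1 * c2 * (d1 * d2 + cj d1 * cj d2)"
        unfolding q1 q2 .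
      moreover have "c1 * c2 * n3 = 2 * c1 * c2 - c1 * c2 * (d3 + cj d3)" unfolding ne by (simp add: algebra_simps)
      ultimately have cc: "c1 * c2 * n3 = 2 * c1 * c2 - (c1^2 * (d2 * cj d2 - 1) + c2^2 * (d1 * cj d1 - 1) + c1 * c2 * (d1 * d2 + cj d1 * cj d2))"
        by simp
      show ?thesis unfolding cc unfolding R_def c3 ne(1,2) by (simp add: algebra_simps power2_eq_square)
    qed
    define x1 x2 x3 where "x1 = qx x" and "x2 = qx y" and "x3 = qx z"
    have xn: "x1 \<noteq> 0" "x2 \<noteq> 0" "x3 \<noteq> 0"
      unfolding x1_def x2_def x3_def using qx_nonzero qn1_nonzero x y z by auto
    define m :: 'a where "m = - 1"
    have m: "m \<noteq> 0" "m \<in> F" unfolding m_def by auto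
    have neg: "- b = m * b" for b unfolding m_def by simp
    have self: "H x1 x1 = H m x1" "H x2 x2 = H m x2" "H x3 x3 = H m x3" using H_self xn m_def by simp_all
    note ex = H_mult H_mult_left self H_F mult_ac neg n m xn E.hs_sym E.hs_left_commute_self
    have "lam v * (H x1 (- n1) * H x2 (- n2) * H x3 (- n3)) * (H x1 x2 * H (- (x1 * x2)) x3) = 1"
    proof (cases "c1 = 0")
      case c1: True
      then have f1: "fst x = 0" using xe by simp
      have t1: "H x1 b = H (- n1) b" "H b x1 = H b (- n1)" if "b \<noteq> 0" for b
        using H_torus[OF x f1 4(1) that] unfolding x1_def n1_def by auto
      have x3e: "x3 = x1 * x2" using qx_F_left[OF f1 nz(1), of y] f1 unfolding x3_def x1_def x2_def z_def by (simp add: qx_def)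
      show ?thesis
      proof (cases "c2 = 0")
        case True
        then have f2: "fst y = 0" using ye by simp
        have t2: "H x2 b = H (- n2) b" "H b x2 = H b (- n2)" if "b \<noteq> 0" for b
          using H_torus[OF y f2 4(2) that] unfolding x2_def n2_def by auto
        have "R = 0" unfolding R_def using c1 True by simp
        then have "lam v = 1" by (rule lam0)
        moreover have F1: "H x1 b = 1" and F2: "H x2 b = 1" if "b \<in> F" "b \<noteq> 0" for b
          using t1(1)[OF that(2)] t2(1)[OF that(2)] that n H_F by simp_all
        moreover have "H x1 x2 = 1" using t1(1)[of x2] t2(2)[of "- n1"] xn n H_F by simp
        moreover have "H x3 (- n3) = 1" unfolding x3e using F1[of "- n3"] F2[of "- n3"] H_mult_left[of "- n3" x1 x2] xn n by simp
        moreover have "H (- (x1 * x2)) x3 = 1" unfolding x3e by (rule E.hs_uminus_self)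
        ultimately show ?thesis using n by simp
      next
        case False
        then have x2c: "x2 = c2" unfolding x2_def qx_def ye by simp
        have Re: "R = x2 * n1" unfolding R_def c1 x2c by simp
        then have lv: "lam v = H (x2 * n1) (- (n1 * n2 * n3))" using lamR xn n unfolding v_def by simp
        have "H x1 x2 = H (m * n1) x2" using t1(1)[of x2] xn neg by simp
        moreover have "H x1 b = 1" "H b x1 = 1" if "b \<in> F" "b \<noteq> 0" for b
          using t1[OF that(2)] that n H_F by simp_all
        ultimately show ?thesis unfolding lv x3e by (simp add: ex)
      qed
    next
      case c1: False
      then have x1c: "x1 = c1" unfolding x1_def qx_def xe by simp
      show ?thesis
      proof (cases "c2 = 0")
        case c2: True
        then have f2: "fst y = 0" using ye by simp
        have t2: "H x2 b = H (- n2) b" "H b x2 = H b (- n2)" if "b \<noteq> 0" for b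
          using H_torus[OF y f2 4(2) that] unfolding x2_def n2_def by auto
        have x2d: "x2 = d2" unfolding x2_def qx_def ye c2 by simp
        have "d2 * cj d2 = 1" using q2 c2 by simp
        then have cd: "cj d2 = inverse x2" unfolding x2d by (metis inverse_unique)
        have c3x: "c3 = x1 * inverse x2" unfolding c3 c2 x1c cd by simp
        then have "c3 \<noteq> 0" using xn by simp
        then have x3e: "x3 = x1 * inverse x2" unfolding x3_def qx_def c3_def[symmetric] c3x by simp
        have inv: "H b (inverse x2) = H b x2" "H (inverse x2) b = H x2 b" if "b \<noteq> 0" for b
          using E.hs_inverse[of b x2] E.hs_sym that xn by auto
        have Re: "R = x1 * n2" unfolding R_def c2 x1c by simp
        then have lv: "lam v = H (x1 * n2) (- (n1 * n2 * n3))" using lamR xn n unfolding v_def by simp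
        have "H x2 x1 = H (m * n2) x1" using t2(1)[of x1] xn neg by simp
        moreover have "H x2 b = 1" "H b x2 = 1" if "b \<in> F" "b \<noteq> 0" for b
          using t2[OF that(2)] that n H_F by simp_all
        ultimately show ?thesis unfolding lv x3e by (simp add: ex inv)
      next
        case c2: False
        then have x2c: "x2 = c2" unfolding x2_def qx_def ye by simp
        show ?thesis
        proof (cases "c3 = 0")
          case c3z: True
          have f3: "fst z = 0" using c3z c3_def by simp
          have t3: "H x3 b = H (- n3) b" "H b x3 = H b (- n3)" if "b \<noteq> 0" for b
            using H_torus[OF z f3 _ that] 4(3) z_def unfolding x3_def n3_def by auto
          define s where "s = c2 * (d1 - 1) + c1 * (cj d2 - 1)"
          \<comment> \<open>With c3 = 0 the product x1*x2*n3 is a square, so x2 may be replaced by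
            x1*n3 in every symbol.\<close>
          have s2: "x1 * x2 * n3 = s^2" using pluck c3z unfolding s_def x1c x2c by simp
          have s0: "s \<noteq> 0" using s2 xn n by auto
          have "H b x1 * H b x2 * H b n3 = 1" if "b \<noteq> 0" for b
          proof -
            have "H b (x1 * x2 * n3) = 1" unfolding s2 by (rule E.hs_square) simp
            then show ?thesis using H_mult[of b "x1 * x2" n3] H_mult[of b x1 x2] that xn n by simp
          qed
          then have t2: "H b x2 = H b x1 * H b n3" if "b \<noteq> 0" for b
            using that E.hs_cases[of b x1] E.hs_cases[of b x2] E.hs_cases[of b n3] by fastforce
          have lv: "lam v = H x1 (- v)"
          proof (cases "R = 0")
            case True
            then show ?thesis using lam0 by simp
          next
            case False
            have "H (c1 * n2) (c2 * n1) = H (- 1) R * H (c1 * n2) R * H (c2 * n1) R"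
              by (rule E.hs_sum) (use c1 c2 n False R_def in auto)
            then have "H (x1 * n2) (x2 * n1) * (H (- 1) R * H (x1 * n2) R * H (x2 * n1) R) = 1"
              unfolding x1c x2c by (simp add: mult_ac)
            moreover have "H R x2 = H R x1 * H R n3" using t2[OF False] .
            ultimately have "H x1 (m * (n1 * n2 * n3)) * H R (m * (n1 * n2 * n3)) = 1"
              using t2[of x1] t2[of n1] t2[of n2] t2[of n3] t2[of m] False m_def[symmetric] by (simp add: ex)
            then have "H R (- v) = H x1 (- v)"
              unfolding v_def neg using E.hs_cases[of R "m * (n1 * n2 * n3)"] E.hs_cases[of x1 "m * (n1 * n2 * n3)"] by auto
            then show ?thesis using lamR[OF False] by simp
          qed
          have "H x3 (m * n3) = 1" using t3(1)[of "m * n3"] n m H_F[of "m * n3" "m * n3"] neg by auto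
          moreover have "H (m * (x1 * x2)) x3 = H (m * (x1 * x2)) (m * n3)" using t3(2)[of "m * (x1 * x2)"] m xn neg by simp
          ultimately show ?thesis unfolding lv unfolding v_def neg
            using t2[of x1] t2[of n1] t2[of n2] t2[of n3] t2[of m] by (simp add: ex)
        next
          case c3z: False
          then have x3c: "x3 = c3" unfolding x3_def qx_def c3_def by simp
          show ?thesis
          proof (cases "R = 0")
            case True
            \<comment> \<open>With R = 0 the coordinate x2 is -x1*n2/n1, and -n1*n2*n3 is a square
              of E.\<close>
            have "c2 * n1 = - (c1 * n2)" using True unfolding R_def by (simp add: eq_neg_iff_add_eq_0 add.commute)
            then have x2e: "x2 = m * x1 * n2 * inverse n1" unfolding x2c x1c neg using n by (simp add: field_simps)
            have inv: "H b (inverse n1) = H b n1" "H (inverse n1) b = H n1 b" if "b \<noteq> 0" for b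
              using E.hs_inverse[of b n1] E.hs_sym that n by auto
            have "H x3 (m * (n1 * n2 * n3)) = 1" using lam0(2)[OF True, of x3] unfolding v_def neg .
            then have x3r: "H x3 n3 = H x3 m * H x3 n1 * H x3 n2"
              using xn n m E.hs_cases[of x3 n3] E.hs_cases[of x3 m] E.hs_cases[of x3 n1] E.hs_cases[of x3 n2]
              by (auto simp: H_mult)
            show ?thesis unfolding lam0(1)[OF True] x2e using x3r by (simp add: ex inv)
          next
            case False
            define s where "s = c2 * (d1 - 1) + c1 * (cj d2 - 1)"
            have "H (- (x3 * R)) (x1 * x2 * n3) = 1"
            proof (rule E.hs_solution)
              show "- (x3 * R) * 1^2 + x1 * x2 * n3 * 1^2 = s^2"
                using pluck unfolding s_def x1c x2c x3c by (simp add: algebra_simps)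
            qed auto
            moreover have "H (c1 * n2) (c2 * n1) = H (- 1) R * H (c1 * n2) R * H (c2 * n1) R"
              by (rule E.hs_sum) (use c1 c2 n False R_def in auto)
            then have "H (x1 * n2) (x2 * n1) * (H (- 1) R * H (x1 * n2) R * H (x2 * n1) R) = 1"
              unfolding x1c x2c by (simp add: mult_ac)
            ultimately have rel: "H (- (x3 * R)) (x1 * x2 * n3) *
              (H (x1 * n2) (x2 * n1) * (H m R * H (x1 * n2) R * H (x2 * n1) R)) = 1" unfolding m_def by simp
            have "lam v * (H x1 (- n1) * H x2 (- n2) * H x3 (- n3)) * (H x1 x2 * H (- (x1 * x2)) x3) =
              H (- (x3 * R)) (x1 * x2 * n3) * (H (x1 * n2) (x2 * n1) * (H m R * H (x1 * n2) R * H (x2 * n1) R))"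
              unfolding lamR[OF False] unfolding v_def using False by (simp add: ex)
            then show ?thesis using rel by simp
          qed
        qed
      qed
    qed
    moreover have "lam v = lam n1 * lam n2 * lam n3" unfolding v_def using lam_mult3 n by simp
    ultimately have "sg z * (sg x * sg y * bt x y) = 1"
      using 4 unfolding sg_def bt_def z_def[symmetric] x1_def x2_def x3_def n1_def n2_def n3_def x
      by (simp add: mult_ac)
    then show ?thesis unfolding z_def[symmetric]
    proof (rule sign_eqI)
      have "sg x * sg y * bt x y * (sg x * sg y * bt x y) = (sg x * sg x) * (sg y * sg y) * (bt x y * bt x y)"
        by (simp only: mult_ac)
      then show "sg x * sg y * bt x y * (sg x * sg y * bt x y) = 1" unfolding sg_sign bt_sign by simp
    qed
  qed
qed

end

section \<open>Conjugation and commutators\<close>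

context quadratic_extension
begin

lemma H_F_cj: "a \<in> F \<Longrightarrow> a \<noteq> 0 \<Longrightarrow> x \<noteq> 0 \<Longrightarrow> H a (cj x) = H a x"
  using H_norm[of a "cj x"] H_norm[of a x] by simp

text \<open>Apply the sum rule to z + cj z. This trace lies in F, so its symbols with z and with cj
  z agree and cancel.\<close>

lemma H_cj_self: assumes "z \<noteq> 0" shows "H z (cj z) = 1"
proof (cases "z + cj z = 0")
  case True
  then have "cj z = - z" by (simp add: add_eq_0_iff)
  then show ?thesis by (simp add: E.hs_uminus_self)
next
  case False
  have "H z (cj z) = H (- 1) (z + cj z) * H z (z + cj z) * H (cj z) (z + cj z)"
    by (rule E.hs_sum) (use assms False in auto)
  also have "H (cj z) (z + cj z) = H z (z + cj z)"
    using H_F_cj[of "z + cj z" z] assms False E.hs_sym by (metis trace_F)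
  also have "H (- 1) (z + cj z) = 1" by (rule H_F) auto
  finally show ?thesis by simp
qed

lemma H_nm_commute: "x \<noteq> 0 \<Longrightarrow> y \<noteq> 0 \<Longrightarrow> H (nm x) y = H (nm y) x"
  using H_norm[of "nm x" y] H_norm[of "nm y" x] hs_sym by simp

end

context quaternion_algebra
begin

lemma bt_one: "p \<noteq> (0, 0) \<Longrightarrow> bt (0, 1) p = 1" "p \<noteq> (0, 0) \<Longrightarrow> bt p (0, 1) = 1"
  using qx_nonzero[of p] H_square_right[of "qn p" "qx p"] E.hs_uminus_self(2)[of "qx p"]
  unfolding bt_def qm_one qn_one by (simp_all add: qx_def[of "(0, 1)"])

text \<open>The graph of \<open>sg\<close> is stable under conjugation in the cover, with y =
  g*x*g^-1 written without inverses. As \<open>nu\<close> is invariant, the symbols collapse to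
  (X*Y*D, -n*A*T). Its two entries add up to a square, or one of them is a square itself.\<close>

lemma sg_conj:
  assumes x: "qn x = 1" and g: "g \<noteq> (0, 0)" and y: "qm y g = qm g x"
  shows "sg y * bt y g = sg x * bt g x"
proof (cases "x = (0, 1)")
  case True
  then have "y = (0, 1)" using y qm_right_cancel[OF g, of y "(0, 1)"] by simp
  then show ?thesis using True bt_one[OF g] by simp
next
  case False
  have n0: "qn g \<noteq> 0" using g by simp
  have qy: "qn y = 1" using qn_mult[of y g] qn_mult[of g x] y x n0 by simp
  have y1: "y \<noteq> (0, 1)"
  proof
    assume "y = (0, 1)"
    then have "qm g x = qm g (0, 1)" using y by simp
    then have "qm (qm (qi g) g) x = qm (qm (qi g) g) (0, 1)" unfolding qm_assoc by simp
    then show False using qm_inverse(1)[OF g] False by simp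
  qed
  obtain c d where xe: "x = (c, d)" by (cases x)
  obtain a e where ge: "g = (a, e)" by (cases g)
  obtain c' d' where ye: "y = (c', d')" by (cases y)
  have nu: "nu y = nu x"
  proof -
    have "qm (c', d' - 1) g = qm g (c, d - 1)"
      using y unfolding xe ye ge qm_def by (simp add: cj_diff algebra_simps)
    then have "nu y * qn g = qn g * nu x" unfolding nu_def xe ye fst_conv snd_conv qn_mult[symmetric] by simp
    then show ?thesis using n0 by simp
  qed
  define n where "n = nu x"
  have n: "n \<noteq> 0" "n \<in> F" unfolding n_def using nu_nonzero False by auto
  define D where "D = qn g"
  have D: "D \<noteq> 0" "D \<in> F" unfolding D_def using n0 by auto
  define A X Y T where "A = qx g" and "X = qx x" and "Y = qx y" and "T = qx (qm g x)"
  have nz: "A \<noteq> 0" "X \<noteq> 0" "Y \<noteq> 0" "T \<noteq> 0"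
    unfolding A_def X_def Y_def T_def using qx_nonzero qm_nonzero g qn1_nonzero[OF x] qn1_nonzero[OF qy] by auto
  have key: "H (X * Y * D) (- n * (A * T)) = 1"
  proof (cases "fst x = 0 \<or> fst y = 0")
    case True
    have "\<exists>s. - n * (A * T) = s^2"
    proof (cases "fst y = 0")
      case True
      have "T = snd y * A" unfolding T_def A_def y[symmetric] using qx_F_left[OF True] qn1_nonzero[OF qy] by simp
      then have "- n * (A * T) = (- nu y * snd y) * A^2" unfolding n_def nu by (simp add: power2_eq_square)
      also have "\<dots> = ((1 - snd y) * A)^2" unfolding torus_square[OF qy True] by (simp add: power_mult_distrib)
      finally show ?thesis by blast
    next
      case False
      then have c: "c = 0" using True xe by simp
      then have cd: "d * cj d = 1" using qn1_eq[of c d] x xe by simp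
      then have d0: "d \<noteq> 0" by auto
      have a: "a \<noteq> 0"
      proof
        assume "a = 0"
        then have "qm x g = qm g x" unfolding xe ge qm_def c by (simp add: mult.commute)
        then have "y = x" using qm_right_cancel[OF g] y by metis
        then show False using False xe c by simp
      qed
      have gx: "fst (qm g x) = a * cj d" unfolding ge xe qm_def c by simp
      have T: "T = a * cj d" "A = a" unfolding T_def A_def qx_def gx using a d0 ge by auto
      have sq: "- n * d = (1 - d)^2" using torus_square[OF x] c unfolding n_def xe by simp
      have "- n * (A * T) = (- n * d) * (a * cj d)^2"
      proof -
        have "(- n * d) * (a * cj d)^2 = - n * (a * (a * cj d)) * (d * cj d)" by (simp add: power2_eq_square)
        also have "\<dots> = - n * (A * T)" unfolding T cd by simp
        finally show ?thesis by (rule sym)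
      qed
      also have "\<dots> = ((1 - d) * (a * cj d))^2" unfolding sq by (simp add: power_mult_distrib)
      finally show ?thesis by blast
    qed
    then obtain s where s: "- n * (A * T) = s^2" by blast
    show ?thesis unfolding s by (rule E.hs_square) simp
  next
    case False
    then have c: "c \<noteq> 0" "c' \<noteq> 0" "X = c" "Y = c'" unfolding X_def Y_def qx_def xe ye by auto
    define b where "b = a * cj d + e * c"
    have gx: "qm g x = (b, w * a * cj c + e * d)" unfolding b_def ge xe qm_def by simp
    \<comment> \<open>Multiplying y*g = g*x on the right by the conjugate (-a, cj e) of g isolates
      the lower left entry of D*y.\<close>
    have cc: "c * c' * D = (a - b)^2 + n * (a * b)"
    proof -
      have "qm (qm y g) (- a, cj e) = (b * e - (w * a * cj c + e * d) * a, w * b * cj (- a) + (w * a * cj c + e * d) * cj e)"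
        unfolding y gx unfolding qm_def by simp
      moreover have "qm (qm y g) (- a, cj e) = qm y (0, D)"
        unfolding qm_assoc D_def qn_def ge nm_def by (simp add: qm_def[of "(a, e)"] cj_uminus mult_ac)
      moreover have "qm y (0, D) = (c' * D, d' * D)" unfolding qm_def ye using D by simp
      ultimately have "c' * D = b * e - (w * a * cj c + e * d) * a" by simp
      then have "c * c' * D = c * (b * e - (w * a * cj c + e * d) * a)" by (simp add: mult.assoc)
      also have "\<dots> = (e * c) * b - a * a * (w * (c * cj c)) - (e * c) * d * a" by (simp add: algebra_simps)
      also have "w * (c * cj c) = d * cj d - 1" using qn1_eq[of c d] x xe by simp
      also have "e * c = b - a * cj d" unfolding b_def by simp
      finally have 1: "c * c' * D = (b - a * cj d) * b - a * a * (d * cj d - 1) - (b - a * cj d) * d * a" .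
      have ne: "n = 2 - d - cj d" unfolding n_def using nu_eq[OF x] xe by simp
      show ?thesis unfolding 1 ne by (simp add: algebra_simps power2_eq_square)
    qed
    show ?thesis
    proof (cases "a = 0 \<or> b = 0")
      case True
      then have "\<exists>s. X * Y * D = s^2" unfolding c cc by (auto intro: exI[of _ b] exI[of _ a])
      then obtain s where s: "X * Y * D = s^2" by blast
      have "H (- n * (A * T)) (s^2) = 1" by (rule E.hs_square) simp
      then show ?thesis unfolding s using E.hs_sym by metis
    next
      case False
      then have AT: "A = a" "T = b" unfolding A_def T_def gx unfolding qx_def ge by auto
      show ?thesis
      proof (rule E.hs_solution)
        show "X * Y * D * 1^2 + - n * (A * T) * 1^2 = (a - b)^2" unfolding c cc AT by simp
      qed auto
    qed
  qed
  define m :: 'a where "m = - 1"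
  have m: "m \<noteq> 0" "m \<in> F" unfolding m_def by auto
  have neg: "- b = m * b" for b unfolding m_def by simp
  have self: "H A A = H m A" "H X X = H m X" "H Y Y = H m Y" "H T T = H m T" using H_self nz m_def by simp_all
  note ex = H_mult H_mult_left self H_F mult_ac neg n m nz D E.hs_sym E.hs_left_commute_self
  have 1: "sg y * bt y g = lam n * H Y (- n) * (H Y A * H (- (Y * A)) T)"
    unfolding sg_def bt_def y qy using y1 by (simp add: nu n_def A_def Y_def T_def)
  have 2: "sg x * bt g x = lam n * H X (- n) * (H A X * H (- (A * X)) T * H D (A * T))"
    unfolding sg_def bt_def using False by (simp add: n_def A_def X_def T_def D_def)
  have 3: "H Y (- n) * (H Y A * H (- (Y * A)) T) * (H X (- n) * (H A X * H (- (A * X)) T * H D (A * T))) = 1"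
    using key by (simp add: ex)
  have "sg y * bt y g * (sg x * bt g x) = (lam n * lam n) *
    (H Y (- n) * (H Y A * H (- (Y * A)) T) * (H X (- n) * (H A X * H (- (A * X)) T * H D (A * T))))"
    unfolding 1 2 by (simp only: mult_ac)
  also have "\<dots> = 1" unfolding 3 lam_sign by simp
  finally show ?thesis
  proof (rule sign_eqI)
    have "sg x * bt g x * (sg x * bt g x) = (sg x * sg x) * (bt g x * bt g x)" by (simp only: mult_ac)
    then show "sg x * bt g x * (sg x * bt g x) = 1" unfolding sg_sign bt_sign by simp
  qed
qed

text \<open>The computation for \<open>comm_torus\<close> after descent to F: a, n, m are norms from
  E and D is the reduced norm. The sum rule for D + w*n = m does the work, and the minus sign in
  \<open>lam\<close> is compensated by (\<open>d0\<close>, w) = -1.\<close>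

lemma commutator_symbols:
  assumes F: "a \<in> F" "n \<in> F" "m \<in> F" "D \<in> F" and nz: "a \<noteq> 0" "n \<noteq> 0" "m \<noteq> 0" "D \<noteq> 0"
    and d: "hs d0 a = 1" "hs d0 n = 1" "hs d0 m = 1" and sum: "D + w * n = m"
  shows "hs a n * hs D a * hs a (- (d0 * (a * n * m))) * lam (w * n * d0 * (a * D)) *
    hs (- (w * n * d0 * (a * D))) (- (d0 * (a * n * m))) = 1"
proof -
  define i :: 'a where "i = - 1"
  have i: "i \<in> F" "i \<noteq> 0" unfolding i_def by auto
  have neg: "- b = i * b" for b unfolding i_def by simp
  have self: "hs b b = hs i b" if "b \<in> {a, n, m, D, w, d0}" for b
    unfolding i_def using hs_self[of b] that F nz by auto
  have self': "hs a a = hs i a" "hs n n = hs i n" "hs m m = hs i m" "hs D D = hs i D" "hs w w = hs i w" "hs d0 d0 = hs i d0"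
    by (rule self, simp)+
  have ii: "hs w (i * b) = hs w i * hs w b" "hs d0 (i * b) = hs d0 i * hs d0 b" if "b \<in> F" "b \<noteq> 0" for b
    using hs_mult i that by auto
  note ex = hs_mult hs_mult_left self' mult_ac neg i F nz hs_sym hs_left_commute_self
  have "hs D (w * n) = hs (- 1) m * hs D m * hs (w * n) m"
    by (rule hs_sum) (use F nz sum in auto)
  then have "hs D (w * n) * (hs (- 1) m * hs D m * hs (w * n) m) = 1" by (simp add: mult_ac hs_left_commute_self)
  then have r: "hs D (w * n) * (hs i m * hs D m * hs (w * n) m) = 1" unfolding i_def .
  have r': "hs D w * hs D n * (hs i m * hs D m * (hs w m * hs n m)) = 1"
    using r F nz i by (simp add: hs_mult hs_mult_left mult_ac)
  have dw: "hs d0 w = - 1" "hs w d0 = - 1" using hs_d0_w hs_sym by auto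
  have d': "hs a d0 = 1" "hs n d0 = 1" "hs m d0 = 1" using d hs_sym by auto
  show ?thesis unfolding lam_def \<mu>_def
    using r' by (simp add: ex dw d d')
qed


text \<open>q is the commutator of z and h, and the claim is that the commutator of their lifts lies
  in the graph of \<open>sg\<close>. If h lies in E or z in F, the two commute and q = 1. Otherwise
  (z, cj z) = 1 leaves only symbols with an entry in F, and the projection formula moves them to
  F.\<close>

lemma comm_torus:
  assumes z: "z \<noteq> 0" and h: "h \<noteq> (0, 0)"
  shows "\<exists>q. qn q = 1 \<and> qm q (qm h (0, z)) = qm (0, z) h \<and>
    sg q * bt q (qm h (0, z)) * bt h (0, z) = bt (0, z) h"
proof -
  obtain c e where he: "h = (c, e)" by (cases h)
  define Z :: "'a \<times> 'a" where "Z = (0, z)"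
  define u v where "u = qm Z h" and "v = qm h Z"
  have ue: "u = (z * c, z * e)" and ve: "v = (c * cj z, e * z)" unfolding u_def v_def Z_def he qm_def by auto
  have Z0: "Z \<noteq> (0, 0)" unfolding Z_def using z by simp
  have uv0: "u \<noteq> (0, 0)" "v \<noteq> (0, 0)" unfolding u_def v_def using qm_nonzero Z0 h by auto
  define a where "a = nm z"
  define D where "D = qn h"
  have aD: "a \<in> F" "D \<in> F" "a \<noteq> 0" "D \<noteq> 0" unfolding a_def D_def using z h by auto
  have qZ: "qn Z = a" "qx Z = z" unfolding a_def Z_def qn_def qx_def by auto
  define x where "x = qx h"
  have x0: "x \<noteq> 0" unfolding x_def using qx_nonzero h by simp
  have qu: "qx u = z * x" unfolding u_def x_def using qx_F_left[of Z h] Z0 unfolding Z_def by simp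
  define i :: 'a where "i = - 1"
  have i: "i \<in> F" "i \<noteq> 0" unfolding i_def by auto
  have neg: "- b = i * b" for b unfolding i_def by simp
  have cz: "cj z \<noteq> 0" using z by simp
  have zz: "H z (cj z) = 1" "H (cj z) z = 1" using H_cj_self[OF z] E.hs_sym by metis+
  have Fcj: "H b (cj z) = H b z" "H (cj z) b = H z b" if "b \<in> F" "b \<noteq> 0" for b
    using H_F_cj[OF that z] E.hs_sym by metis+
  have az: "H a b = H z b * H (cj z) b" if "b \<noteq> 0" for b
    unfolding a_def nm_def using H_mult_left[of b z "cj z"] that z by simp
  have btZh: "bt Z h = H z x * H a x"
  proof -
    have "bt Z h = H z x * H (- (z * x)) (z * x) * H a (z * (z * x))"
      unfolding bt_def qZ u_def[symmetric] qu x_def[symmetric] by simp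
    also have "H a (z * (z * x)) = H a x" using H_mult z x0 aD by (simp add: E.hs_left_commute_self)
    finally show ?thesis using E.hs_uminus_self by simp
  qed
  have bthZ: "bt h Z = H x z * H (- (x * z)) (qx v) * H D (x * qx v)"
    unfolding bt_def qZ v_def[symmetric] x_def D_def by simp
  have same: ?thesis if uv: "u = v" and b: "bt h Z = bt Z h"
    using that bt_one(1)[OF uv0(2)] unfolding u_def v_def Z_def
    by (intro exI[of _ "(0, 1)"]) (simp add: sg_def)
  show ?thesis
  proof (cases "c = 0")
    case c: True
    then have xe: "x = e" unfolding x_def qx_def he by simp
    have qv: "qx v = x * z" unfolding ve qx_def c xe by simp
    have "D = nm x" unfolding D_def qn_def he c xe by simp
    then have "H D z = H a x" unfolding a_def using H_nm_commute x0 z by simp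
    moreover have "bt h Z = H x z * H D z"
      unfolding bthZ qv using E.hs_uminus_self H_mult[of D x "x * z"] H_mult[of D x z] aD x0 z by (simp add: E.hs_left_commute_self)
    ultimately have "bt h Z = bt Z h" unfolding btZh using E.hs_sym[of x z] by simp
    moreover have "u = v" unfolding ue ve c by (simp add: mult.commute)
    ultimately show ?thesis using same by blast
  next
    case c: False
    then have xc: "x = c" unfolding x_def qx_def he by simp
    have qv: "qx v = c * cj z" unfolding ve qx_def using c z by simp
    show ?thesis
    proof (cases "z \<in> F")
      case zF: True
      then have cjz: "cj z = z" by simp
      have "bt h Z = H c z * H D z" unfolding bthZ qv cjz xc
        using E.hs_uminus_self H_mult[of D c "c * z"] H_mult[of D c z] aD c z by (simp add: E.hs_left_commute_self)
      moreover have "H D z = 1" using H_F aD zF by simp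
      moreover have "H a c = 1" unfolding a_def nm_of_F[OF zF] using E.hs_square[of z c] E.hs_sym by simp
      ultimately have "bt h Z = bt Z h" unfolding btZh xc using E.hs_sym[of c z] by simp
      moreover have "u = v" unfolding ue ve cjz by (simp add: mult.commute)
      ultimately show ?thesis using same by blast
    next
      case False
      \<comment> \<open>Writing z - cj z = t*\<delta> gives it the norm -\<open>d0\<close>*t^2; as t
        lies in F, its square then drops out of the symbols of F.\<close>
      define t where "t = (z - cj z) / \<delta>"
      have tF: "t \<in> F" by (rule cj_fixed) (simp add: t_def cj_divide cj_diff divide_simps)
      have zt: "z - cj z = t * \<delta>" unfolding t_def by simp
      have t0: "t \<noteq> 0"
      proof
        assume "t = 0"
        then have "cj z = z" using zt by simp
        then show False using False cj_fixed by blast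
      qed
      have nmzt: "nm (z - cj z) = - (d0 * t^2)" unfolding zt nm_mult nm_\<delta> nm_of_F[OF tF] by simp
      define n where "n = nm c"
      have n: "n \<in> F" "n \<noteq> 0" unfolding n_def using c by auto
      have Hac: "H a c = hs a n" unfolding n_def using H_norm aD c by simp
      have HDz: "H D z = hs D a" unfolding a_def using H_norm aD z by simp
      have self: "H c c = H i c" "H z z = H i z" unfolding i_def using H_self c z by auto
      have ibz: "bt h Z = H c z * (H i z * H a c) * H D z"
        unfolding bthZ qv xc using c z cz aD i
        by (simp add: neg H_mult H_mult_left self zz Fcj az mult_ac E.hs_sym[of c z] E.hs_sym[of c "cj z"] E.hs_left_commute_self)
      have both: "bt Z h * bt h Z = H i z * H D z"
        unfolding btZh xc ibz using E.hs_sym[of c z] by (simp add: mult_ac E.hs_left_commute_self)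
      define q where "q = qm u (qi v)"
      have qv': "qm q v = u" unfolding q_def qm_assoc qm_inverse(1)[OF uv0(2)] by simp
      have nv: "qn v = D * a" "qn u = D * a" unfolding v_def u_def qn_mult qZ D_def by auto
      have q1: "qn q = 1" using qn_mult[of q v] nv aD unfolding qv' by simp
      define k where "k = D * a"
      have k: "k \<noteq> 0" "k \<in> F" "cj k = k" unfolding k_def using aD by auto
      have qq: "q = (z * c * e * (z - cj z) / k, (a * nm e - w * n * z^2) / k)"
      proof -
        have "qi v = (- (c * cj z) / k, cj (e * z) / k)" unfolding qi_def nv k_def by (simp add: ve)
        then show ?thesis unfolding q_def qm_def ue a_def n_def nm_def using k(1,3)
          by (simp add: cj_divide cj_mult cj_uminus field_simps power2_eq_square)
      qed
      have q_ne: "q \<noteq> (0, 1)"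
      proof
        assume "q = (0, 1)"
        then have "u = v" using qv' by simp
        then have "z * c = c * cj z" unfolding ue ve by simp
        then have "z = cj z" using c by simp
        then show False using False cj_fixed by metis
      qed
      \<comment> \<open>(q - 1)*v = u - v has lower right entry 0, so the norm of q - 1 is found
        without expanding q.\<close>
      have nuq: "nu q * k = w * n * d0 * t^2"
      proof -
        have "qm (fst q, snd q - 1) v = (c * (z - cj z), 0)"
          using qv' unfolding qm_def ue ve by (simp add: prod_eq_iff algebra_simps)
        then have "nu q * qn v = qn (c * (z - cj z), 0)" unfolding nu_def qn_mult[symmetric] by simp
        also have "\<dots> = w * n * d0 * t^2" unfolding qn_def n_def by (simp add: nm_mult nmzt)
        finally show ?thesis unfolding nv k_def .
      qed
      then have nuq': "nu q = w * n * d0 * (a * D) * (t / k)^2"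
        using k(1) aD unfolding k_def by (simp add: field_simps power2_eq_square)
      have tk: "t / k \<in> F" "t / k \<noteq> 0" using tF t0 k by auto
      have hnu: "hs (- nu q) b = hs (- (w * n * d0 * (a * D))) b" if "b \<in> F" "b \<noteq> 0" for b
      proof -
        have "- nu q = - (w * n * d0 * (a * D)) * (t / k)^2" unfolding nuq' by simp
        then have "hs b (- nu q) = hs b (- (w * n * d0 * (a * D)))"
          using hs_mult_square[of b "- (w * n * d0 * (a * D))" "t / k"] that tk n aD by simp
        then show ?thesis using hs_sym by metis
      qed
      have lnu: "lam (nu q) = lam (w * n * d0 * (a * D))"
      proof -
        have "- nu q = - (w * n * d0 * (a * D)) * (t / k)^2" unfolding nuq' by simp
        then show ?thesis unfolding lam_def
          using hs_mult_square[of \<mu> "- (w * n * d0 * (a * D))" "t / k"] tk n aD by simp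
      qed
      have d: "hs d0 a = 1" "hs d0 n = 1" unfolding a_def n_def using hs_d0_nm z c by auto
      have btq: "bt q v = H (qx q) (c * cj z) * H (- (qx q * (c * cj z))) (z * c)"
        unfolding bt_def qv' qu xc qv q1 by simp
      have "sg q * bt q v * (bt Z h * bt h Z) = 1"
      proof (cases "e = 0")
        case e: True
        have D': "D = - (w * n)" unfolding D_def qn_def he n_def e by simp
        have f0: "fst q = 0" unfolding qq e by simp
        have "snd q = (- w * n * z^2) / (- (w * n) * a)" unfolding qq k_def D' e by simp
        also have "\<dots> = z / cj z" unfolding a_def nm_def using n z by (simp add: field_simps power2_eq_square)
        finally have X: "qx q = z / cj z" unfolding qx_def using f0 by simp
        have X0: "z / cj z \<noteq> 0" using z by simp
        have XH: "H (z / cj z) b = H a b" if "b \<noteq> 0" for b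
        proof -
          have "H b (z / cj z) = H b z * H b (cj z)"
            using E.hs_inverse[of b "cj z"] H_mult[of b z "inverse (cj z)"] that z by (simp add: divide_inverse)
          then show ?thesis using az[OF that] E.hs_sym by metis
        qed
        have "bt q v = H (z / cj z) (c * cj z) * H (- (z * c)) (z * c)"
          unfolding btq X using z by (simp add: mult_ac)
        also have "\<dots> = H a c * H i z"
          using XH[of "c * cj z"] c z aD E.hs_uminus_self H_mult[of a c "cj z"] Fcj[of a] az[of z] zz self by simp
        finally have b: "bt q v = H a c * H i z" .
        have s: "sg q = lam (nu q)"
          unfolding sg_def using q_ne H_torus(1)[OF q1 f0 q_ne, of "- nu q"] nu_nonzero[OF q_ne] H_F by simp
        have "w * n * d0 * (a * D) = - (d0 * a) * (w * n)^2" unfolding D' by (simp add: power2_eq_square)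
        then have "lam (nu q) = - hs \<mu> (d0 * a * (w * n)^2)" unfolding lnu unfolding lam_def by simp
        also have "\<dots> = - hs \<mu> (d0 * a)" using hs_mult_square[of \<mu> "d0 * a" "w * n"] aD n by simp
        also have "\<dots> = hs i a * hs w a"
          using hs_\<mu>[of "d0 * a"] aD d hs_d0_w hs_sym[of w d0] hs_self[of d0] i
          unfolding i_def[symmetric] by (simp add: hs_mult mult_ac hs_sym[of d0 i] hs_left_commute_self)
        finally have l: "lam (nu q) = hs i a * hs w a" .
        have "hs D a = hs i a * (hs w a * hs n a)"
          unfolding D' neg using hs_mult_left aD n i by (simp add: mult_ac)
        then show ?thesis unfolding s b l both HDz Hac using hs_sym[of a n]
          by (simp add: mult_ac hs_left_commute_self E.hs_left_commute_self)
      next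
        case e: False
        define m where "m = nm e"
        have m: "m \<in> F" "m \<noteq> 0" "hs d0 m = 1" unfolding m_def using e hs_d0_nm by auto
        have f0: "fst q \<noteq> 0" unfolding qq using z c e t0 k zt by simp
        define y where "y = fst q"
        have y0: "y \<noteq> 0" unfolding y_def using f0 .
        have X: "qx q = y" unfolding qx_def y_def using f0 by simp
        have nmy: "nm y = - (d0 * (a * n * m)) * (t / k)^2"
        proof -
          have "nm y * nm k = a * n * m * nm (z - cj z)"
            unfolding y_def qq a_def n_def m_def nm_mult[symmetric] using k(1) by simp
          then have "nm y * k^2 = - (d0 * (a * n * m)) * t^2" unfolding nmzt nm_of_F[OF k(2)] by (simp add: mult_ac)
          then show ?thesis using k(1) by (simp add: field_simps)
        qed
        have hy: "hs b (nm y) = hs b (- (d0 * (a * n * m)))" if "b \<in> F" "b \<noteq> 0" for b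
          unfolding nmy using hs_mult_square[of b "- (d0 * (a * n * m))" "t / k"] that tk m n aD by simp
        have b: "bt q v = H a y * H i z * H a c"
          unfolding btq X neg using y0 c z cz i aD
          by (simp add: H_mult H_mult_left self zz Fcj az mult_ac E.hs_sym[of y z] E.hs_sym[of y "cj z"] E.hs_sym[of y c]
              E.hs_sym[of c "cj z"] E.hs_sym[of c z] E.hs_left_commute_self)
        have s: "sg q = lam (nu q) * H y (- nu q)" unfolding sg_def X using q_ne by simp
        have n0: "nu q \<noteq> 0" "nu q \<in> F" using nu_nonzero[OF q_ne] by auto
        have "H y (- nu q) = hs (- nu q) (nm y)" using H_norm[of "- nu q" y] n0 y0 E.hs_sym by simp
        also have "\<dots> = hs (- (w * n * d0 * (a * D))) (- (d0 * (a * n * m)))"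
          using hnu[of "nm y"] hy y0 aD n by simp
        finally have 1: "H y (- nu q) = hs (- (w * n * d0 * (a * D))) (- (d0 * (a * n * m)))" .
        have 2: "H a y = hs a (- (d0 * (a * n * m)))" using H_norm[of a y] hy[of a] aD y0 by simp
        have "D + w * n = m" unfolding D_def qn_def he n_def m_def by simp
        note core = commutator_symbols[OF aD(1) n(1) m(1) aD(2,3) n(2) m(2) aD(4) d m(3) this]
        show ?thesis unfolding s b both HDz Hac 1 2 lnu using core
          by (simp add: mult_ac hs_left_commute_self E.hs_left_commute_self)
      qed
      then have "(sg q * bt q v * bt h Z) * bt Z h = 1" by (simp add: mult_ac)
      then have "sg q * bt q v * bt h Z = bt Z h" by (rule sign_eqI) (rule bt_sign)
      then show ?thesis using q1 qv' unfolding u_def v_def Z_def by blast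
    qed
  qed
qed

end

section \<open>Extension of characters\<close>

lemma complex_root_exists: assumes "n > 0" shows "\<exists>v :: complex. v ^ n = a"
proof (cases "a = 0")
  case False
  have "(cis (Arg a / n) * of_real (root n (cmod a))) ^ n = cis (Arg a) * of_real (cmod a)"
    using assms by (simp add: power_mult_distrib DeMoivre flip: of_real_power)
  also have "\<dots> = a" using rcis_cmod_Arg[of a] by (simp add: rcis_def mult.commute)
  finally show ?thesis by blast
qed (use assms in \<open>auto intro: exI[of _ 0]\<close>)

text \<open>Divisibility of the multiplicative group of the complex numbers: graphs of partial
  characters are extended by one element at a time, and Zorn's lemma does the rest.\<close>
definition char_graph :: "('g, 'm) monoid_scheme \<Rightarrow> ('g \<times> complex) set \<Rightarrow> bool" where
  "char_graph G \<Gamma> \<longleftrightarrow> (\<forall>(x, a)\<in>\<Gamma>. x \<in> carrier G \<and> a \<noteq> 0 \<and> (inv\<^bsub>G\<^esub> x, inverse a) \<in> \<Gamma>) \<and>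
    (\<forall>(x, a)\<in>\<Gamma>. \<forall>(y, b)\<in>\<Gamma>. (x \<otimes>\<^bsub>G\<^esub> y, a * b) \<in> \<Gamma>) \<and>
    (\<forall>x a b. (x, a) \<in> \<Gamma> \<longrightarrow> (x, b) \<in> \<Gamma> \<longrightarrow> a = b) \<and>
    (\<forall>x\<in>carrier G. \<forall>y\<in>carrier G. (x \<otimes>\<^bsub>G\<^esub> y \<otimes>\<^bsub>G\<^esub> inv\<^bsub>G\<^esub> x \<otimes>\<^bsub>G\<^esub> inv\<^bsub>G\<^esub> y, 1) \<in> \<Gamma>)"

lemma char_graphI:
  assumes "\<And>x a. (x, a) \<in> \<Gamma> \<Longrightarrow> x \<in> carrier G \<and> a \<noteq> 0 \<and> (inv\<^bsub>G\<^esub> x, inverse a) \<in> \<Gamma>"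
    and "\<And>x a y b. (x, a) \<in> \<Gamma> \<Longrightarrow> (y, b) \<in> \<Gamma> \<Longrightarrow> (x \<otimes>\<^bsub>G\<^esub> y, a * b) \<in> \<Gamma>"
    and "\<And>x a b. (x, a) \<in> \<Gamma> \<Longrightarrow> (x, b) \<in> \<Gamma> \<Longrightarrow> a = b"
    and "\<And>x y. x \<in> carrier G \<Longrightarrow> y \<in> carrier G \<Longrightarrow>
      (x \<otimes>\<^bsub>G\<^esub> y \<otimes>\<^bsub>G\<^esub> inv\<^bsub>G\<^esub> x \<otimes>\<^bsub>G\<^esub> inv\<^bsub>G\<^esub> y, 1) \<in> \<Gamma>"
  shows "char_graph G \<Gamma>"
  unfolding char_graph_def using assms by (auto split: prod.splits)

lemma char_graphD:
  assumes "char_graph G \<Gamma>"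
  shows "(x, a) \<in> \<Gamma> \<Longrightarrow> x \<in> carrier G" "(x, a) \<in> \<Gamma> \<Longrightarrow> a \<noteq> 0"
    "(x, a) \<in> \<Gamma> \<Longrightarrow> (inv\<^bsub>G\<^esub> x, inverse a) \<in> \<Gamma>"
    "(x, a) \<in> \<Gamma> \<Longrightarrow> (y, b) \<in> \<Gamma> \<Longrightarrow> (x \<otimes>\<^bsub>G\<^esub> y, a * b) \<in> \<Gamma>"
    "(x, a) \<in> \<Gamma> \<Longrightarrow> (x, b) \<in> \<Gamma> \<Longrightarrow> a = b"
    "x \<in> carrier G \<Longrightarrow> y \<in> carrier G \<Longrightarrow>
      (x \<otimes>\<^bsub>G\<^esub> y \<otimes>\<^bsub>G\<^esub> inv\<^bsub>G\<^esub> x \<otimes>\<^bsub>G\<^esub> inv\<^bsub>G\<^esub> y, 1) \<in> \<Gamma>"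
proof -
  note D = assms[unfolded char_graph_def]
  show "x \<in> carrier G" "a \<noteq> 0" "(inv\<^bsub>G\<^esub> x, inverse a) \<in> \<Gamma>" if "(x, a) \<in> \<Gamma>"
    using bspec[OF conjunct1[OF D] that] by auto
  show "(x \<otimes>\<^bsub>G\<^esub> y, a * b) \<in> \<Gamma>" if "(x, a) \<in> \<Gamma>" "(y, b) \<in> \<Gamma>"
    using bspec[OF conjunct1[OF conjunct2[OF D]] that(1)] that(2) by auto
  show "a = b" if "(x, a) \<in> \<Gamma>" "(x, b) \<in> \<Gamma>"
    using conjunct1[OF conjunct2[OF conjunct2[OF D]]] that by blast
  show "(x \<otimes>\<^bsub>G\<^esub> y \<otimes>\<^bsub>G\<^esub> inv\<^bsub>G\<^esub> x \<otimes>\<^bsub>G\<^esub> inv\<^bsub>G\<^esub> y, 1) \<in> \<Gamma>" if "x \<in> carrier G" "y \<in> carrier G"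
    using conjunct2[OF conjunct2[OF conjunct2[OF D]]] that by blast
qed

context group
begin

text \<open>If some least positive power x^n already has a value a, then x receives an n-th root of
  a; otherwise it receives 1. Since commutators have value 1, the domain is normal and values are
  invariant under conjugation, so the elements y*x^k can be multiplied although the group is not
  abelian.\<close>

lemma char_graph_step:
  assumes \<Gamma>: "char_graph G \<Gamma>" and x: "x \<in> carrier G"
  shows "\<exists>\<Gamma>' v. char_graph G \<Gamma>' \<and> \<Gamma> \<subseteq> \<Gamma>' \<and> (x, v) \<in> \<Gamma>'"
proof -
  note mem = char_graphD(1-3)[OF \<Gamma>] and mult = char_graphD(4)[OF \<Gamma>]
    and unique = char_graphD(5)[OF \<Gamma>] and comm = char_graphD(6)[OF \<Gamma>]
  have one: "(\<one>, 1) \<in> \<Gamma>" using comm[of \<one> \<one>] by simp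
  have conj: "(g \<otimes> y \<otimes> inv g, a) \<in> \<Gamma>" if "(y, a) \<in> \<Gamma>" "g \<in> carrier G" for y a g
    using mult[OF comm[OF that(2) mem(1)[OF that(1)]] that(1)] mem(1)[OF that(1)] that(2)
    by (simp add: m_assoc)
  have pow: "(y [^] (k::int), power_int a k) \<in> \<Gamma>" if "(y, a) \<in> \<Gamma>" for y a k
  proof -
    have nat: "(y [^] (n::nat), a ^ n) \<in> \<Gamma>" for n
      by (induction n) (use one mult that in \<open>auto simp: power_Suc2 simp del: power_Suc\<close>)
    show ?thesis
    proof (cases k rule: int_cases2)
      case (nonneg n)
      then show ?thesis using nat[of n] by (simp add: int_pow_int)
    next
      case (nonpos n)
      have "y [^] k = inv (y [^] n)" unfolding nonpos using mem(1)[OF that] by (rule int_pow_neg_int)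
      moreover have "power_int a k = inverse (a ^ n)" unfolding nonpos by (simp add: power_int_minus)
      ultimately show ?thesis using mem(3)[OF nat[of n]] by simp
    qed
  qed
  define P where "P = (\<lambda>n::nat. n > 0 \<and> (\<exists>a. (x [^] n, a) \<in> \<Gamma>))"
  have "\<exists>v. v \<noteq> 0 \<and> (\<forall>k::int. (\<exists>a. (x [^] k, a) \<in> \<Gamma>) \<longrightarrow> (x [^] k, power_int v k) \<in> \<Gamma>)"
  proof (cases "\<exists>n. P n")
    case True
    define n where "n = (LEAST n. P n)"
    have Pn: "P n" unfolding n_def using True by (rule LeastI_ex)
    have least: "\<not> P j" if "j < n" for j using that not_less_Least unfolding n_def by blast
    obtain a where a: "n > 0" "(x [^] n, a) \<in> \<Gamma>" using Pn unfolding P_def by blast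
    obtain v where v: "v ^ n = a" using complex_root_exists a(1) by blast
    have v0: "v \<noteq> 0" using v a mem(2)[OF a(2)] by auto
    have "(x [^] k, power_int v k) \<in> \<Gamma>" if k: "(x [^] k, b) \<in> \<Gamma>" for k :: int and b
    proof -
      \<comment> \<open>Division with remainder: a power x^r in the domain with r < n forces r = 0
        by minimality of n.\<close>
      define r where "r = nat (k mod int n)"
      define d where "d = k div int n"
      have kd: "k = int r + int n * d" "r < n" unfolding r_def d_def using a(1)
        by (simp_all add: nat_less_iff)
      have an: "(x [^] (int n), a) \<in> \<Gamma>" using a(2) by (simp add: int_pow_int)
      have q: "((x [^] (int n)) [^] d, power_int a d) \<in> \<Gamma>" by (rule pow[OF an])
      have xq: "(x [^] (int n)) [^] d = x [^] (int n * d)" using int_pow_pow[OF x] by simp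
      have "x [^] k \<otimes> inv (x [^] (int n * d)) = x [^] (int r)"
        unfolding kd(1) using x by (simp add: int_pow_mult m_assoc)
      then have "(x [^] (int r), b * inverse (power_int a d)) \<in> \<Gamma>" using mult[OF k mem(3)[OF q]] unfolding xq by simp
      then have "\<exists>c. (x [^] r, c) \<in> \<Gamma>" by (auto simp: int_pow_int)
      then have "r = 0" using least[OF kd(2)] unfolding P_def by auto
      then have "k = int n * d" using kd by simp
      moreover have "power_int a d = power_int v (int n * d)" unfolding v[symmetric] by (simp add: power_int_mult)
      ultimately show ?thesis using q xq by simp
    qed
    then show ?thesis using v0 by blast
  next
    case False
    have "k = 0" if k: "(x [^] k, b) \<in> \<Gamma>" for k :: int and b
    proof (rule ccontr)
      assume "k \<noteq> 0"
      then have k0: "nat \<bar>k\<bar> > 0" by simp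
      have "\<exists>b. (x [^] \<bar>k\<bar>, b) \<in> \<Gamma>"
        using k mem(3)[OF k] x by (cases "k \<ge> 0") (auto simp: int_pow_neg)
      then obtain b where "(x [^] \<bar>k\<bar>, b) \<in> \<Gamma>" by blast
      moreover have "x [^] \<bar>k\<bar> = x [^] (nat \<bar>k\<bar>)" using int_pow_int[of G x "nat \<bar>k\<bar>"] by simp
      ultimately have "(x [^] (nat \<bar>k\<bar>), b) \<in> \<Gamma>" by (simp only:)
      then have "P (nat \<bar>k\<bar>)" unfolding P_def using k0 by blast
      then show False using False by blast
    qed
    then have "(x [^] k, power_int 1 k) \<in> \<Gamma>" if "(x [^] k, b) \<in> \<Gamma>" for k :: int and b
      using that one by fastforce
    then show ?thesis by (metis one_neq_zero)
  qed
  then obtain v where v: "v \<noteq> 0" "\<And>k::int. \<And>a. (x [^] k, a) \<in> \<Gamma> \<Longrightarrow> (x [^] k, power_int v k) \<in> \<Gamma>" by blast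
  define \<Gamma>' where "\<Gamma>' = {(y \<otimes> x [^] k, a * power_int v k) |y a (k::int). (y, a) \<in> \<Gamma>}"
  have I: "(y \<otimes> x [^] k, a * power_int v k) \<in> \<Gamma>'" if "(y, a) \<in> \<Gamma>" for y a and k :: int
    unfolding \<Gamma>'_def using that by blast
  have sub: "\<Gamma> \<subseteq> \<Gamma>'"
  proof
    fix p assume p: "p \<in> \<Gamma>"
    obtain y a where "p = (y, a)" by (cases p)
    then show "p \<in> \<Gamma>'" using I[of y a 0] p mem(1)[of y a] by simp
  qed
  have "char_graph G \<Gamma>'"
  proof (rule char_graphI)
    fix z c assume "(z, c) \<in> \<Gamma>'"
    then obtain y a k where *: "z = y \<otimes> x [^] (k::int)" "c = a * power_int v k" "(y, a) \<in> \<Gamma>"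
      unfolding \<Gamma>'_def by blast
    note y = mem[OF *(3)]
    have zc: "z \<in> carrier G" "c \<noteq> 0" using * y x v by simp_all
    have iz: "inv z = (x [^] (- k) \<otimes> inv y \<otimes> inv (x [^] (- k))) \<otimes> x [^] (- k)"
      unfolding * using y x by (simp add: inv_mult_group int_pow_neg m_assoc)
    have "inverse c = inverse a * power_int v (- k)" unfolding * by (simp add: power_int_minus)
    then have "(inv z, inverse c) \<in> \<Gamma>'"
      using I[OF conj[OF y(3)], of "x [^] (- k)" "- k"] x iz by simp
    then show "z \<in> carrier G \<and> c \<noteq> 0 \<and> (inv z, inverse c) \<in> \<Gamma>'" using zc by blast
    fix z' c' assume "(z', c') \<in> \<Gamma>'"
    then obtain y' a' l where **: "z' = y' \<otimes> x [^] (l::int)" "c' = a' * power_int v l" "(y', a') \<in> \<Gamma>"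
      unfolding \<Gamma>'_def by blast
    note y' = mem[OF **(3)]
    have "z \<otimes> z' = (y \<otimes> (x [^] k \<otimes> y' \<otimes> inv (x [^] k))) \<otimes> x [^] (k + l)"
    proof -
      have "inv (x [^] k) \<otimes> (x [^] k \<otimes> x [^] l) = x [^] l" using x by (simp flip: m_assoc)
      then show ?thesis unfolding * ** int_pow_mult[OF x] using y y' x by (simp add: m_assoc)
    qed
    moreover have "c * c' = (a * a') * power_int v (k + l)" unfolding * ** using v by (simp add: power_int_add)
    ultimately show "(z \<otimes> z', c * c') \<in> \<Gamma>'" using I[OF mult[OF *(3) conj[OF **(3)]], of "x [^] k" "k + l"] x by simp
  next
    fix z c c' assume "(z, c) \<in> \<Gamma>'" "(z, c') \<in> \<Gamma>'"
    then obtain y a k y' a' l where *: "z = y \<otimes> x [^] (k::int)" "c = a * power_int v k" "(y, a) \<in> \<Gamma>"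
      and **: "z = y' \<otimes> x [^] (l::int)" "c' = a' * power_int v l" "(y', a') \<in> \<Gamma>"
      unfolding \<Gamma>'_def by blast
    note y = mem[OF *(3)] and y' = mem[OF **(3)]
    have "x [^] (k - l) = inv y \<otimes> y'"
    proof -
      have "y \<otimes> x [^] (k - l) \<otimes> x [^] l = y' \<otimes> x [^] l"
        using * ** y y' x by (simp add: m_assoc flip: int_pow_mult)
      then have "y \<otimes> x [^] (k - l) = y'" using y y' x by simp
      then show ?thesis using y y' x by (metis inv_solve_left int_pow_closed)
    qed
    then have e: "(x [^] (k - l), inverse a * a') \<in> \<Gamma>" using mult[OF y(3) **(3)] by simp
    have "power_int v (k - l) = inverse a * a'" using unique[OF v(2)[OF e] e] .
    then have "power_int v k = inverse a * a' * power_int v l" using v by (simp add: power_int_diff field_simps)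
    then show "c = c'" unfolding * ** using y by simp
  next
    fix y z assume "y \<in> carrier G" "z \<in> carrier G"
    then show "(y \<otimes> z \<otimes> inv y \<otimes> inv z, 1) \<in> \<Gamma>'" using comm sub by blast
  qed
  moreover have "(x, v) \<in> \<Gamma>'" using I[OF one, of 1] x by simp
  ultimately show ?thesis using sub by blast
qed

lemma char_graph_total:
  assumes \<Gamma>0: "char_graph G \<Gamma>0"
  shows "\<exists>\<psi>. (\<forall>x\<in>carrier G. \<psi> x \<noteq> 0) \<and> (\<forall>x\<in>carrier G. \<forall>y\<in>carrier G. \<psi> (x \<otimes> y) = \<psi> x * \<psi> y) \<and>
    (\<forall>(x, a)\<in>\<Gamma>0. \<psi> x = a)"
proof -
  define A where "A = {\<Gamma>. char_graph G \<Gamma> \<and> \<Gamma>0 \<subseteq> \<Gamma>}"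
  have "\<exists>M\<in>A. \<forall>X\<in>A. M \<subseteq> X \<longrightarrow> X = M"
  proof (rule subset_Zorn)
    fix C assume C: "subset.chain A C"
    show "\<exists>U\<in>A. \<forall>X\<in>C. X \<subseteq> U"
    proof (cases "C = {}")
      case True
      then show ?thesis using \<Gamma>0 unfolding A_def by blast
    next
      case False
      have CA: "X \<in> A" if "X \<in> C" for X using C that unfolding subset.chain_def by blast
      have ch: "X \<subseteq> Y \<or> Y \<subseteq> X" if "X \<in> C" "Y \<in> C" for X Y using C that unfolding subset.chain_def by blast
      have two: "\<exists>X\<in>C. p \<in> X \<and> q \<in> X" if "p \<in> \<Union>C" "q \<in> \<Union>C" for p q
        using that ch by (meson UnionE in_mono)
      have cg: "char_graph G X" if "X \<in> C" for X using CA[OF that] unfolding A_def by blast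
      have "char_graph G (\<Union>C)"
      proof (rule char_graphI)
        fix z c assume zc: "(z, c) \<in> \<Union>C"
        then obtain X where X: "(z, c) \<in> X" "X \<in> C" by blast
        show "z \<in> carrier G \<and> c \<noteq> 0 \<and> (inv z, inverse c) \<in> \<Union>C"
          using char_graphD(1-3)[OF cg[OF X(2)] X(1)] X(2) by blast
        fix z' c' assume Y: "(z', c') \<in> \<Union>C"
        obtain W where W: "W \<in> C" "(z, c) \<in> W" "(z', c') \<in> W" using two[OF zc Y] by blast
        show "(z \<otimes> z', c * c') \<in> \<Union>C" using char_graphD(4)[OF cg[OF W(1)] W(2,3)] W(1) by blast
      next
        fix z c c' assume X: "(z, c) \<in> \<Union>C" and Y: "(z, c') \<in> \<Union>C"
        obtain W where W: "W \<in> C" "(z, c) \<in> W" "(z, c') \<in> W" using two[OF X Y] by blast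
        show "c = c'" by (rule char_graphD(5)[OF cg[OF W(1)] W(2,3)])
      next
        fix y z assume "y \<in> carrier G" "z \<in> carrier G"
        moreover obtain X where "X \<in> C" using False by blast
        ultimately show "(y \<otimes> z \<otimes> inv y \<otimes> inv z, 1) \<in> \<Union>C" using char_graphD(6)[OF cg[of X], of y z] by blast
      qed
      moreover have "\<Gamma>0 \<subseteq> \<Union>C" using False CA unfolding A_def by blast
      ultimately show ?thesis unfolding A_def by blast
    qed
  qed
  then obtain M where M: "M \<in> A" and max: "\<And>X. X \<in> A \<Longrightarrow> M \<subseteq> X \<Longrightarrow> X = M" by blast
  have Mg: "char_graph G M" "\<Gamma>0 \<subseteq> M" using M unfolding A_def by auto
  have total: "\<exists>a. (x, a) \<in> M" if x: "x \<in> carrier G" for x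
  proof -
    obtain X v where X: "char_graph G X" "M \<subseteq> X" "(x, v) \<in> X" using char_graph_step[OF Mg(1) x] by blast
    then have "X = M" using max[of X] Mg unfolding A_def by blast
    then show ?thesis using X by blast
  qed
  note unique = char_graphD(5)[OF Mg(1)]
  define \<psi> where "\<psi> = (\<lambda>x. THE a. (x, a) \<in> M)"
  have val: "\<psi> x = a" if "(x, a) \<in> M" for x a unfolding \<psi>_def using unique that by blast
  have "\<psi> x \<noteq> 0" if x: "x \<in> carrier G" for x
  proof -
    obtain a where a: "(x, a) \<in> M" using total[OF x] by blast
    then have "a \<noteq> 0" by (rule char_graphD(2)[OF Mg(1)])
    then show ?thesis using val[OF a] by simp
  qed
  moreover have "\<psi> (x \<otimes> y) = \<psi> x * \<psi> y" if x: "x \<in> carrier G" and y: "y \<in> carrier G" for x y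
  proof -
    obtain a b where ab: "(x, a) \<in> M" "(y, b) \<in> M" using total x y by blast
    then have "(x \<otimes> y, a * b) \<in> M" by (rule char_graphD(4)[OF Mg(1)])
    then show ?thesis using val ab by simp
  qed
  moreover have "\<forall>(x, a)\<in>\<Gamma>0. \<psi> x = a" using val Mg(2) by blast
  ultimately show ?thesis by blast
qed

end

context quaternion_algebra
begin

section \<open>The double cover of the quaternion group in row coordinates\<close>

definition cover :: "(('a \<times> 'a) \<times> int) monoid" where
  "cover = \<lparr>carrier = {p. fst p \<noteq> (0, 0) \<and> (snd p = 1 \<or> snd p = - 1)},
    mult = (\<lambda>p q. (qm (fst p) (fst q), snd p * snd q * bt (fst p) (fst q))), one = ((0, 1), 1)\<rparr>"

lemma bt_pm: "bt p q = 1 \<or> bt p q = - 1"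
  using bt_sign[of p q] by (simp add: zmult_eq_1_iff)

lemma sg_pm: "sg p = 1 \<or> sg p = - 1"
  using sg_sign[of p] by (simp add: zmult_eq_1_iff)

lemma group_cover: "group cover"
proof (rule groupI)
  fix p q r assume p: "p \<in> carrier cover" and q: "q \<in> carrier cover" and r: "r \<in> carrier cover"
  show "p \<otimes>\<^bsub>cover\<^esub> q \<in> carrier cover"
    using p q bt_pm[of "fst p" "fst q"] qm_nonzero[of "fst p" "fst q"] unfolding cover_def by auto
  show "p \<otimes>\<^bsub>cover\<^esub> q \<otimes>\<^bsub>cover\<^esub> r = p \<otimes>\<^bsub>cover\<^esub> (q \<otimes>\<^bsub>cover\<^esub> r)"
    using bt_cocycle[of "fst p" "fst q" "fst r"] p q r unfolding cover_def by (simp add: qm_assoc mult_ac)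
  show "\<one>\<^bsub>cover\<^esub> \<otimes>\<^bsub>cover\<^esub> p = p" using p bt_one unfolding cover_def by (cases p) auto
  show "\<exists>y\<in>carrier cover. y \<otimes>\<^bsub>cover\<^esub> p = \<one>\<^bsub>cover\<^esub>"
  proof (rule bexI)
    show "(qi (fst p), snd p * bt (qi (fst p)) (fst p)) \<otimes>\<^bsub>cover\<^esub> p = \<one>\<^bsub>cover\<^esub>"
      using p qm_inverse[of "fst p"] bt_sign[of "qi (fst p)" "fst p"] unfolding cover_def by (auto simp: mult_ac)
    show "(qi (fst p), snd p * bt (qi (fst p)) (fst p)) \<in> carrier cover"
      using p qi_nonzero[of "fst p"] bt_pm[of "qi (fst p)" "fst p"] unfolding cover_def by auto
  qed
qed (auto simp: cover_def)

end

section \<open>Splitting over the multiplicative group\<close>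

context quaternion_algebra
begin

definition kel :: "'a \<times> 'a \<Rightarrow> ('a \<times> 'a) \<times> int" where "kel x = (x, sg x)"

text \<open>Equality modulo the graph of \<open>sg\<close> over the norm one group. The relation
  takes the place of a quotient group; normality enters through \<open>kel_conj\<close>, in
  \<open>ksim_left\<close>.\<close>

definition ksim :: "('a \<times> 'a) \<times> int \<Rightarrow> ('a \<times> 'a) \<times> int \<Rightarrow> bool" where
  "ksim p q \<longleftrightarrow> (\<exists>x. qn x = 1 \<and> p = kel x \<otimes>\<^bsub>cover\<^esub> q)"

interpretation cover: group cover by (rule group_cover)

lemma mem_cover: "p \<in> carrier cover \<longleftrightarrow> fst p \<noteq> (0, 0) \<and> (snd p = 1 \<or> snd p = - 1)"
  unfolding cover_def by simp

lemma mult_cover: "p \<otimes>\<^bsub>cover\<^esub> q = (qm (fst p) (fst q), snd p * snd q * bt (fst p) (fst q))"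
  unfolding cover_def by simp

lemma kel_closed: "qn x = 1 \<Longrightarrow> kel x \<in> carrier cover"
  unfolding mem_cover kel_def using sg_pm qn1_nonzero by auto

lemma kel_mult: "qn x = 1 \<Longrightarrow> qn y = 1 \<Longrightarrow> kel x \<otimes>\<^bsub>cover\<^esub> kel y = kel (qm x y)"
  unfolding mult_cover kel_def using sg_mult[of x y] by simp

lemma kel_one: "kel (0, 1) = \<one>\<^bsub>cover\<^esub>" unfolding kel_def sg_def cover_def by simp

lemma qn_qi: assumes "qn x = 1" shows "qn (qi x) = 1"
  using qn_mult[of "qi x" x] qm_inverse(1)[OF qn1_nonzero[OF assms]] assms by simp

lemma kel_inverse: assumes "qn x = 1" shows "kel (qi x) \<otimes>\<^bsub>cover\<^esub> kel x = \<one>\<^bsub>cover\<^esub>"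
  using kel_mult[OF qn_qi[OF assms] assms] qm_inverse(1)[OF qn1_nonzero[OF assms]] kel_one by simp

lemma kel_conj:
  assumes r: "r \<in> carrier cover" and x: "qn x = 1"
  shows "\<exists>y. qn y = 1 \<and> r \<otimes>\<^bsub>cover\<^esub> kel x = kel y \<otimes>\<^bsub>cover\<^esub> r"
proof -
  define g where "g = fst r"
  have g: "g \<noteq> (0, 0)" unfolding g_def using r mem_cover by simp
  define y where "y = qm (qm g x) (qi g)"
  have y: "qm y g = qm g x" unfolding y_def qm_assoc qm_inverse(1)[OF g] by simp
  have "qn y * qn g = qn g * qn x" unfolding qn_mult[symmetric] y ..
  then have "qn y = 1" using x g by simp
  moreover have "r \<otimes>\<^bsub>cover\<^esub> kel x = kel y \<otimes>\<^bsub>cover\<^esub> r"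
    using sg_conj[OF x g y] y unfolding mult_cover kel_def g_def by (simp add: mult_ac)
  ultimately show ?thesis by blast
qed

lemma ksim_sym: assumes "ksim p q" "q \<in> carrier cover" shows "ksim q p"
proof -
  obtain x where x: "qn x = 1" "p = kel x \<otimes>\<^bsub>cover\<^esub> q" using assms unfolding ksim_def by blast
  have "kel (qi x) \<otimes>\<^bsub>cover\<^esub> p = q"
    unfolding x(2) using kel_inverse[OF x(1)] kel_closed x qn_qi assms by (simp flip: cover.m_assoc)
  then show ?thesis unfolding ksim_def using qn_qi[OF x(1)] by metis
qed

lemma ksim_trans:
  assumes "ksim p q" "ksim q r" "r \<in> carrier cover" shows "ksim p r"
proof -
  obtain x y where xy: "qn x = 1" "p = kel x \<otimes>\<^bsub>cover\<^esub> q" "qn y = 1" "q = kel y \<otimes>\<^bsub>cover\<^esub> r"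
    using assms unfolding ksim_def by blast
  have "p = kel (qm x y) \<otimes>\<^bsub>cover\<^esub> r"
    unfolding xy kel_mult[OF xy(1,3), symmetric] using kel_closed xy assms by (simp add: cover.m_assoc)
  then show ?thesis unfolding ksim_def using qn_mult[of x y] xy(1,3) by (intro exI[of _ "qm x y"]) simp
qed

lemma ksim_right:
  assumes "ksim p q" "q \<in> carrier cover" "r \<in> carrier cover"
  shows "ksim (p \<otimes>\<^bsub>cover\<^esub> r) (q \<otimes>\<^bsub>cover\<^esub> r)"
proof -
  obtain x where x: "qn x = 1" "p = kel x \<otimes>\<^bsub>cover\<^esub> q" using assms unfolding ksim_def by blast
  have "p \<otimes>\<^bsub>cover\<^esub> r = kel x \<otimes>\<^bsub>cover\<^esub> (q \<otimes>\<^bsub>cover\<^esub> r)"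
    unfolding x(2) using kel_closed[OF x(1)] assms by (simp add: cover.m_assoc)
  then show ?thesis unfolding ksim_def using x by blast
qed

lemma ksim_left:
  assumes "ksim p q" "q \<in> carrier cover" "r \<in> carrier cover"
  shows "ksim (r \<otimes>\<^bsub>cover\<^esub> p) (r \<otimes>\<^bsub>cover\<^esub> q)"
proof -
  obtain x where x: "qn x = 1" "p = kel x \<otimes>\<^bsub>cover\<^esub> q" using assms unfolding ksim_def by blast
  obtain y where y: "qn y = 1" "r \<otimes>\<^bsub>cover\<^esub> kel x = kel y \<otimes>\<^bsub>cover\<^esub> r" using kel_conj[OF assms(3) x(1)] by blast
  have "r \<otimes>\<^bsub>cover\<^esub> p = (r \<otimes>\<^bsub>cover\<^esub> kel x) \<otimes>\<^bsub>cover\<^esub> q"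
    unfolding x(2) using kel_closed[OF x(1)] assms by (simp add: cover.m_assoc)
  also have "\<dots> = kel y \<otimes>\<^bsub>cover\<^esub> (r \<otimes>\<^bsub>cover\<^esub> q)"
    unfolding y(2) using kel_closed[OF y(1)] assms by (simp add: cover.m_assoc)
  finally show ?thesis unfolding ksim_def using y by blast
qed

lemma commute_torus:
  assumes "z \<noteq> 0" "h \<in> carrier cover"
  shows "ksim (((0, z), 1) \<otimes>\<^bsub>cover\<^esub> h) (h \<otimes>\<^bsub>cover\<^esub> ((0, z), 1))"
proof -
  have h: "fst h \<noteq> (0, 0)" using assms mem_cover by simp
  obtain q where q: "qn q = 1" "qm q (qm (fst h) (0, z)) = qm (0, z) (fst h)"
    "sg q * bt q (qm (fst h) (0, z)) * bt (fst h) (0, z) = bt (0, z) (fst h)"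
    using comm_torus[OF assms(1) h] by blast
  then have "((0, z), 1) \<otimes>\<^bsub>cover\<^esub> h = kel q \<otimes>\<^bsub>cover\<^esub> (h \<otimes>\<^bsub>cover\<^esub> ((0, z), 1))"
    unfolding mult_cover kel_def fst_conv snd_conv q(2) q(3)[symmetric] by (simp add: mult_ac)
  then show ?thesis unfolding ksim_def using q(1) by blast
qed

text \<open>An element whose reduced norm is a norm from E equals, modulo the graph, a lift (Z, e)
  of an element of E, and the sign e is central. This reduces the claim to
  \<open>commute_torus\<close>.\<close>

lemma commute_norm:
  assumes p: "p \<in> carrier cover" and n: "hs d0 (qn (fst p)) = 1" and h: "h \<in> carrier cover"
  shows "ksim (p \<otimes>\<^bsub>cover\<^esub> h) (h \<otimes>\<^bsub>cover\<^esub> p)"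
proof -
  define g where "g = fst p"
  have g: "g \<noteq> (0, 0)" unfolding g_def using p mem_cover by simp
  have "hil F d0 (qn g)" using n unfolding hs_def g_def by (simp split: if_splits)
  then obtain z where z: "qn g = nm z" using hil_d0_iff[of "qn g"] by auto
  then have z0: "z \<noteq> 0" using g by (metis nm_eq_0 qn_eq_0)
  define Z :: "'a \<times> 'a" where "Z = (0, z)"
  have Z: "Z \<noteq> (0, 0)" "qn Z = nm z" unfolding Z_def qn_def using z0 by auto
  define x where "x = qm g (qi Z)"
  have xZ: "qm x Z = g" unfolding x_def qm_assoc qm_inverse(1)[OF Z(1)] by simp
  have x: "qn x = 1" using qn_mult[of x Z] xZ z Z z0 by simp
  define e where "e = snd p * sg x * bt x Z"
  have e: "e = 1 \<or> e = - 1" unfolding e_def using p mem_cover sg_pm[of x] bt_pm[of x Z] by auto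
  have e1: "(Z, e) = ((0, 1), e) \<otimes>\<^bsub>cover\<^esub> (Z, 1)" unfolding mult_cover using bt_one(1)[OF Z(1)] by simp
  have central: "((0, 1), e) \<otimes>\<^bsub>cover\<^esub> r = r \<otimes>\<^bsub>cover\<^esub> ((0, 1), e)" if "r \<in> carrier cover" for r
    using bt_one[of "fst r"] that mem_cover[of r] unfolding mult_cover by simp
  have ec: "((0, 1), e) \<in> carrier cover" "(Z, 1) \<in> carrier cover" "(Z, e) \<in> carrier cover"
    using e Z(1) unfolding mem_cover by auto
  have "p = kel x \<otimes>\<^bsub>cover\<^esub> (Z, e)"
  proof -
    have "sg x * e * bt x Z = snd p * (sg x * sg x) * (bt x Z * bt x Z)" unfolding e_def by (simp only: mult_ac)
    then have "sg x * e * bt x Z = snd p" unfolding sg_sign bt_sign by simp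
    then show ?thesis unfolding mult_cover kel_def fst_conv snd_conv xZ g_def by simp
  qed
  then have pZ: "ksim p (Z, e)" unfolding ksim_def using x by blast
  have "ksim ((Z, 1) \<otimes>\<^bsub>cover\<^esub> h) (h \<otimes>\<^bsub>cover\<^esub> (Z, 1))" unfolding Z_def by (rule commute_torus[OF z0 h])
  then have "ksim (((0, 1), e) \<otimes>\<^bsub>cover\<^esub> ((Z, 1) \<otimes>\<^bsub>cover\<^esub> h)) (((0, 1), e) \<otimes>\<^bsub>cover\<^esub> (h \<otimes>\<^bsub>cover\<^esub> (Z, 1)))"
    using ksim_left ec h by simp
  moreover have "((0, 1), e) \<otimes>\<^bsub>cover\<^esub> ((Z, 1) \<otimes>\<^bsub>cover\<^esub> h) = (Z, e) \<otimes>\<^bsub>cover\<^esub> h"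
    unfolding e1 using ec h by (simp add: cover.m_assoc)
  moreover have "((0, 1), e) \<otimes>\<^bsub>cover\<^esub> (h \<otimes>\<^bsub>cover\<^esub> (Z, 1)) = h \<otimes>\<^bsub>cover\<^esub> (Z, e)"
    unfolding e1 using ec h central[OF h] by (simp flip: cover.m_assoc)
  ultimately have 1: "ksim ((Z, e) \<otimes>\<^bsub>cover\<^esub> h) (h \<otimes>\<^bsub>cover\<^esub> (Z, e))" by simp
  have 2: "ksim (p \<otimes>\<^bsub>cover\<^esub> h) ((Z, e) \<otimes>\<^bsub>cover\<^esub> h)" by (rule ksim_right[OF pZ ec(3) h])
  have 3: "ksim (h \<otimes>\<^bsub>cover\<^esub> p) (h \<otimes>\<^bsub>cover\<^esub> (Z, e))" by (rule ksim_left[OF pZ ec(3) h])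
  have "ksim (h \<otimes>\<^bsub>cover\<^esub> (Z, e)) (h \<otimes>\<^bsub>cover\<^esub> p)" using ksim_sym[OF 3] ec h by simp
  then show ?thesis using ksim_trans[OF ksim_trans[OF 2 1]] ec h p by simp
qed

text \<open>If neither reduced norm is a norm from E, then that of y = p*q^-1 is, because such norms
  have index two. So y commutes with q modulo the graph, and hence so does p = y*q.\<close>

lemma commute_all:
  assumes p: "p \<in> carrier cover" and q: "q \<in> carrier cover"
  shows "ksim (p \<otimes>\<^bsub>cover\<^esub> q) (q \<otimes>\<^bsub>cover\<^esub> p)"
proof (cases "hs d0 (qn (fst p)) = 1")
  case True
  then show ?thesis using commute_norm p q by blast
next
  case False
  then have np: "hs d0 (qn (fst p)) = - 1" using hs_cases by blast
  show ?thesis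
  proof (cases "hs d0 (qn (fst q)) = 1")
    case True
    have "ksim (q \<otimes>\<^bsub>cover\<^esub> p) (p \<otimes>\<^bsub>cover\<^esub> q)" by (rule commute_norm[OF q True p])
    then show ?thesis using ksim_sym p q by simp
  next
    case False
    then have nq: "hs d0 (qn (fst q)) = - 1" using hs_cases by blast
    define y where "y = p \<otimes>\<^bsub>cover\<^esub> inv\<^bsub>cover\<^esub> q"
    have y: "y \<in> carrier cover" unfolding y_def using p q by simp
    have yq: "y \<otimes>\<^bsub>cover\<^esub> q = p" unfolding y_def using p q by (simp add: cover.m_assoc)
    have "qn (fst y) * qn (fst q) = qn (fst p)" unfolding yq[symmetric] mult_cover by (simp add: qn_mult)
    moreover have "qn (fst y) \<noteq> 0" "qn (fst q) \<noteq> 0" using y q mem_cover by auto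
    ultimately have "hs d0 (qn (fst p)) = hs d0 (qn (fst y)) * hs d0 (qn (fst q))"
      using hs_mult[of d0 "qn (fst y)" "qn (fst q)"] by simp
    then have "hs d0 (qn (fst y)) = 1" using np nq by simp
    then have "ksim (y \<otimes>\<^bsub>cover\<^esub> q) (q \<otimes>\<^bsub>cover\<^esub> y)" using commute_norm y q by blast
    then have "ksim (y \<otimes>\<^bsub>cover\<^esub> q \<otimes>\<^bsub>cover\<^esub> q) (q \<otimes>\<^bsub>cover\<^esub> y \<otimes>\<^bsub>cover\<^esub> q)" using ksim_right q y by simp
    then show ?thesis using yq q y by (simp add: cover.m_assoc)
  qed
qed

text \<open>By \<open>commute_all\<close> the graph of the character (x, e) -> e*sg x contains every
  commutator with value 1, so the character extends to the whole cover. Its value on the central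
  sign e is e, which turns multiplicativity of the extension into the cocycle equation for its
  restriction to (p, 1).\<close>

lemma ex_splitting_pairs:
  "\<exists>S :: 'a \<times> 'a \<Rightarrow> complex. (\<forall>p. p \<noteq> (0, 0) \<longrightarrow> S p \<noteq> 0) \<and>
    (\<forall>p q. p \<noteq> (0, 0) \<longrightarrow> q \<noteq> (0, 0) \<longrightarrow> S (qm p q) = S p * S q * of_int (bt p q))"
proof -
  define \<Gamma> :: "((('a \<times> 'a) \<times> int) \<times> complex) set" where
    "\<Gamma> = {((x, e), of_int (e * sg x)) |x e. qn x = 1 \<and> (e = 1 \<or> e = - 1)}"
  have I: "((x, e), of_int (e * sg x)) \<in> \<Gamma>" if "qn x = 1" "e = 1 \<or> e = - 1" for x e
    unfolding \<Gamma>_def using that by blast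
  have "char_graph cover \<Gamma>"
  proof (rule char_graphI)
    fix p c assume "(p, c) \<in> \<Gamma>"
    then obtain x e where *: "p = (x, e)" "c = of_int (e * sg x)" "qn x = 1" "e = 1 \<or> e = - 1"
      unfolding \<Gamma>_def by blast
    have pc: "p \<in> carrier cover" unfolding mem_cover * using qn1_nonzero * by auto
    have c0: "c \<noteq> 0" unfolding * using *(4) sg_pm[of x] by auto
    define e' where "e' = e * bt (qi x) x"
    have e': "e' = 1 \<or> e' = - 1" unfolding e'_def using *(4) bt_pm[of "qi x" x] by auto
    have x0: "x \<noteq> (0, 0)" using qn1_nonzero * by blast
    have "inv\<^bsub>cover\<^esub> p = (qi x, e')"
    proof (rule cover.inv_equality)
      have "e * e = 1" using *(4) by auto
      then have "e' * e * bt (qi x) x = 1" unfolding e'_def using bt_sign[of "qi x" x] by (simp add: mult_ac)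
      then show "(qi x, e') \<otimes>\<^bsub>cover\<^esub> p = \<one>\<^bsub>cover\<^esub>"
        unfolding mult_cover *(1) using qm_inverse(1)[OF x0] by (simp add: cover_def)
      show "(qi x, e') \<in> carrier cover" unfolding mem_cover using e' qi_nonzero[OF x0] by simp
    qed (rule pc)
    moreover have "inverse c = of_int (e' * sg (qi x))"
    proof -
      have "sg (qi x) * sg x * bt (qi x) x = 1"
        using sg_mult[OF qn_qi[OF *(3)] *(3)] qm_inverse(1)[OF x0] by (simp add: sg_def)
      then have "(e' * sg (qi x)) * (e * sg x) = e * e" unfolding e'_def by (simp add: mult_ac)
      also have "\<dots> = 1" using *(4) by auto
      finally have "of_int ((e' * sg (qi x)) * (e * sg x)) = (1 :: complex)" by (simp only: of_int_1)
      then have "of_int (e' * sg (qi x)) * c = 1" unfolding * by simp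
      then show ?thesis using c0 by (metis mult.commute inverse_unique)
    qed
    ultimately show "p \<in> carrier cover \<and> c \<noteq> 0 \<and> (inv\<^bsub>cover\<^esub> p, inverse c) \<in> \<Gamma>"
      using pc c0 I[OF qn_qi[OF *(3)] e'] by simp
    fix q c' assume "(q, c') \<in> \<Gamma>"
    then obtain y d where **: "q = (y, d)" "c' = of_int (d * sg y)" "qn y = 1" "d = 1 \<or> d = - 1"
      unfolding \<Gamma>_def by blast
    have "e * d * bt x y * sg (qm x y) = e * sg x * (d * sg y) * (bt x y * bt x y)"
      unfolding sg_mult[OF *(3) **(3)] by (simp only: mult_ac)
    then have i: "e * d * bt x y * sg (qm x y) = e * sg x * (d * sg y)" unfolding bt_sign by simp
    have cc: "c * c' = of_int (e * d * bt x y * sg (qm x y))" unfolding i * ** by (simp only: of_int_mult)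
    have "qn (qm x y) = 1" using qn_mult * ** by simp
    moreover have "e * d * bt x y = 1 \<or> e * d * bt x y = - 1" using *(4) **(4) bt_pm[of x y] by auto
    ultimately have "((qm x y, e * d * bt x y), of_int (e * d * bt x y * sg (qm x y))) \<in> \<Gamma>" by (rule I)
    then show "(p \<otimes>\<^bsub>cover\<^esub> q, c * c') \<in> \<Gamma>" unfolding cc mult_cover *(1) **(1) fst_conv snd_conv .
  next
    fix p c c' assume "(p, c) \<in> \<Gamma>" "(p, c') \<in> \<Gamma>"
    then show "c = c'" unfolding \<Gamma>_def by auto
  next
    fix p q assume p: "p \<in> carrier cover" and q: "q \<in> carrier cover"
    obtain x where x: "qn x = 1" "p \<otimes>\<^bsub>cover\<^esub> q = kel x \<otimes>\<^bsub>cover\<^esub> (q \<otimes>\<^bsub>cover\<^esub> p)"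
      using commute_all[OF p q] unfolding ksim_def by blast
    have "p \<otimes>\<^bsub>cover\<^esub> q \<otimes>\<^bsub>cover\<^esub> inv\<^bsub>cover\<^esub> p \<otimes>\<^bsub>cover\<^esub> inv\<^bsub>cover\<^esub> q = kel x"
      unfolding x(2) using p q kel_closed[OF x(1)] by (simp add: cover.m_assoc)
    then show "(p \<otimes>\<^bsub>cover\<^esub> q \<otimes>\<^bsub>cover\<^esub> inv\<^bsub>cover\<^esub> p \<otimes>\<^bsub>cover\<^esub> inv\<^bsub>cover\<^esub> q, 1) \<in> \<Gamma>"
      using I[OF x(1) sg_pm[of x]] sg_sign[of x] unfolding kel_def by simp
  qed
  then obtain \<psi> where \<psi>: "\<And>x. x \<in> carrier cover \<Longrightarrow> \<psi> x \<noteq> 0"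
    "\<And>x y. x \<in> carrier cover \<Longrightarrow> y \<in> carrier cover \<Longrightarrow> \<psi> (x \<otimes>\<^bsub>cover\<^esub> y) = \<psi> x * \<psi> y"
    "\<And>x a. (x, a) \<in> \<Gamma> \<Longrightarrow> \<psi> x = a"
    using cover.char_graph_total[of \<Gamma>] by fast
  define S where "S = (\<lambda>p. \<psi> (p, 1))"
  have c1: "(p, 1) \<in> carrier cover" if "p \<noteq> (0, 0)" for p using that unfolding mem_cover by simp
  have "S (qm p q) = S p * S q * of_int (bt p q)" if p: "p \<noteq> (0, 0)" and q: "q \<noteq> (0, 0)" for p q
  proof -
    have pq: "qm p q \<noteq> (0, 0)" using qm_nonzero p q by blast
    define e where "e = bt p q"
    have e: "e = 1 \<or> e = - 1" unfolding e_def by (rule bt_pm)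
    have ec: "((0, 1), e) \<in> carrier cover" unfolding mem_cover using e by auto
    have v: "\<psi> ((0, 1), e) = of_int e" using \<psi>(3)[OF I[of "(0, 1)" e]] e by (simp add: sg_def)
    have "(p, 1) \<otimes>\<^bsub>cover\<^esub> (q, 1) = (qm p q, 1) \<otimes>\<^bsub>cover\<^esub> ((0, 1), e)"
      unfolding mult_cover e_def using bt_one(2)[OF pq] by simp
    then have "S p * S q = S (qm p q) * of_int e"
      unfolding S_def using \<psi>(2) c1 p q pq ec v by metis
    moreover have "of_int e * of_int e = (1 :: complex)" using e by auto
    ultimately show ?thesis unfolding e_def[symmetric] by (metis mult.assoc mult.right_neutral)
  qed
  moreover have "S p \<noteq> 0" if "p \<noteq> (0, 0)" for p unfolding S_def using \<psi>(1) c1 that by blast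
  ultimately show ?thesis by blast
qed

end

text \<open>Conjugation by the unipotent matrix [[1, y], [0, 1]].\<close>
definition umat :: "'a::field \<Rightarrow> 'a mat2 \<Rightarrow> 'a mat2" where
  "umat y g = M2 (m11 g + y * m21 g) (m12 g + y * m22 g - y * m11 g - y^2 * m21 g) (m21 g) (m22 g - y * m21 g)"

lemma mmul_umat: "mmul (umat y g) (umat y h) = umat y (mmul g h)"
  unfolding mmul_def umat_def by (simp add: algebra_simps power2_eq_square)

lemma mdet_umat: "mdet (umat y g) = mdet g"
  unfolding mdet_def umat_def by (simp add: algebra_simps power2_eq_square)

text \<open>Conjugation keeps the lower left entry, and keeps the lower right one whenever the lower
  left vanishes. Of the factors and their product, \<open>beta\<close> sees only these entries and
  the determinants.\<close>

lemma beta_umat: assumes "mdet g \<noteq> 0" "mdet h \<noteq> 0" shows "beta (umat y g) (umat y h) = beta g h"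
proof -
  define D1 D2 where "D1 = mdet g" and "D2 = mdet h"
  have D: "D1 \<noteq> 0" "D2 \<noteq> 0" using assms unfolding D1_def D2_def by auto
  let ?G = "\<lambda>g. conj_y D2 (pg g)"
  have 1: "xg (?G (umat y g)) = xg (?G g)"
    unfolding xg_def conj_y_def pg_def mdet_umat D1_def[symmetric] using D by (simp add: umat_def)
  have 2: "xg (pg (umat y h)) = xg (pg h)" unfolding xg_def pg_def mdet_umat D2_def[symmetric] using D by (simp add: umat_def)
  have r21: "m21 (mmul (?G (umat y g)) (pg (umat y h))) = m21 (mmul (?G g) (pg h))"
    unfolding mmul_def conj_y_def pg_def mdet_umat D1_def[symmetric] D2_def[symmetric] using D
    by (simp add: umat_def field_simps)
  have r22: "m22 (mmul (?G (umat y g)) (pg (umat y h))) = m22 (mmul (?G g) (pg h)) - y * m21 (mmul (?G g) (pg h))"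
    unfolding mmul_def conj_y_def pg_def mdet_umat D1_def[symmetric] D2_def[symmetric] using D
    by (simp add: umat_def field_simps power2_eq_square)
  have 3: "xg (mmul (?G (umat y g)) (pg (umat y h))) = xg (mmul (?G g) (pg h))"
    unfolding xg_def r21 r22 by simp
  have 4: "vfac D2 (pg (umat y g)) = vfac D2 (pg g)"
    unfolding vfac_def pg_def mdet_umat D1_def[symmetric] using D by (simp add: umat_def)
  show ?thesis unfolding beta_def beta_SL_def mdet_umat D2_def[symmetric] 1 2 3 4 ..
qed

section \<open>Embeddings of the quaternion algebra\<close>

text \<open>Gaussian elimination: a vector with nonzero last entry is moved to the end by the
  transposition \<open>\<pi>\<close> and used to clear the last column.\<close>

lemma (in subfield_char0) linear_dependence:
  fixes v :: "nat \<Rightarrow> nat \<Rightarrow> 'a"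
  assumes "\<And>i j. i \<le> n \<Longrightarrow> j < n \<Longrightarrow> v i j \<in> K"
  shows "\<exists>c. (\<forall>i\<le>n. c i \<in> K) \<and> (\<exists>i\<le>n. c i \<noteq> 0) \<and> (\<forall>j<n. (\<Sum>i\<le>n. c i * v i j) = 0)"
  using assms
proof (induction n arbitrary: v)
  case 0
  then show ?case by (intro exI[of _ "\<lambda>_. 1"]) auto
next
  case (Suc n)
  show ?case
  proof (cases "\<exists>k\<le>Suc n. v k n \<noteq> 0")
    case False
    have "\<exists>c. (\<forall>i\<le>n. c i \<in> K) \<and> (\<exists>i\<le>n. c i \<noteq> 0) \<and> (\<forall>j<n. (\<Sum>i\<le>n. c i * v i j) = 0)"
      by (rule Suc.IH) (use Suc.prems in simp)
    then obtain c where c: "\<forall>i\<le>n. c i \<in> K" "\<exists>i\<le>n. c i \<noteq> 0" "\<forall>j<n. (\<Sum>i\<le>n. c i * v i j) = 0"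
      by blast
    define c' where "c' = c(Suc n := 0)"
    have eq: "(\<Sum>i\<le>Suc n. c' i * v i j) = (\<Sum>i\<le>n. c i * v i j)" for j
      unfolding c'_def by simp
    have "(\<Sum>i\<le>Suc n. c' i * v i j) = 0" if "j < Suc n" for j
    proof (cases "j = n")
      case True
      then show ?thesis using False by (intro sum.neutral) auto
    next
      case False
      then show ?thesis unfolding eq using c(3) that by simp
    qed
    moreover have "\<forall>i\<le>Suc n. c' i \<in> K" unfolding c'_def using c by auto
    moreover have "\<exists>i\<le>Suc n. c' i \<noteq> 0" unfolding c'_def using c(2) by (metis fun_upd_other le_SucI not_less_eq_eq order_refl)
    ultimately show ?thesis by blast
  next
    case True
    then obtain k where k: "k \<le> Suc n" "v k n \<noteq> 0" by blast
    define \<pi> where "\<pi> = (\<lambda>i. if i = k then Suc n else if i = Suc n then k else i)"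
    have \<pi>\<pi>: "\<pi> (\<pi> i) = i" for i unfolding \<pi>_def by auto
    have \<pi>_le: "\<pi> i \<le> Suc n" if "i \<le> Suc n" for i unfolding \<pi>_def using k that by auto
    have bij: "bij_betw \<pi> {..Suc n} {..Suc n}"
      by (rule bij_betw_byWitness[where f' = \<pi>]) (use \<pi>\<pi> \<pi>_le in auto)
    define u where "u = (\<lambda>i j. v (\<pi> i) j)"
    have u: "u i j \<in> K" if "i \<le> Suc n" "j < Suc n" for i j
      unfolding u_def using Suc.prems \<pi>_le that by simp
    have un: "u (Suc n) n \<noteq> 0" unfolding u_def \<pi>_def using k by simp
    define r where "r = (\<lambda>i. u i n / u (Suc n) n)"
    have rK: "r i \<in> K" if "i \<le> Suc n" for i unfolding r_def using u that by auto
    obtain c where c: "\<forall>i\<le>n. c i \<in> K" "\<exists>i\<le>n. c i \<noteq> 0"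
      "\<forall>j<n. (\<Sum>i\<le>n. c i * (u i j - r i * u (Suc n) j)) = 0"
      using Suc.IH[of "\<lambda>i j. u i j - r i * u (Suc n) j"] u rK by (auto simp: less_Suc_eq_le)
    define d where "d = c(Suc n := - (\<Sum>i\<le>n. c i * r i))"
    have sumd: "(\<Sum>i\<le>Suc n. d i * u i j) = (\<Sum>i\<le>n. c i * (u i j - r i * u (Suc n) j))" for j
      unfolding d_def by (simp add: right_diff_distrib sum_subtractf sum_distrib_right mult.assoc)
    have zero: "(\<Sum>i\<le>Suc n. d i * u i j) = 0" if "j < Suc n" for j
    proof (cases "j = n")
      case True
      show ?thesis unfolding sumd True r_def using un by simp
    next
      case False
      then show ?thesis unfolding sumd using c(3) that by simp
    qed
    have sumK: "(\<Sum>i\<in>I. g i) \<in> K" if "finite I" "\<And>i. i \<in> I \<Longrightarrow> g i \<in> K" for g :: "nat \<Rightarrow> 'a" and I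
      using that by (induction I rule: finite_induct) auto
    have dK: "d i \<in> K" if "i \<le> Suc n" for i
      unfolding d_def using c(1) rK that by (auto intro!: uminus_K sumK)
    have "(\<Sum>i\<le>Suc n. d (\<pi> i) * v i j) = (\<Sum>i\<le>Suc n. d i * u i j)" for j
    proof -
      have "(\<Sum>i\<le>Suc n. d i * u i j) = (\<Sum>i\<in>{..Suc n}. (\<lambda>i. d (\<pi> i) * v i j) (\<pi> i))"
        unfolding u_def \<pi>\<pi> ..
      also have "\<dots> = (\<Sum>i\<in>{..Suc n}. d (\<pi> i) * v i j)" by (rule sum.reindex_bij_betw[OF bij])
      finally show ?thesis by simp
    qed
    moreover have "\<exists>i\<le>Suc n. d (\<pi> i) \<noteq> 0"
    proof -
      obtain i where i: "i \<le> n" "c i \<noteq> 0" using c(2) by blast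
      then have "d i \<noteq> 0" unfolding d_def by simp
      then show ?thesis using \<pi>\<pi>[of i] \<pi>_le[of i] i by (intro exI[of _ "\<pi> i"]) auto
    qed
    ultimately show ?thesis using zero dK \<pi>_le by (intro exI[of _ "\<lambda>i. d (\<pi> i)"]) auto
  qed
qed

context quadratic_extension
begin

text \<open>A matrix with zero bottom row has no inverse, so taking bottom rows is injective on A.
  Both A and E^2 have dimension 4 over F, so it is also onto.\<close>

lemma DF_rows:
  assumes A: "is_DF_image F A"
  shows "g \<in> A \<Longrightarrow> m21 g = 0 \<Longrightarrow> m22 g = 0 \<Longrightarrow> g = mzero"
    and "\<exists>g\<in>A. m21 g = c \<and> m22 g = d"
proof -
  note D1 = A[unfolded is_DF_image_def]
  note D2 = conjunct2[OF D1]
  note D3 = conjunct2[OF D2]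
  note D4 = conjunct2[OF D3]
  note D5 = conjunct2[OF D4]
  obtain b :: "nat \<Rightarrow> 'a mat2" where b: "\<forall>i<4. b i \<in> A"
    and ind: "\<forall>c :: nat \<Rightarrow> 'a. (\<forall>i<4. c i \<in> F) \<and>
           madd (madd (mscal (c 0) (b 0)) (mscal (c 1) (b 1)))
                (madd (mscal (c 2) (b 2)) (mscal (c 3) (b 3))) = mzero
           \<longrightarrow> (\<forall>i<4. c i = 0)"
    using conjunct1[OF D4] by (elim exE conjE)
  have add: "\<And>g h. g \<in> A \<Longrightarrow> h \<in> A \<Longrightarrow> madd g h \<in> A" using conjunct1[OF D2] by blast
  have sc: "\<And>c g. c \<in> F \<Longrightarrow> g \<in> A \<Longrightarrow> mscal c g \<in> A" using conjunct1[OF D3] by blast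
  have inv: "\<And>g. g \<in> A \<Longrightarrow> g \<noteq> mzero \<Longrightarrow> \<exists>h\<in>A. mmul g h = mone" using conjunct1[OF D5] by blast
  have row0: "g = mzero" if gA: "g \<in> A" and "m21 g = 0" "m22 g = 0" for g
  proof (rule ccontr)
    assume "g \<noteq> mzero"
    then obtain h where "mmul g h = mone" using inv[OF gA] by blast
    then have "m22 (mmul g h) = 1" unfolding mone_def by simp
    then show False using that unfolding mmul_def by simp
  qed
  then show "g \<in> A \<Longrightarrow> m21 g = 0 \<Longrightarrow> m22 g = 0 \<Longrightarrow> g = mzero" .
  define comb where "comb = (\<lambda>c :: nat \<Rightarrow> 'a. madd (madd (mscal (c 0) (b 0)) (mscal (c 1) (b 1)))
                (madd (mscal (c 2) (b 2)) (mscal (c 3) (b (3::nat)))))"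
  have combA: "comb c \<in> A" if "\<forall>i<4. c i \<in> F" for c :: "nat \<Rightarrow> 'a"
    unfolding comb_def using that b by (intro add sc) auto
  \<comment> \<open>Four rows from the basis and, at index 4, the target (c, d): five vectors in a
    space of dimension 4. Independence of the basis makes the coefficient at index 4
    nonzero.\<close>
  define row where "row = (\<lambda>i::nat. if i < 4 then (m21 (b i), m22 (b i)) else (c, d))"
  define v where "v = (\<lambda>i (j::nat). if j = 0 then re (fst (row i)) else if j = 1 then im (fst (row i))
     else if j = 2 then re (snd (row i)) else im (snd (row i)))"
  have "v i j \<in> F" for i j unfolding v_def by simp
  then obtain k where k: "\<forall>i\<le>4. k i \<in> F" "\<exists>i\<le>4. k i \<noteq> 0" "\<forall>j<4. (\<Sum>i\<le>4. k i * v i j) = 0"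
    using linear_dependence[of 4 v] by blast
  have ex5: "(\<Sum>i\<le>4. g i) = g 0 + g 1 + g 2 + g 3 + g 4" for g :: "nat \<Rightarrow> 'a"
    by (simp add: eval_nat_numeral)
  have s: "(\<Sum>i\<le>4. k i * fst (row i)) = 0" "(\<Sum>i\<le>4. k i * snd (row i)) = 0"
  proof -
    have "(\<Sum>i\<le>4. k i * fst (row i)) = (\<Sum>i\<le>4. k i * v i 0) + (\<Sum>i\<le>4. k i * v i 1) * \<delta>"
      unfolding v_def sum_distrib_right sum.distrib[symmetric]
      by (intro sum.cong refl) (subst re_im, simp add: algebra_simps)
    then show "(\<Sum>i\<le>4. k i * fst (row i)) = 0" using k(3) by simp
    have "(\<Sum>i\<le>4. k i * snd (row i)) = (\<Sum>i\<le>4. k i * v i 2) + (\<Sum>i\<le>4. k i * v i 3) * \<delta>"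
      unfolding v_def sum_distrib_right sum.distrib[symmetric]
      by (intro sum.cong refl) (subst re_im, simp add: algebra_simps)
    then show "(\<Sum>i\<le>4. k i * snd (row i)) = 0" using k(3) by simp
  qed
  have rows: "m21 (comb e) = e 0 * fst (row 0) + e 1 * fst (row 1) + e 2 * fst (row 2) + e 3 * fst (row 3)"
    "m22 (comb e) = e 0 * snd (row 0) + e 1 * snd (row 1) + e 2 * snd (row 2) + e 3 * snd (row 3)" for e
    unfolding comb_def row_def madd_def mscal_def by simp_all
  have row4: "row 4 = (c, d)" unfolding row_def by simp
  have k4: "k 4 \<noteq> 0"
  proof
    assume 0: "k 4 = 0"
    have "comb k = mzero"
      using row0[OF combA[of k]] k(1) s 0 unfolding rows ex5 by simp
    then have "\<forall>i<4. k i = 0" using ind k(1) unfolding comb_def by auto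
    then show False using k(2) 0 by (metis le_eq_less_or_eq)
  qed
  define e where "e = (\<lambda>i. - k i / k 4)"
  have "comb e \<in> A" using combA[of e] k(1) unfolding e_def by auto
  moreover have "m21 (comb e) = c"
  proof -
    have "k 4 * m21 (comb e) = - (k 0 * fst (row 0) + k 1 * fst (row 1) + k 2 * fst (row 2) + k 3 * fst (row 3))"
      unfolding rows e_def using k4 by (simp add: field_simps)
    also have "\<dots> = k 4 * c" using s(1) unfolding ex5 row4 by (simp add: add_eq_0_iff)
    finally show ?thesis using k4 by simp
  qed
  moreover have "m22 (comb e) = d"
  proof -
    have "k 4 * m22 (comb e) = - (k 0 * snd (row 0) + k 1 * snd (row 1) + k 2 * snd (row 2) + k 3 * snd (row 3))"
      unfolding rows e_def using k4 by (simp add: field_simps)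
    also have "\<dots> = k 4 * d" using s(2) unfolding ex5 row4 by (simp add: add_eq_0_iff)
    finally show ?thesis using k4 by simp
  qed
  ultimately show "\<exists>g\<in>A. m21 g = c \<and> m22 g = d" by blast
qed

text \<open>Elements of A are determined by their bottom rows, so relations are tested there. The
  element t with row (0, \<delta>) generates a copy of E, which a unipotent conjugation turns into
  the matrices diag(cj d, d). The element j whose row becomes (1, 0) induces \<open>cj\<close> on
  this copy, and its square is the scalar w.\<close>

lemma DF_structure:
  assumes A: "is_DF_image F A"
  shows "\<exists>w y. w \<in> F \<and> \<not> hil F d0 w \<and>
    (\<forall>g\<in>A. g = umat y (M2 (cj (m22 g + y * m21 g)) (w * cj (m21 g)) (m21 g) (m22 g + y * m21 g)))"
proof -
  note D1 = A[unfolded is_DF_image_def]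
  note D2 = conjunct2[OF D1]
  note D3 = conjunct2[OF D2]
  note D4 = conjunct2[OF D3]
  note D5 = conjunct2[OF D4]
  note one = conjunct1[OF D1] and centre = conjunct2[OF D5]
  have add: "\<And>g h. g \<in> A \<Longrightarrow> h \<in> A \<Longrightarrow> madd g h \<in> A"
    and mul: "\<And>g h. g \<in> A \<Longrightarrow> h \<in> A \<Longrightarrow> mmul g h \<in> A" using conjunct1[OF D2] by blast+
  have sc: "\<And>c g. c \<in> F \<Longrightarrow> g \<in> A \<Longrightarrow> mscal c g \<in> A" using conjunct1[OF D3] by blast
  have inv: "\<And>g. g \<in> A \<Longrightarrow> g \<noteq> mzero \<Longrightarrow> \<exists>h\<in>A. mmul g h = mone" using conjunct1[OF D5] by blast
  note defs = mmul_def madd_def mscal_def mone_def mzero_def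
  have eqI: "g = h" if "g \<in> A" "h \<in> A" "m21 g = m21 h" "m22 g = m22 h" for g h
  proof -
    have "madd g (mscal (- 1) h) \<in> A" by (rule add[OF that(1) sc[OF _ that(2)]]) simp
    then have "madd g (mscal (- 1) h) = mzero"
      by (rule DF_rows(1)[OF A]) (use that(3,4) in \<open>auto simp: madd_def mscal_def\<close>)
    then show ?thesis by (cases g; cases h) (simp add: defs)
  qed
  obtain t where t: "t \<in> A" "m21 t = 0" "m22 t = \<delta>" using DF_rows(2)[OF A, of 0 \<delta>] by blast
  have d0A: "mscal d0 mone \<in> A" using sc one by simp
  have tt: "mmul t t = mscal d0 mone"
    by (rule eqI[OF mul[OF t(1,1)] d0A]) (use t(2,3) in \<open>auto simp: defs d0_def power2_eq_square\<close>)
  \<comment> \<open>The square of \<open>m11 t\<close> is \<open>d0\<close>. The root \<delta> would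
    make t a scalar matrix, hence central, but the centre of A consists of scalars from F.\<close>
  have t11: "m11 t = - \<delta>"
  proof (rule ccontr)
    assume ne: "m11 t \<noteq> - \<delta>"
    have "m11 t * m11 t = \<delta> * \<delta>" using tt t unfolding d0_def by (simp add: defs power2_eq_square)
    then have a: "m11 t = \<delta>" using ne by (simp add: square_eq_iff)
    have "m11 t * m12 t + m12 t * \<delta> = 0" using tt t by (simp add: defs)
    then have "2 * \<delta> * m12 t = 0" unfolding a by (simp add: algebra_simps)
    then have "m12 t = 0" by simp
    then have "t = mscal \<delta> mone" using a t by (cases t) (simp add: defs)
    then have "t \<in> {a\<in>A. \<forall>b\<in>A. mmul a b = mmul b a}" using t by (auto simp: defs mult.commute)
    then obtain c where "c \<in> F" "t = mscal c mone" unfolding centre by blast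
    then show False using t \<delta>_notin by (auto simp: defs)
  qed
  \<comment> \<open>The unipotent parameter for which conjugation diagonalises t.\<close>
  define y where "y = m12 t / (2 * \<delta>)"
  have t12: "m12 t = 2 * \<delta> * y" unfolding y_def by simp
  have tore: "\<exists>g\<in>A. g = M2 (cj d) (y * (d - cj d)) 0 d" for d
  proof -
    define g where "g = madd (mscal (re d) mone) (mscal (im d) t)"
    have gA: "g \<in> A" unfolding g_def using add sc one t by simp
    have g: "g = M2 (re d - im d * \<delta>) (im d * (2 * \<delta> * y)) 0 (re d + im d * \<delta>)"
      unfolding g_def using t(2,3) t11 t12 by (simp add: madd_def mscal_def mone_def)
    have e1: "re d + im d * \<delta> = d" by (rule re_im[symmetric])
    have e2: "re d - im d * \<delta> = cj d" using cj_eq[of "re d" "im d"] unfolding e1 by simp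
    have e3: "im d * (2 * \<delta> * y) = y * (d - cj d)" unfolding im_def by (simp add: field_simps)
    show ?thesis using gA g unfolding e1 e2 e3 by blast
  qed
  obtain j where j: "j \<in> A" "m21 j = 1" "m22 j = - y" using DF_rows(2)[OF A, of 1 "- y"] by blast
  have tu: "M2 (cj d) (y * (d - cj d)) 0 d = umat y (M2 (cj d) 0 0 d)" for d
    unfolding umat_def by (simp add: algebra_simps)
  have tA: "umat y (M2 (cj d) 0 0 d) \<in> A" for d using tore[of d] unfolding tu by blast
  define J where "J = umat (- y) j"
  have ju: "j = umat y J" unfolding J_def umat_def by (cases j) (simp add: algebra_simps power2_eq_square)
  have J: "m21 J = 1" "m22 J = 0" unfolding J_def umat_def using j by simp_all
  have comm: "mmul J (M2 (cj d) 0 0 d) = mmul (M2 d 0 0 (cj d)) J" for d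
  proof -
    have "mmul j (umat y (M2 (cj d) 0 0 d)) = mmul (umat y (M2 (cj (cj d)) 0 0 (cj d))) j"
    proof (rule eqI)
      show "mmul j (umat y (M2 (cj d) 0 0 d)) \<in> A" "mmul (umat y (M2 (cj (cj d)) 0 0 (cj d))) j \<in> A"
        by (rule mul[OF j(1) tA], rule mul[OF tA j(1)])
    qed (simp_all add: ju mmul_umat, simp_all add: umat_def mmul_def J)
    then have "umat y (mmul J (M2 (cj d) 0 0 d)) = umat y (mmul (M2 d 0 0 (cj d)) J)"
      unfolding ju mmul_umat by simp
    then have "umat (- y) (umat y (mmul J (M2 (cj d) 0 0 d))) = umat (- y) (umat y (mmul (M2 d 0 0 (cj d)) J))" by simp
    moreover have "umat (- y) (umat y g) = g" for g
      unfolding umat_def by (cases g) (simp add: algebra_simps power2_eq_square)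
    ultimately show ?thesis by simp
  qed
  have J11: "m11 J = 0"
  proof -
    have "m11 J * - \<delta> = \<delta> * m11 J" using comm[of \<delta>] by (simp add: mmul_def)
    then have "2 * \<delta> * m11 J = 0" by (simp add: algebra_simps)
    then show ?thesis by simp
  qed
  define w where "w = m12 J"
  have Je: "J = M2 0 w 1 0" unfolding w_def using J J11 by (cases J) simp
  \<comment> \<open>Comparing rows shows that j^2 corresponds to diag(cj w, w), while direct
    multiplication gives w times the identity; so w lies in F.\<close>
  have "mmul j j = umat y (M2 (cj w) 0 0 w)"
  proof (rule eqI)
    show "mmul j j \<in> A" "umat y (M2 (cj w) 0 0 w) \<in> A" by (rule mul[OF j(1) j(1)], rule tA)
  qed (simp_all add: ju Je mmul_umat, simp_all add: umat_def mmul_def)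
  then have "m11 (mmul j j) = cj w" unfolding umat_def by simp
  moreover have "m11 (mmul j j) = w" unfolding ju Je mmul_umat by (simp add: umat_def mmul_def)
  ultimately have wF: "w \<in> F" using cj_fixed by simp
  have gen: "umat y (M2 (cj d) (w * cj c) c d) \<in> A" for c d
  proof -
    have "madd (umat y (M2 (cj d) 0 0 d)) (mmul (umat y (M2 (cj c) 0 0 c)) j) \<in> A"
      by (rule add[OF tA mul[OF tA j(1)]])
    moreover have "madd (umat y (M2 (cj d) 0 0 d)) (mmul (umat y (M2 (cj c) 0 0 c)) j) =
        umat y (M2 (cj d) (w * cj c) c d)"
      unfolding ju Je mmul_umat by (simp add: umat_def mmul_def madd_def algebra_simps)
    ultimately show ?thesis by simp
  qed
  \<comment> \<open>If w were a norm N z, the element with lower left entry 1 that corresponds to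
    (1, z) would have determinant 0 and no inverse.\<close>
  have "\<not> hil F d0 w"
  proof
    assume "hil F d0 w"
    then obtain z where z: "w = nm z" using hil_d0_iff wF by blast
    define g where "g = umat y (M2 (cj z) (w * cj 1) 1 z)"
    have g: "g \<in> A" unfolding g_def by (rule gen)
    have "g \<noteq> mzero" unfolding g_def umat_def mzero_def by simp
    then obtain h where h: "h \<in> A" "mmul g h = mone" using inv g by blast
    have "mdet g * mdet h = mdet (mmul g h)" unfolding mdet_def mmul_def by (simp add: algebra_simps)
    also have "\<dots> = 1" unfolding h mdet_def mone_def by simp
    finally have "mdet g \<noteq> 0" by auto
    then show False unfolding g_def mdet_umat unfolding mdet_def z nm_def by (simp add: mult.commute)
  qed
  moreover have "g = umat y (M2 (cj (m22 g + y * m21 g)) (w * cj (m21 g)) (m21 g) (m22 g + y * m21 g))" if "g \<in> A" for g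
    by (rule eqI[OF that gen]) (simp_all add: umat_def)
  ultimately show ?thesis using wF by blast
qed

text \<open>A is a unipotent conjugate of the matrices \<open>dm p\<close>, and \<open>beta\<close>
  is unchanged by this conjugation, so the splitting on rows is transported through
  \<open>pr\<close>.\<close>

lemma splits_DF:
  assumes A: "is_DF_image F A"
  shows "splits_Cstar (A - {mzero})"
proof -
  obtain w y where w: "w \<in> F" "\<not> hil F d0 w"
    and form: "\<And>g. g \<in> A \<Longrightarrow> g = umat y (M2 (cj (m22 g + y * m21 g)) (w * cj (m21 g)) (m21 g) (m22 g + y * m21 g))"
    using DF_structure[OF A] by blast
  interpret quaternion_algebra F f \<delta> w
    by unfold_locales (use w in auto)
  obtain S :: "'a \<times> 'a \<Rightarrow> complex" where S: "\<And>p. p \<noteq> (0, 0) \<Longrightarrow> S p \<noteq> 0"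
    "\<And>p q. p \<noteq> (0, 0) \<Longrightarrow> q \<noteq> (0, 0) \<Longrightarrow> S (qm p q) = S p * S q * of_int (bt p q)"
    using ex_splitting_pairs by blast
  define pr where "pr = (\<lambda>g. (m21 g, m22 g + y * m21 g))"
  have pru: "pr (umat y (dm p)) = p" for p unfolding pr_def umat_def dm_def by simp
  have g: "g = umat y (dm (pr g))" if "g \<in> A" for g using form[OF that] unfolding dm_def pr_def by simp
  have nz: "pr g \<noteq> (0, 0)" if "g \<in> A - {mzero}" for g
  proof
    assume "pr g = (0, 0)"
    then have "g = umat y (dm (0, 0))" using g[of g] that by simp
    then show False using that unfolding umat_def dm_def mzero_def by simp
  qed
  show ?thesis unfolding splits_Cstar_def
  proof (intro exI[of _ "\<lambda>g. S (pr g)"] conjI ballI)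
    fix g assume gA: "g \<in> A - {mzero}"
    show "S (pr g) \<noteq> 0" by (rule S(1)[OF nz[OF gA]])
    fix h assume hA: "h \<in> A - {mzero}"
    define p q where "p = pr g" and "q = pr h"
    have pq: "p \<noteq> (0, 0)" "q \<noteq> (0, 0)" unfolding p_def q_def using nz gA hA by auto
    have ge: "g = umat y (dm p)" and he: "h = umat y (dm q)" unfolding p_def q_def using g gA hA by auto
    have "pr (mmul g h) = qm p q" unfolding ge he mmul_umat mmul_dm pru ..
    moreover have "beta g h = bt p q" unfolding ge he
      using beta_umat[of "dm p" "dm q" y] beta_dm[OF pq] pq by (simp add: mdet_dm)
    ultimately show "S (pr (mmul g h)) = S (pr g) * S (pr h) * of_int (beta g h)"
      using S(2)[OF pq] unfolding p_def q_def by simp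
  qed
qed

end

theorem theorem3p1:
  fixes F :: "'a::field_char_0 set"
  assumes "nonarch_local_field F"
    and "quadratic_ext F"
  shows "splits_twofold (GL2_over F) \<and>
         (\<forall>A. is_DF_image F A \<longrightarrow> splits_Cstar (A - {mzero}))"
proof -
  obtain f where f: "local_field F f" using nonarch_local_field_imp[OF assms(1)] by blast
  obtain \<delta> where "quadratic_extension F f \<delta>" using quadratic_ext_imp[OF f assms(2)] by blast
  then interpret quadratic_extension F f \<delta> .
  show ?thesis using splits_GL2 splits_DF by blast
qed

end
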